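(* Let $\boldsymbol{oGpd}_{\max}$ be the full sub-2-category of the 2-category $\boldsymbol{oGpd}$ (ordered groupoids, double functors, $\Lambda$-transformations) on those ordered groupoids in which every object is less than or equal to a unique maximal object, and let $\boldsymbol{lcCat}$ be the 2-category of left-cancellative categories, functors and natural transformations. The 2-functors $\mathbf{L}\colon \boldsymbol{oGpd}_{\max}\to\boldsymbol{lcCat}$ and $\mathbf{G}\colon\boldsymbol{lcCat}\to\boldsymbol{oGpd}_{\max}$ (defined in the context) define a 2-adjoint biequivalence $\boldsymbol{oGpd}_{\max}\simeq\boldsymbol{lcCat}$.
   Context: All categories are small. An ordered groupoid is a groupoid $\mathcal{G}$ with a partial order $\le$ on its arrows, inducing one on objects via identities ($A\le B$ iff $1_A\le 1_B$), such that: $a\le b$ implies $a^{-1}\le b^{-1}$; $a\le b$ and $c\le d$ imply $ac\le bd$ when both composites are defined; and for each $f\colon A\to B$ and $A'\le A$ there is a unique arrow $f|_{A'}\colon A'\to B'$ with domain $A'$ and $f|_{A'}\le f$. It is regarded as a double category: horizontal arrows are the groupoid arrows, there is a unique vertical arrow from $A$ to $B$ iff $A\le B$, and double cells are relations $g\le g'$ between horizontal arrows. A double functor (ordered functor) is an order-preserving functor of groupoids (it need not preserve maximal objects). For double functors $F,G\colon\mathcal{G}\to\mathcal{H}$: a horizontal transformation $\alpha\colon F\Rightarrow_h G$ is a family of horizontal arrows $\alpha_X\colon FX\to GX$ that is natural with respect to horizontal arrows and satisfies $\alpha_X\le\alpha_{Y}$ whenever $X\le Y$; $F\le G$ means $Fh\le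 Gh$ for all horizontal arrows $h$. A $\Lambda$-transformation $(\alpha,\le)\colon F\Rightarrow G$ consists of a double functor $G'\colon \mathcal{G}\to\mathcal{H}$ with $G'\le G$ and a horizontal transformation $\alpha\colon F\Rightarrow_h G'$. The vertical composite of $(\alpha\colon F\Rightarrow_h G'\le G)$ and $(\gamma\colon G\Rightarrow_h H'\le H)$ has components $\gamma_X|_{G'X}\circ\alpha_X$, followed by the resulting inequality. Whiskering is given by $(\beta,\le)F=(\beta F,\le)$ and $H(\alpha,\le)=(H\alpha,\le)$, and horizontal composition is derived from whiskering and vertical composition. A category is left-cancellative if all its arrows are monomorphisms. The 2-functor $\mathbf{L}$: $\mathbf{L}(\mathcal{G})$ has the objects of $\mathcal{G}$; an arrow $A\to B$ is a pair $(h,\le)$ consisting of a horizontal arrow $h\colon A\to B'$ with $B'\le B$; the composite of $(h\colon A\to B'\le B)$ and $(k\colon B\to C'\le C)$ is $(k|_{B'}\circ h,\le)$. On double functors $\mathbf{L}(F)$ is $F$ on objects and $\mathbf{L}(F)(h,\le)=(F(h),\le)$. For a $\Lambda$-transformation, $\mathbf{L}(\alpha,\le)$ has components $(\alpha_X,\le)$. The 2-functor $\mathbf{G}$: the objects of $\mathbf{G}(\mathcal{C})$ are subobjects in $\mathcal{C}$, i.e. classes $[m\colon A\to B]$ of arrows with $[m]=[m']$ iff $m=m'k$ for some isomorphism $k$. Horizontal arrows $[m]\to[n]$ are classes $[m,n]$ of spans $B\xleftarrow{m}A\xrightarrow{n}C$, with $[m,n]=[m',n']$ iff there is an isomorphism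 $h$ with $m=m'h$, $n=n'h$; the composite of $[k,m]\colon[k]\to[m]$ and $[m',n]\colon[m']\to[n]$, where $m=m'h$ with $h$ an isomorphism, is $[k,nh]$. The order is: $[n]\le[n']$ iff $n=n'h$ for some arrow $h$; $[m,n]\le[m',n']$ iff there is an arrow $h$ with $m=m'h$ and $n=n'h$. (Each object $[m\colon A\to B]$ lies below the maximal object $[1_B]$, so $\mathbf{G}$ lands in $\boldsymbol{oGpd}_{\max}$.) On functors, $\mathbf{G}(K)[m]=[Km]$ and $\mathbf{G}(K)[m,n]=[Km,Kn]$. For a natural transformation $\theta\colon K\Rightarrow K'$, $\mathbf{G}(\theta)$ is the $\Lambda$-transformation with components $[Km]\xrightarrow{[Km,\,K'm\circ\theta_{\mathrm{dom}(m)}]}[K'm\circ\theta_{\mathrm{dom}(m)}]\le[K'm]$, the intermediate double functor being $[m]\mapsto[K'm\circ\theta_{\mathrm{dom}(m)}]$, $[m,n]\mapsto[K'm\circ\theta_{\mathrm{dom}(m)},K'n\circ\theta_{\mathrm{dom}(n)}]$. A 2-adjoint biequivalence is a 2-adjunction (here $\mathbf{G}$ left 2-adjoint to $\mathbf{L}$) all of whose unit and counit components are equivalences (have pseudo-inverses) in the respective 2-categories. *)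

theory Defs
  imports Main "HOL-Library.FuncSet" "HOL-Library.Infinite_Typeclass"
begin

section \<open>Small categories and their functors\<close>

text \<open>
  A category is small when its objects and arrows are elements of the universe, which is a fixed
  but arbitrary infinite type \<open>'u\<close>. All structure maps are extensional (\<open>undefined\<close> outside
  their domain), so that equality of records is equality of the mathematical objects.
  \<open>Comp C (g, f)\<close> is the composite ``\<open>g\<close> after \<open>f\<close>''.
\<close>

record 'u cat =
  Obj :: "'u set"
  Arr :: "'u set"
  Dom :: "'u \<Rightarrow> 'u"
  Cod :: "'u \<Rightarrow> 'u"
  Ident :: "'u \<Rightarrow> 'u"
  Comp :: "'u \<times> 'u \<Rightarrow> 'u"

abbreviation cmp :: "('u, 'm) cat_scheme \<Rightarrow> 'u \<Rightarrow> 'u \<Rightarrow> 'u" (infixl "\<cdot>\<index>" 70)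
  where "g \<cdot>\<^bsub>C\<^esub> f \<equiv> Comp C (g, f)"

definition composable :: "('u, 'm) cat_scheme \<Rightarrow> ('u \<times> 'u) set" where
  "composable C = {(g, f). g \<in> Arr C \<and> f \<in> Arr C \<and> Dom C g = Cod C f}"

definition hom :: "('u, 'm) cat_scheme \<Rightarrow> 'u \<Rightarrow> 'u \<Rightarrow> 'u set" where
  "hom C A B = {f \<in> Arr C. Dom C f = A \<and> Cod C f = B}"

locale category =
  fixes C :: "('u, 'm) cat_scheme" (structure)
  assumes Dom: "Dom C \<in> Arr C \<rightarrow>\<^sub>E Obj C"
    and Cod: "Cod C \<in> Arr C \<rightarrow>\<^sub>E Obj C"
    and Ident: "Ident C \<in> Obj C \<rightarrow>\<^sub>E Arr C"
    and Comp: "Comp C \<in> composable C \<rightarrow>\<^sub>E Arr C"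
    and Ident_hom: "A \<in> Obj C \<Longrightarrow> Ident C A \<in> hom C A A"
    and Comp_hom: "(g, f) \<in> composable C \<Longrightarrow> g \<cdot> f \<in> hom C (Dom C f) (Cod C g)"
    and Comp_Ident: "f \<in> Arr C \<Longrightarrow> f \<cdot> Ident C (Dom C f) = f"
    and Ident_Comp: "f \<in> Arr C \<Longrightarrow> Ident C (Cod C f) \<cdot> f = f"
    and Comp_assoc:
      "\<lbrakk>(h, g) \<in> composable C; (g, f) \<in> composable C\<rbrakk> \<Longrightarrow> (h \<cdot> g) \<cdot> f = h \<cdot> (g \<cdot> f)"

definition inverse_arrows :: "('u, 'm) cat_scheme \<Rightarrow> 'u \<Rightarrow> 'u \<Rightarrow> bool" where
  "inverse_arrows C f g \<longleftrightarrow> f \<in> Arr C \<and> g \<in> hom C (Cod C f) (Dom C f) \<and>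
     g \<cdot>\<^bsub>C\<^esub> f = Ident C (Dom C f) \<and> f \<cdot>\<^bsub>C\<^esub> g = Ident C (Cod C f)"

definition iso :: "('u, 'm) cat_scheme \<Rightarrow> 'u \<Rightarrow> bool" where
  "iso C f \<longleftrightarrow> (\<exists>g. inverse_arrows C f g)"

definition inv_arrow :: "('u, 'm) cat_scheme \<Rightarrow> 'u \<Rightarrow> 'u" where
  "inv_arrow C f = (THE g. inverse_arrows C f g)"

definition mono_arrow :: "('u, 'm) cat_scheme \<Rightarrow> 'u \<Rightarrow> bool" where
  "mono_arrow C f \<longleftrightarrow> f \<in> Arr C \<and>
     (\<forall>g h. (f, g) \<in> composable C \<and> (f, h) \<in> composable C \<and> Dom C g = Dom C h \<and>
        f \<cdot>\<^bsub>C\<^esub> g = f \<cdot>\<^bsub>C\<^esub> h \<longrightarrow> g = h)"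

definition left_cancellative :: "('u, 'm) cat_scheme \<Rightarrow> bool" where
  "left_cancellative C \<longleftrightarrow> (\<forall>f \<in> Arr C. mono_arrow C f)"

text \<open>The parameter \<open>'c\<close> is the type of the source and target, categories or ordered groupoids.\<close>

record ('u, 'c) func =
  fdom :: 'c
  fcod :: 'c
  omap :: "'u \<Rightarrow> 'u"
  amap :: "'u \<Rightarrow> 'u"

locale is_functor =
  fixes F :: "('u, ('u, 'm) cat_scheme) func"
  assumes fdom: "category (fdom F)"
    and fcod: "category (fcod F)"
    and omap: "omap F \<in> Obj (fdom F) \<rightarrow>\<^sub>E Obj (fcod F)"
    and amap: "amap F \<in> Arr (fdom F) \<rightarrow>\<^sub>E Arr (fcod F)"
    and amap_hom: "f \<in> Arr (fdom F) \<Longrightarrow>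
      amap F f \<in> hom (fcod F) (omap F (Dom (fdom F) f)) (omap F (Cod (fdom F) f))"
    and amap_Ident: "A \<in> Obj (fdom F) \<Longrightarrow>
      amap F (Ident (fdom F) A) = Ident (fcod F) (omap F A)"
    and amap_Comp: "(g, f) \<in> composable (fdom F) \<Longrightarrow>
      amap F (g \<cdot>\<^bsub>fdom F\<^esub> f) = amap F g \<cdot>\<^bsub>fcod F\<^esub> amap F f"

definition id_func :: "('u, 'm) cat_scheme \<Rightarrow> ('u, ('u, 'm) cat_scheme) func" where
  "id_func C = \<lparr>fdom = C, fcod = C, omap = (\<lambda>A \<in> Obj C. A), amap = (\<lambda>f \<in> Arr C. f)\<rparr>"

definition comp_func ::
  "('u, ('u, 'm) cat_scheme) func \<Rightarrow> ('u, ('u, 'm) cat_scheme) func \<Rightarrow> ('u, ('u, 'm) cat_scheme) func"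
  where "comp_func G F =
    \<lparr>fdom = fdom F, fcod = fcod G,
     omap = compose (Obj (fdom F)) (omap G) (omap F),
     amap = compose (Arr (fdom F)) (amap G) (amap F)\<rparr>"

definition parallel :: "('u, 'c) func \<Rightarrow> ('u, 'c) func \<Rightarrow> bool" where
  "parallel F G \<longleftrightarrow> fdom F = fdom G \<and> fcod F = fcod G"

text \<open>Naturality of a family of arrows \<open>F X \<rightarrow> G X\<close>.\<close>

definition natural ::
  "('u, ('u, 'm) cat_scheme) func \<Rightarrow> ('u, ('u, 'm) cat_scheme) func \<Rightarrow> ('u \<Rightarrow> 'u) \<Rightarrow> bool" where
  "natural F G a \<longleftrightarrow> a \<in> extensional (Obj (fdom F)) \<and>
     (\<forall>X \<in> Obj (fdom F). a X \<in> hom (fcod F) (omap F X) (omap G X)) \<and>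
     (\<forall>f \<in> Arr (fdom F). amap G f \<cdot>\<^bsub>fcod F\<^esub> a (Dom (fdom F) f) =
                          a (Cod (fdom F) f) \<cdot>\<^bsub>fcod F\<^esub> amap F f)"

record 'u ntrans =
  nsrc :: "('u, 'u cat) func"
  ntrg :: "('u, 'u cat) func"
  ncomp :: "'u \<Rightarrow> 'u"

definition natural_transformation :: "'u ntrans \<Rightarrow> bool" where
  "natural_transformation t \<longleftrightarrow> is_functor (nsrc t) \<and> is_functor (ntrg t) \<and>
     parallel (nsrc t) (ntrg t) \<and> natural (nsrc t) (ntrg t) (ncomp t)"

definition nid :: "('u, 'u cat) func \<Rightarrow> 'u ntrans" where
  "nid F = \<lparr>nsrc = F, ntrg = F, ncomp = (\<lambda>X \<in> Obj (fdom F). Ident (fcod F) (omap F X))\<rparr>"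

definition nvcomp :: "'u ntrans \<Rightarrow> 'u ntrans \<Rightarrow> 'u ntrans" where
  "nvcomp u t = \<lparr>nsrc = nsrc t, ntrg = ntrg u,
     ncomp = (\<lambda>X \<in> Obj (fdom (nsrc t)). ncomp u X \<cdot>\<^bsub>fcod (nsrc t)\<^esub> ncomp t X)\<rparr>"

definition nhcomp :: "'u ntrans \<Rightarrow> 'u ntrans \<Rightarrow> 'u ntrans" where
  "nhcomp u t = \<lparr>nsrc = comp_func (nsrc u) (nsrc t), ntrg = comp_func (ntrg u) (ntrg t),
     ncomp = (\<lambda>X \<in> Obj (fdom (nsrc t)).
        ncomp u (omap (ntrg t) X) \<cdot>\<^bsub>fcod (nsrc u)\<^esub> amap (nsrc u) (ncomp t X))\<rparr>"


section \<open>Ordered groupoids\<close>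

record 'u ogpd = "'u cat" +
  Le :: "('u \<times> 'u) set"

definition obj_le :: "('u, 'm) ogpd_scheme \<Rightarrow> 'u \<Rightarrow> 'u \<Rightarrow> bool" where
  "obj_le G A B \<longleftrightarrow> A \<in> Obj G \<and> B \<in> Obj G \<and> (Ident G A, Ident G B) \<in> Le G"

locale ordered_groupoid = category G for G :: "('u, 'm) ogpd_scheme" (structure) +
  assumes all_iso: "f \<in> Arr G \<Longrightarrow> iso G f"
    and Le_order: "partial_order_on (Arr G) (Le G)"
    and Le_inv: "(a, b) \<in> Le G \<Longrightarrow> (inv_arrow G a, inv_arrow G b) \<in> Le G"
    and Le_Comp: "\<lbrakk>(a, b) \<in> Le G; (c, d) \<in> Le G; (a, c) \<in> composable G; (b, d) \<in> composable G\<rbrakk>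
      \<Longrightarrow> (a \<cdot> c, b \<cdot> d) \<in> Le G"
    and ex1_restr: "\<lbrakk>f \<in> Arr G; obj_le G A' (Dom G f)\<rbrakk>
      \<Longrightarrow> \<exists>!f'. (f', f) \<in> Le G \<and> Dom G f' = A'"

definition restr :: "('u, 'm) ogpd_scheme \<Rightarrow> 'u \<Rightarrow> 'u \<Rightarrow> 'u" where
  "restr G f A' = (THE f'. (f', f) \<in> Le G \<and> Dom G f' = A')"

definition maximal_obj :: "('u, 'm) ogpd_scheme \<Rightarrow> 'u \<Rightarrow> bool" where
  "maximal_obj G M \<longleftrightarrow> M \<in> Obj G \<and> (\<forall>B. obj_le G M B \<longrightarrow> B = M)"

definition has_unique_maximal :: "('u, 'm) ogpd_scheme \<Rightarrow> bool" where
  "has_unique_maximal G \<longleftrightarrow> (\<forall>A \<in> Obj G. \<exists>!M. maximal_obj G M \<and> obj_le G A M)"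

type_synonym 'u ofunc = "('u, 'u ogpd) func"

definition double_functor :: "'u ofunc \<Rightarrow> bool" where
  "double_functor F \<longleftrightarrow> ordered_groupoid (fdom F) \<and> ordered_groupoid (fcod F) \<and> is_functor F \<and>
     (\<forall>a b. (a, b) \<in> Le (fdom F) \<longrightarrow> (amap F a, amap F b) \<in> Le (fcod F))"

definition func_le :: "'u ofunc \<Rightarrow> 'u ofunc \<Rightarrow> bool" where
  "func_le F G \<longleftrightarrow> parallel F G \<and> (\<forall>h \<in> Arr (fdom F). (amap F h, amap G h) \<in> Le (fcod F))"

definition horizontal_transformation :: "'u ofunc \<Rightarrow> 'u ofunc \<Rightarrow> ('u \<Rightarrow> 'u) \<Rightarrow> bool" where
  "horizontal_transformation F G a \<longleftrightarrow> parallel F G \<and> natural F G a \<and>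
     (\<forall>X Y. obj_le (fdom F) X Y \<longrightarrow> (a X, a Y) \<in> Le (fcod F))"

text \<open>
  A \<open>\<Lambda>\<close>-transformation from \<open>lsrc\<close> to \<open>ltrg\<close>: a horizontal transformation \<open>lcomp\<close> from \<open>lsrc\<close> to
  the intermediate double functor \<open>lmid\<close>, which lies below \<open>ltrg\<close>.
\<close>

record 'u ltrans =
  lsrc :: "'u ofunc"
  ltrg :: "'u ofunc"
  lmid :: "'u ofunc"
  lcomp :: "'u \<Rightarrow> 'u"

definition lambda_transformation :: "'u ltrans \<Rightarrow> bool" where
  "lambda_transformation t \<longleftrightarrow>
     double_functor (lsrc t) \<and> double_functor (ltrg t) \<and> double_functor (lmid t) \<and>
     func_le (lmid t) (ltrg t) \<and> horizontal_transformation (lsrc t) (lmid t) (lcomp t)"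

definition lid :: "'u ofunc \<Rightarrow> 'u ltrans" where
  "lid F = \<lparr>lsrc = F, ltrg = F, lmid = F,
     lcomp = (\<lambda>X \<in> Obj (fdom F). Ident (fcod F) (omap F X))\<rparr>"

text \<open>
  For \<open>t = (\<alpha> : F \<Rightarrow> G' \<le> G)\<close> and \<open>u = (\<gamma> : G \<Rightarrow> H' \<le> H)\<close> the intermediate double functor of the
  vertical composite sends \<open>X\<close> to the codomain of \<open>\<gamma>\<^sub>X\<close> restricted to \<open>G' X\<close>, and an arrow \<open>h\<close> to
  the corresponding restriction of \<open>H' h\<close>.
\<close>

definition lvcomp :: "'u ltrans \<Rightarrow> 'u ltrans \<Rightarrow> 'u ltrans" where
  "lvcomp u t =
    (let C = fdom (lsrc t); D = fcod (lsrc t);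
         g = (\<lambda>X. restr D (lcomp u X) (omap (lmid t) X))
     in \<lparr>lsrc = lsrc t, ltrg = ltrg u,
         lmid = \<lparr>fdom = C, fcod = D,
                 omap = (\<lambda>X \<in> Obj C. Cod D (g X)),
                 amap = (\<lambda>h \<in> Arr C. restr D (amap (lmid u) h) (Cod D (g (Dom C h))))\<rparr>,
         lcomp = (\<lambda>X \<in> Obj C. g X \<cdot>\<^bsub>D\<^esub> lcomp t X)\<rparr>)"

definition lwhisk_right :: "'u ltrans \<Rightarrow> 'u ofunc \<Rightarrow> 'u ltrans" where
  "lwhisk_right t F = \<lparr>lsrc = comp_func (lsrc t) F, ltrg = comp_func (ltrg t) F,
     lmid = comp_func (lmid t) F, lcomp = compose (Obj (fdom F)) (lcomp t) (omap F)\<rparr>"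

definition lwhisk_left :: "'u ofunc \<Rightarrow> 'u ltrans \<Rightarrow> 'u ltrans" where
  "lwhisk_left H t = \<lparr>lsrc = comp_func H (lsrc t), ltrg = comp_func H (ltrg t),
     lmid = comp_func H (lmid t), lcomp = compose (Obj (fdom (lsrc t))) (amap H) (lcomp t)\<rparr>"

definition lhcomp :: "'u ltrans \<Rightarrow> 'u ltrans \<Rightarrow> 'u ltrans" where
  "lhcomp u t = lvcomp (lwhisk_right u (ltrg t)) (lwhisk_left (lsrc u) t)"


section \<open>Strict 2-categories, 2-functors, 2-adjunctions\<close>

record ('o, 'm, 'c) two_cat =
  Obj0 :: "'o set"
  Mor1 :: "'m set"
  Cell2 :: "'c set"
  src1 :: "'m \<Rightarrow> 'o"
  trg1 :: "'m \<Rightarrow> 'o"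
  src2 :: "'c \<Rightarrow> 'm"
  trg2 :: "'c \<Rightarrow> 'm"
  id1 :: "'o \<Rightarrow> 'm"
  comp1 :: "'m \<Rightarrow> 'm \<Rightarrow> 'm"
  id2 :: "'m \<Rightarrow> 'c"
  vcomp :: "'c \<Rightarrow> 'c \<Rightarrow> 'c"
  hcomp :: "'c \<Rightarrow> 'c \<Rightarrow> 'c"

definition hom1 :: "('o, 'm, 'c) two_cat \<Rightarrow> 'o \<Rightarrow> 'o \<Rightarrow> 'm set" where
  "hom1 K A B = {f \<in> Mor1 K. src1 K f = A \<and> trg1 K f = B}"

definition hom2 :: "('o, 'm, 'c) two_cat \<Rightarrow> 'm \<Rightarrow> 'm \<Rightarrow> 'c set" where
  "hom2 K f g = {a \<in> Cell2 K. src2 K a = f \<and> trg2 K a = g}"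

abbreviation src0 :: "('o, 'm, 'c) two_cat \<Rightarrow> 'c \<Rightarrow> 'o" where
  "src0 K a \<equiv> src1 K (src2 K a)"

abbreviation trg0 :: "('o, 'm, 'c) two_cat \<Rightarrow> 'c \<Rightarrow> 'o" where
  "trg0 K a \<equiv> trg1 K (src2 K a)"

locale two_category =
  fixes K :: "('o, 'm, 'c) two_cat"
  assumes src1: "f \<in> Mor1 K \<Longrightarrow> src1 K f \<in> Obj0 K"
    and trg1: "f \<in> Mor1 K \<Longrightarrow> trg1 K f \<in> Obj0 K"
    and id1: "A \<in> Obj0 K \<Longrightarrow> id1 K A \<in> hom1 K A A"
    and comp1: "\<lbrakk>f \<in> Mor1 K; g \<in> Mor1 K; trg1 K f = src1 K g\<rbrakk>
      \<Longrightarrow> comp1 K g f \<in> hom1 K (src1 K f) (trg1 K g)"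
    and comp1_id1: "f \<in> Mor1 K \<Longrightarrow> comp1 K f (id1 K (src1 K f)) = f"
    and id1_comp1: "f \<in> Mor1 K \<Longrightarrow> comp1 K (id1 K (trg1 K f)) f = f"
    and comp1_assoc: "\<lbrakk>f \<in> Mor1 K; g \<in> Mor1 K; h \<in> Mor1 K; trg1 K f = src1 K g; trg1 K g = src1 K h\<rbrakk>
      \<Longrightarrow> comp1 K (comp1 K h g) f = comp1 K h (comp1 K g f)"
    and src2: "a \<in> Cell2 K \<Longrightarrow> src2 K a \<in> Mor1 K"
    and trg2: "a \<in> Cell2 K \<Longrightarrow> trg2 K a \<in> hom1 K (src0 K a) (trg0 K a)"
    and id2: "f \<in> Mor1 K \<Longrightarrow> id2 K f \<in> hom2 K f f"
    and vcomp: "\<lbrakk>a \<in> Cell2 K; b \<in> Cell2 K; trg2 K a = src2 K b\<rbrakk>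
      \<Longrightarrow> vcomp K b a \<in> hom2 K (src2 K a) (trg2 K b)"
    and vcomp_id2: "a \<in> Cell2 K \<Longrightarrow> vcomp K a (id2 K (src2 K a)) = a"
    and id2_vcomp: "a \<in> Cell2 K \<Longrightarrow> vcomp K (id2 K (trg2 K a)) a = a"
    and vcomp_assoc: "\<lbrakk>a \<in> Cell2 K; b \<in> Cell2 K; c \<in> Cell2 K; trg2 K a = src2 K b; trg2 K b = src2 K c\<rbrakk>
      \<Longrightarrow> vcomp K (vcomp K c b) a = vcomp K c (vcomp K b a)"
    and hcomp: "\<lbrakk>a \<in> Cell2 K; b \<in> Cell2 K; trg0 K a = src0 K b\<rbrakk>
      \<Longrightarrow> hcomp K b a \<in> hom2 K (comp1 K (src2 K b) (src2 K a)) (comp1 K (trg2 K b) (trg2 K a))"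
    and hcomp_id: "a \<in> Cell2 K \<Longrightarrow> hcomp K a (id2 K (id1 K (src0 K a))) = a"
    and id_hcomp: "a \<in> Cell2 K \<Longrightarrow> hcomp K (id2 K (id1 K (trg0 K a))) a = a"
    and hcomp_assoc: "\<lbrakk>a \<in> Cell2 K; b \<in> Cell2 K; c \<in> Cell2 K; trg0 K a = src0 K b; trg0 K b = src0 K c\<rbrakk>
      \<Longrightarrow> hcomp K (hcomp K c b) a = hcomp K c (hcomp K b a)"
    and hcomp_id2: "\<lbrakk>f \<in> Mor1 K; g \<in> Mor1 K; trg1 K f = src1 K g\<rbrakk>
      \<Longrightarrow> hcomp K (id2 K g) (id2 K f) = id2 K (comp1 K g f)"
    and interchange: "\<lbrakk>a \<in> Cell2 K; a' \<in> Cell2 K; b \<in> Cell2 K; b' \<in> Cell2 K;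
        trg2 K a = src2 K a'; trg2 K b = src2 K b'; trg0 K a = src0 K b\<rbrakk>
      \<Longrightarrow> hcomp K (vcomp K b' b) (vcomp K a' a) = vcomp K (hcomp K b' a') (hcomp K b a)"

definition full_sub :: "('o, 'm, 'c) two_cat \<Rightarrow> ('o \<Rightarrow> bool) \<Rightarrow> ('o, 'm, 'c) two_cat" where
  "full_sub K P = K
    \<lparr>Obj0 := {A \<in> Obj0 K. P A},
     Mor1 := {f \<in> Mor1 K. P (src1 K f) \<and> P (trg1 K f)},
     Cell2 := {a \<in> Cell2 K. P (src0 K a) \<and> P (trg0 K a)}\<rparr>"

record ('o, 'm, 'c, 'p, 'n, 'd) two_fun =
  map0 :: "'o \<Rightarrow> 'p"
  map1 :: "'m \<Rightarrow> 'n"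
  map2 :: "'c \<Rightarrow> 'd"

locale two_functor = A: two_category A + B: two_category B
  for A :: "('o, 'm, 'c) two_cat" and B :: "('p, 'n, 'd) two_cat" +
  fixes T :: "('o, 'm, 'c, 'p, 'n, 'd) two_fun"
  assumes map0: "X \<in> Obj0 A \<Longrightarrow> map0 T X \<in> Obj0 B"
    and map1: "f \<in> Mor1 A \<Longrightarrow> map1 T f \<in> hom1 B (map0 T (src1 A f)) (map0 T (trg1 A f))"
    and map2: "a \<in> Cell2 A \<Longrightarrow> map2 T a \<in> hom2 B (map1 T (src2 A a)) (map1 T (trg2 A a))"
    and map1_id1: "X \<in> Obj0 A \<Longrightarrow> map1 T (id1 A X) = id1 B (map0 T X)"
    and map1_comp1: "\<lbrakk>f \<in> Mor1 A; g \<in> Mor1 A; trg1 A f = src1 A g\<rbrakk>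
      \<Longrightarrow> map1 T (comp1 A g f) = comp1 B (map1 T g) (map1 T f)"
    and map2_id2: "f \<in> Mor1 A \<Longrightarrow> map2 T (id2 A f) = id2 B (map1 T f)"
    and map2_vcomp: "\<lbrakk>a \<in> Cell2 A; b \<in> Cell2 A; trg2 A a = src2 A b\<rbrakk>
      \<Longrightarrow> map2 T (vcomp A b a) = vcomp B (map2 T b) (map2 T a)"
    and map2_hcomp: "\<lbrakk>a \<in> Cell2 A; b \<in> Cell2 A; trg0 A a = src0 A b\<rbrakk>
      \<Longrightarrow> map2 T (hcomp A b a) = hcomp B (map2 T b) (map2 T a)"

definition id_two_fun :: "('o, 'm, 'c, 'o, 'm, 'c) two_fun" where
  "id_two_fun = \<lparr>map0 = id, map1 = id, map2 = id\<rparr>"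

definition comp_two_fun ::
  "('p, 'n, 'd, 'q, 'k, 'e) two_fun \<Rightarrow> ('o, 'm, 'c, 'p, 'n, 'd) two_fun \<Rightarrow>
   ('o, 'm, 'c, 'q, 'k, 'e) two_fun" where
  "comp_two_fun S T =
    \<lparr>map0 = map0 S \<circ> map0 T, map1 = map1 S \<circ> map1 T, map2 = map2 S \<circ> map2 T\<rparr>"

locale two_natural = S: two_functor A B S + T: two_functor A B T
  for A :: "('o, 'm, 'c) two_cat" and B :: "('p, 'n, 'd) two_cat" and S T +
  fixes \<eta> :: "'o \<Rightarrow> 'n"
  assumes component: "X \<in> Obj0 A \<Longrightarrow> \<eta> X \<in> hom1 B (map0 S X) (map0 T X)"
    and natural1: "f \<in> Mor1 A \<Longrightarrow>
      comp1 B (map1 T f) (\<eta> (src1 A f)) = comp1 B (\<eta> (trg1 A f)) (map1 S f)"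
    and natural2: "a \<in> Cell2 A \<Longrightarrow>
      hcomp B (map2 T a) (id2 B (\<eta> (src0 A a))) = hcomp B (id2 B (\<eta> (trg0 A a))) (map2 S a)"

text \<open>\<open>F : A \<rightarrow> B\<close> is left 2-adjoint to \<open>U : B \<rightarrow> A\<close> with unit \<open>\<eta>\<close> and counit \<open>\<epsilon>\<close>.\<close>

locale two_adjunction = F: two_functor A B F + U: two_functor B A U
    + unit: two_natural A A id_two_fun "comp_two_fun U F" \<eta>
    + counit: two_natural B B "comp_two_fun F U" id_two_fun \<epsilon>
  for A :: "('o, 'm, 'c) two_cat" and B :: "('p, 'n, 'd) two_cat" and F U \<eta> \<epsilon> +
  assumes triangle_F: "X \<in> Obj0 A \<Longrightarrow>
      comp1 B (\<epsilon> (map0 F X)) (map1 F (\<eta> X)) = id1 B (map0 F X)"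
    and triangle_U: "Y \<in> Obj0 B \<Longrightarrow>
      comp1 A (map1 U (\<epsilon> Y)) (\<eta> (map0 U Y)) = id1 A (map0 U Y)"

definition invertible2 :: "('o, 'm, 'c) two_cat \<Rightarrow> 'c \<Rightarrow> bool" where
  "invertible2 K a \<longleftrightarrow> a \<in> Cell2 K \<and> (\<exists>b \<in> hom2 K (trg2 K a) (src2 K a).
     vcomp K b a = id2 K (src2 K a) \<and> vcomp K a b = id2 K (trg2 K a))"

definition isomorphic1 :: "('o, 'm, 'c) two_cat \<Rightarrow> 'm \<Rightarrow> 'm \<Rightarrow> bool" where
  "isomorphic1 K f g \<longleftrightarrow> (\<exists>a \<in> hom2 K f g. invertible2 K a)"

definition equivalence1 :: "('o, 'm, 'c) two_cat \<Rightarrow> 'm \<Rightarrow> bool" where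
  "equivalence1 K f \<longleftrightarrow> f \<in> Mor1 K \<and> (\<exists>g \<in> hom1 K (trg1 K f) (src1 K f).
     isomorphic1 K (comp1 K g f) (id1 K (src1 K f)) \<and>
     isomorphic1 K (comp1 K f g) (id1 K (trg1 K f)))"

definition two_adjoint_biequivalence ::
  "('o, 'm, 'c) two_cat \<Rightarrow> ('p, 'n, 'd) two_cat \<Rightarrow>
   ('o, 'm, 'c, 'p, 'n, 'd) two_fun \<Rightarrow> ('p, 'n, 'd, 'o, 'm, 'c) two_fun \<Rightarrow> bool" where
  "two_adjoint_biequivalence A B F U \<longleftrightarrow> (\<exists>\<eta> \<epsilon>. two_adjunction A B F U \<eta> \<epsilon> \<and>
     (\<forall>X \<in> Obj0 A. equivalence1 A (\<eta> X)) \<and> (\<forall>Y \<in> Obj0 B. equivalence1 B (\<epsilon> Y)))"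


section \<open>The 2-categories of the theorem\<close>

type_synonym 'u Cat2 = "('u cat, ('u, 'u cat) func, 'u ntrans) two_cat"
type_synonym 'u oGpd2 = "('u ogpd, 'u ofunc, 'u ltrans) two_cat"

definition Cat :: "'u Cat2" where
  "Cat = \<lparr>Obj0 = {C. category C}, Mor1 = {F. is_functor F}, Cell2 = {t. natural_transformation t},
     src1 = fdom, trg1 = fcod, src2 = nsrc, trg2 = ntrg,
     id1 = id_func, comp1 = comp_func, id2 = nid, vcomp = nvcomp, hcomp = nhcomp\<rparr>"

definition lcCat :: "'u Cat2" where
  "lcCat = full_sub Cat left_cancellative"

definition oGpd :: "'u oGpd2" where
  "oGpd = \<lparr>Obj0 = {G. ordered_groupoid G}, Mor1 = {F. double_functor F},
     Cell2 = {t. lambda_transformation t},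
     src1 = fdom, trg1 = fcod, src2 = lsrc, trg2 = ltrg,
     id1 = id_func, comp1 = comp_func, id2 = lid, vcomp = lvcomp, hcomp = lhcomp\<rparr>"

definition oGpd_max :: "'u oGpd2" where
  "oGpd_max = full_sub oGpd has_unique_maximal"


section \<open>Pairs and classes inside the universe\<close>

text \<open>
  The arrows of \<open>L(G)\<close> are pairs and those of \<open>G(C)\<close> are classes of pairs. To stay in the universe
  \<open>'u\<close>, pairs are coded by a fixed injection \<open>'u \<times> 'u \<rightarrow> 'u\<close>, and a class by a chosen
  representative; the lemmas \<open>sub_eq_iff\<close> and \<open>span_eq_iff\<close> below state that equality of these codes
  is equality of classes.
\<close>

definition pair :: "'u::infinite \<times> 'u \<Rightarrow> 'u" where
  "pair = (SOME p. inj p)"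

definition unpair :: "'u::infinite \<Rightarrow> 'u \<times> 'u" where
  "unpair = inv pair"

lemma inj_pair: "inj (pair :: 'u::infinite \<times> 'u \<Rightarrow> 'u)"
proof -
  include cardinal_syntax
  have "\<not> finite (UNIV :: 'u set)" by (rule infinite_UNIV)
  then have "|(UNIV :: 'u set) \<times> (UNIV :: 'u set)| =o |UNIV :: 'u set|"
    by (rule card_of_Times_same_infinite)
  then have "\<exists>f. bij_betw f ((UNIV :: 'u set) \<times> (UNIV :: 'u set)) (UNIV :: 'u set)"
    using card_of_ordIso by blast
  then have "\<exists>p :: 'u \<times> 'u \<Rightarrow> 'u. inj p"
    by (auto simp: bij_betw_def)
  then show ?thesis
    unfolding pair_def by (rule someI_ex)
qed

lemma unpair_pair [simp]: "unpair (pair p) = p"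
  by (simp add: unpair_def inj_pair)

definition sub_class :: "'u cat \<Rightarrow> 'u \<Rightarrow> 'u set" where
  "sub_class C m = {m' \<in> Arr C. \<exists>k. iso C k \<and> (m', k) \<in> composable C \<and> m = m' \<cdot>\<^bsub>C\<^esub> k}"

definition sub :: "'u cat \<Rightarrow> 'u \<Rightarrow> 'u" where
  "sub C m = (SOME m'. m' \<in> sub_class C m)"

definition span_class :: "'u cat \<Rightarrow> 'u \<Rightarrow> 'u \<Rightarrow> ('u \<times> 'u) set" where
  "span_class C m n = {(m', n'). m' \<in> Arr C \<and> n' \<in> Arr C \<and> Dom C m' = Dom C n' \<and>
     (\<exists>h. iso C h \<and> (m', h) \<in> composable C \<and> m = m' \<cdot>\<^bsub>C\<^esub> h \<and> n = n' \<cdot>\<^bsub>C\<^esub> h)}"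

definition span :: "'u::infinite cat \<Rightarrow> 'u \<Rightarrow> 'u \<Rightarrow> 'u" where
  "span C m n = pair (SOME p. p \<in> span_class C m n)"


context category
begin

lemma iso_Ident: "A \<in> Obj C \<Longrightarrow> iso C (Ident C A)"
proof -
  assume "A \<in> Obj C"
  moreover from this have "Ident C A \<in> Arr C" "Dom C (Ident C A) = A" "Cod C (Ident C A) = A"
    using Ident_hom by (auto simp: hom_def)
  ultimately have "inverse_arrows C (Ident C A) (Ident C A)"
    using Comp_Ident[of "Ident C A"] by (auto simp: inverse_arrows_def hom_def)
  then show ?thesis by (auto simp: iso_def)
qed

lemma iso_Comp:
  assumes "iso C k" "iso C l" "(l, k) \<in> composable C"
  shows "iso C (l \<cdot> k)"
proof -
  obtain k' where k: "inverse_arrows C k k'" using assms iso_def by metis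
  obtain l' where l: "inverse_arrows C l l'" using assms iso_def by metis
  have c: "(l, k) \<in> composable C" "(k', l') \<in> composable C" "(k, k') \<in> composable C"
    "(k', k) \<in> composable C" "(l, l') \<in> composable C" "(l', l) \<in> composable C"
    using k l assms(3) by (auto simp: inverse_arrows_def hom_def composable_def)
  have lk: "l \<cdot> k \<in> hom C (Dom C k) (Cod C l)" using Comp_hom c by blast
  have kl: "k' \<cdot> l' \<in> hom C (Cod C l) (Dom C k)"
    using Comp_hom[OF c(2)] k l by (auto simp: inverse_arrows_def hom_def)
  have d: "(l' , l \<cdot> k) \<in> composable C" "(k, k' \<cdot> l') \<in> composable C"
    using lk kl k l c by (auto simp: inverse_arrows_def hom_def composable_def)
  have "(k' \<cdot> l') \<cdot> (l \<cdot> k) = k' \<cdot> (l' \<cdot> (l \<cdot> k))"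
    using Comp_assoc c d by blast
  also have "l' \<cdot> (l \<cdot> k) = (l' \<cdot> l) \<cdot> k" using Comp_assoc c by metis
  also have "\<dots> = k" using l k c Ident_Comp[of k]
    by (auto simp: inverse_arrows_def composable_def hom_def)
  finally have 1: "(k' \<cdot> l') \<cdot> (l \<cdot> k) = Ident C (Dom C k)" using k by (simp add: inverse_arrows_def)
  have "(l \<cdot> k) \<cdot> (k' \<cdot> l') = l \<cdot> (k \<cdot> (k' \<cdot> l'))"
    using Comp_assoc c d by blast
  also have "k \<cdot> (k' \<cdot> l') = (k \<cdot> k') \<cdot> l'" using Comp_assoc c by metis
  also have "\<dots> = l'" using l k c Ident_Comp[of l']
    by (auto simp: inverse_arrows_def composable_def hom_def)
  finally have 2: "(l \<cdot> k) \<cdot> (k' \<cdot> l') = Ident C (Cod C l)" using l by (simp add: inverse_arrows_def)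
  show ?thesis using 1 2 lk kl
    by (auto simp: iso_def inverse_arrows_def hom_def intro!: exI[of _ "k' \<cdot> l'"])
qed

lemma iso_cancel:
  assumes "iso C k"
  obtains j where "iso C j" "Dom C j = Cod C k"
    "\<And>m. (m, k) \<in> composable C \<Longrightarrow> (m \<cdot> k, j) \<in> composable C \<and> (m \<cdot> k) \<cdot> j = m"
proof -
  obtain j where k: "inverse_arrows C k j" using assms iso_def by metis
  have c: "(k, j) \<in> composable C" "(j, k) \<in> composable C" "Dom C j = Cod C k" "Cod C j = Dom C k"
    using k by (auto simp: inverse_arrows_def hom_def composable_def)
  have "inverse_arrows C j k" using k by (auto simp: inverse_arrows_def hom_def)
  then have "iso C j" by (auto simp: iso_def)
  moreover have "(m \<cdot> k, j) \<in> composable C \<and> (m \<cdot> k) \<cdot> j = m" if m: "(m, k) \<in> composable C" for m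
  proof
    show "(m \<cdot> k, j) \<in> composable C"
      using Comp_hom[OF m] c by (auto simp: composable_def hom_def)
    have "(m \<cdot> k) \<cdot> j = m \<cdot> (k \<cdot> j)" using Comp_assoc m c by metis
    also have "\<dots> = m" using k m Comp_Ident[of m] by (auto simp: inverse_arrows_def composable_def)
    finally show "(m \<cdot> k) \<cdot> j = m" .
  qed
  ultimately show thesis using that c by blast
qed

lemma composable_Dom_eq:
  "\<lbrakk>(m, k) \<in> composable C; n \<in> Arr C; Dom C m = Dom C n\<rbrakk> \<Longrightarrow> (n, k) \<in> composable C"
  by (auto simp: composable_def)

lemma Comp_assoc_composable:
  "\<lbrakk>(h, g) \<in> composable C; (g, f) \<in> composable C\<rbrakk> \<Longrightarrow> (h, g \<cdot> f) \<in> composable C"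
  using Comp_hom[of g f] by (auto simp: composable_def hom_def)

end

lemma span_class_eq_iff:
  assumes "category C" and mn: "m \<in> Arr C" "n \<in> Arr C" "Dom C m = Dom C n"
    and mn': "m' \<in> Arr C" "n' \<in> Arr C" "Dom C m' = Dom C n'"
  shows "span_class C m n = span_class C m' n' \<longleftrightarrow> (m', n') \<in> span_class C m n"
    and "(m, n) \<in> span_class C m n"
proof -
  interpret category C by fact
  have refl: "(a, b) \<in> span_class C a b" if "a \<in> Arr C" "b \<in> Arr C" "Dom C a = Dom C b" for a b
  proof -
    have "Dom C a \<in> Obj C" using that Dom by auto
    then have "iso C (Ident C (Dom C a))" "(a, Ident C (Dom C a)) \<in> composable C"
      using iso_Ident Ident_hom that by (auto simp: composable_def hom_def)
    then show ?thesis using that Comp_Ident[of a] Comp_Ident[of b]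
      by (auto simp: span_class_def intro!: exI[of _ "Ident C (Dom C a)"])
  qed
  have sym: "(a, b) \<in> span_class C c d"
    if A: "a \<in> Arr C" "b \<in> Arr C" "Dom C a = Dom C b" and B: "(c, d) \<in> span_class C a b" for a b c d
  proof -
    obtain k where k: "iso C k" "(c, k) \<in> composable C" "(d, k) \<in> composable C"
      "a = c \<cdot>\<^bsub>C\<^esub> k" "b = d \<cdot>\<^bsub>C\<^esub> k"
      using B composable_Dom_eq by (auto simp: span_class_def)
    obtain j where "iso C j" "\<And>m. (m, k) \<in> composable C \<Longrightarrow> (m \<cdot>\<^bsub>C\<^esub> k, j) \<in> composable C \<and> (m \<cdot>\<^bsub>C\<^esub> k) \<cdot>\<^bsub>C\<^esub> j = m"
      using iso_cancel k by metis
    then have "iso C j" "(a, j) \<in> composable C" "c = a \<cdot>\<^bsub>C\<^esub> j" "d = b \<cdot>\<^bsub>C\<^esub> j"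
      using k by auto
    then show ?thesis using A by (auto simp: span_class_def)
  qed
  have trans: "(e, f) \<in> span_class C a b"
    if A: "(c, d) \<in> span_class C a b" and B: "(e, f) \<in> span_class C c d" for a b c d e f
  proof -
    obtain k where k: "iso C k" "(c, k) \<in> composable C" "a = c \<cdot>\<^bsub>C\<^esub> k" "b = d \<cdot>\<^bsub>C\<^esub> k"
      using A by (auto simp: span_class_def)
    obtain l where l: "iso C l" "(e, l) \<in> composable C" "(f, l) \<in> composable C" "c = e \<cdot>\<^bsub>C\<^esub> l" "d = f \<cdot>\<^bsub>C\<^esub> l"
      using B composable_Dom_eq by (auto simp: span_class_def)
    have lk: "(l, k) \<in> composable C"
      using k l Comp_hom[OF l(2)] by (auto simp: composable_def hom_def)
    have "iso C (l \<cdot>\<^bsub>C\<^esub> k)" using iso_Comp k l lk by blast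
    moreover have "a = e \<cdot>\<^bsub>C\<^esub> (l \<cdot>\<^bsub>C\<^esub> k)" "b = f \<cdot>\<^bsub>C\<^esub> (l \<cdot>\<^bsub>C\<^esub> k)" using k l lk Comp_assoc by metis+
    moreover have "(e, l \<cdot>\<^bsub>C\<^esub> k) \<in> composable C" using Comp_assoc_composable l lk by blast
    ultimately show ?thesis using B by (auto simp: span_class_def)
  qed
  show "(m, n) \<in> span_class C m n" using refl mn by blast
  show "span_class C m n = span_class C m' n' \<longleftrightarrow> (m', n') \<in> span_class C m n"
  proof
    assume "span_class C m n = span_class C m' n'"
    then show "(m', n') \<in> span_class C m n" using refl mn' by blast
  next
    assume 1: "(m', n') \<in> span_class C m n"
    then have 2: "(m, n) \<in> span_class C m' n'" using sym mn by blast
    have "p \<in> span_class C m n \<longleftrightarrow> p \<in> span_class C m' n'" for p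
      using trans[OF 1] trans[OF 2] by (cases p) blast
    then show "span_class C m n = span_class C m' n'" by blast
  qed
qed

lemma span_eq_iff:
  assumes "category C" "m \<in> Arr C" "n \<in> Arr C" "Dom C m = Dom C n"
    and "m' \<in> Arr C" "n' \<in> Arr C" "Dom C m' = Dom C n'"
  shows "span C m n = span C m' n' \<longleftrightarrow>
    (\<exists>h. iso C h \<and> (m', h) \<in> composable C \<and> m = m' \<cdot>\<^bsub>C\<^esub> h \<and> n = n' \<cdot>\<^bsub>C\<^esub> h)"
proof -
  have rep: "(SOME p. p \<in> span_class C a b) \<in> span_class C a b"
    if "a \<in> Arr C" "b \<in> Arr C" "Dom C a = Dom C b" for a b
    using span_class_eq_iff(2)[OF assms(1)] that by (metis someI)
  have "span C m n = span C m' n' \<longleftrightarrow> span_class C m n = span_class C m' n'"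
  proof
    assume "span C m n = span C m' n'"
    then obtain a b where "(a, b) \<in> span_class C m n" "(a, b) \<in> span_class C m' n'"
      using rep assms inj_pair by (metis span_def injD surj_pair)
    moreover from this have "a \<in> Arr C" "b \<in> Arr C" "Dom C a = Dom C b"
      by (auto simp: span_class_def)
    ultimately show "span_class C m n = span_class C m' n'"
      using span_class_eq_iff(1)[OF assms(1)] assms by metis
  qed (simp add: span_def)
  then show ?thesis
    using span_class_eq_iff(1)[OF assms] assms by (auto simp: span_class_def)
qed

lemma sub_eq_iff:
  assumes "category C" "m \<in> Arr C" "m' \<in> Arr C"
  shows "sub C m = sub C m' \<longleftrightarrow>
    (\<exists>k. iso C k \<and> (m', k) \<in> composable C \<and> m = m' \<cdot>\<^bsub>C\<^esub> k)"
proof -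
  have diag: "a' \<in> sub_class C a \<longleftrightarrow> (a', a') \<in> span_class C a a" for a a'
    by (auto simp: sub_class_def span_class_def)
  have rep: "sub C a \<in> sub_class C a" if "a \<in> Arr C" for a
    using span_class_eq_iff(2)[OF assms(1)] that diag unfolding sub_def by (metis someI)
  have "sub C m = sub C m' \<longleftrightarrow> span_class C m m = span_class C m' m'"
  proof
    assume "sub C m = sub C m'"
    then obtain a where "a \<in> sub_class C m" "a \<in> sub_class C m'"
      using rep assms by metis
    moreover from this have "a \<in> Arr C"
      by (auto simp: sub_class_def)
    ultimately show "span_class C m m = span_class C m' m'"
      using span_class_eq_iff(1)[OF assms(1)] assms diag by metis
  qed (simp add: sub_def diag)
  then show ?thesis
    using span_class_eq_iff(1)[OF assms(1,2,2) _ assms(3,3)] assms by (auto simp: span_class_def)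
qed


section \<open>The 2-functor L\<close>

definition L_arr :: "'u::infinite ogpd \<Rightarrow> 'u set" where
  "L_arr G = {pair (h, B) | h B. h \<in> Arr G \<and> obj_le G (Cod G h) B}"

definition L0 :: "'u::infinite ogpd \<Rightarrow> 'u cat" where
  "L0 G = \<lparr>Obj = Obj G, Arr = L_arr G,
     Dom = (\<lambda>x \<in> L_arr G. Dom G (fst (unpair x))),
     Cod = (\<lambda>x \<in> L_arr G. snd (unpair x)),
     Ident = (\<lambda>A \<in> Obj G. pair (Ident G A, A)),
     Comp = (\<lambda>(y, x) \<in> {(y, x). y \<in> L_arr G \<and> x \<in> L_arr G \<and> Dom G (fst (unpair y)) = snd (unpair x)}.
        let (h, B) = unpair x; (k, E) = unpair y
        in pair (restr G k (Cod G h) \<cdot>\<^bsub>G\<^esub> h, E))\<rparr>"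

definition L1 :: "'u::infinite ofunc \<Rightarrow> ('u, 'u cat) func" where
  "L1 F = \<lparr>fdom = L0 (fdom F), fcod = L0 (fcod F), omap = omap F,
     amap = (\<lambda>x \<in> L_arr (fdom F). let (h, B) = unpair x in pair (amap F h, omap F B))\<rparr>"

definition L2 :: "'u::infinite ltrans \<Rightarrow> 'u ntrans" where
  "L2 t = \<lparr>nsrc = L1 (lsrc t), ntrg = L1 (ltrg t),
     ncomp = (\<lambda>X \<in> Obj (fdom (lsrc t)). pair (lcomp t X, omap (ltrg t) X))\<rparr>"

definition Lfun :: "('u::infinite ogpd, 'u ofunc, 'u ltrans, 'u cat, ('u, 'u cat) func, 'u ntrans) two_fun"
  where "Lfun = \<lparr>map0 = L0, map1 = L1, map2 = L2\<rparr>"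


section \<open>The 2-functor G\<close>

definition G_obj :: "'u cat \<Rightarrow> 'u set" where
  "G_obj C = sub C ` Arr C"

definition G_arr :: "'u::infinite cat \<Rightarrow> 'u set" where
  "G_arr C = {span C m n | m n. m \<in> Arr C \<and> n \<in> Arr C \<and> Dom C m = Dom C n}"

definition G_dom :: "'u::infinite cat \<Rightarrow> 'u \<Rightarrow> 'u" where
  "G_dom C x = sub C (fst (unpair x))"

definition G_cod :: "'u::infinite cat \<Rightarrow> 'u \<Rightarrow> 'u" where
  "G_cod C x = sub C (snd (unpair x))"

text \<open>For \<open>x = [k, m]\<close> and \<open>y = [m', n]\<close> with \<open>m = m' h\<close>, the composite ``\<open>y\<close> after \<open>x\<close>'' is \<open>[k, n h]\<close>.\<close>

definition G_comp :: "'u::infinite cat \<Rightarrow> 'u \<Rightarrow> 'u \<Rightarrow> 'u" where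
  "G_comp C y x = (let (k, m) = unpair x; (m', n) = unpair y;
       h = (THE h. iso C h \<and> (m', h) \<in> composable C \<and> m = m' \<cdot>\<^bsub>C\<^esub> h)
     in span C k (n \<cdot>\<^bsub>C\<^esub> h))"

definition G_le :: "'u::infinite cat \<Rightarrow> ('u \<times> 'u) set" where
  "G_le C = {(x, y) \<in> G_arr C \<times> G_arr C. let (m, n) = unpair x; (m', n') = unpair y in
     \<exists>h. (m', h) \<in> composable C \<and> m = m' \<cdot>\<^bsub>C\<^esub> h \<and> n = n' \<cdot>\<^bsub>C\<^esub> h}"

definition G0 :: "'u::infinite cat \<Rightarrow> 'u ogpd" where
  "G0 C = \<lparr>Obj = G_obj C, Arr = G_arr C,
     Dom = (\<lambda>x \<in> G_arr C. G_dom C x),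
     Cod = (\<lambda>x \<in> G_arr C. G_cod C x),
     Ident = (\<lambda>m \<in> G_obj C. span C m m),
     Comp = (\<lambda>(y, x) \<in> {(y, x). y \<in> G_arr C \<and> x \<in> G_arr C \<and> G_dom C y = G_cod C x}. G_comp C y x),
     Le = G_le C\<rparr>"

definition G1 :: "('u::infinite, 'u cat) func \<Rightarrow> 'u ofunc" where
  "G1 K = \<lparr>fdom = G0 (fdom K), fcod = G0 (fcod K),
     omap = (\<lambda>m \<in> G_obj (fdom K). sub (fcod K) (amap K m)),
     amap = (\<lambda>x \<in> G_arr (fdom K). let (m, n) = unpair x in span (fcod K) (amap K m) (amap K n))\<rparr>"

definition G2 :: "'u::infinite ntrans \<Rightarrow> 'u ltrans" where
  "G2 t = (let C = fdom (nsrc t); D = fcod (nsrc t); K = nsrc t; K' = ntrg t;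
       w = (\<lambda>m. amap K' m \<cdot>\<^bsub>D\<^esub> ncomp t (Dom C m))
     in \<lparr>lsrc = G1 K, ltrg = G1 K',
         lmid = \<lparr>fdom = G0 C, fcod = G0 D,
                 omap = (\<lambda>m \<in> G_obj C. sub D (w m)),
                 amap = (\<lambda>x \<in> G_arr C. let (m, n) = unpair x in span D (w m) (w n))\<rparr>,
         lcomp = (\<lambda>m \<in> G_obj C. span D (amap K m) (w m))\<rparr>)"

definition Gfun :: "('u::infinite cat, ('u, 'u cat) func, 'u ntrans, 'u ogpd, 'u ofunc, 'u ltrans) two_fun"
  where "Gfun = \<lparr>map0 = G0, map1 = G1, map2 = G2\<rparr>"

end

theory Submission
  imports Defs
begin

text \<open>
  A \<open>\<Lambda>\<close>-transformation is determined by its source, its target and its components, so \<open>L\<close> is injective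
  on parallel 2-cells; since \<open>L\<close> preserves all operations on 2-cells, the 2-category axioms for ordered
  groupoids are inherited from those for categories.

  The unit of the adjunction sends \<open>f: A \<rightarrow> B\<close> to \<open>([1\<^sub>A, f], \<le>): [1\<^sub>A] \<rightarrow> [1\<^sub>B]\<close>. It is fully faithful
  because spans with the same left leg in a left-cancellative category are equal only if their right
  legs are, and essentially surjective because \<open>[m] \<cong> [1]\<close> via \<open>[m, 1]\<close>. The counit sends the class of
  \<open>(h: A \<rightarrow> B', B' \<le> B)\<close> to \<open>B'\<close> and the class of a span \<open>(h, k)\<close> to \<open>k h\<^sup>-\<^sup>1\<close>; both naturality and the
  triangle identities hold strictly. An object of \<open>GL(G)\<close> amounts to a pair \<open>B' \<le> B\<close>, which is
  isomorphic to \<open>B' \<le> M\<close> with \<open>M\<close> the maximal object above \<open>B'\<close>; this is where maximal objects are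
  used, and it makes \<open>B' \<mapsto> (B' \<le> M)\<close> a pseudo-inverse of the counit.
\<close>

section \<open>Categories, functors and natural transformations\<close>

text \<open>Classes in \<open>G0 C\<close> are stored as chosen representatives, so every map out of
  them must be shown invariant under precomposition with isomorphisms. \<open>sub_rep\<close> and
  \<open>span_rep\<close> write the representative as the given legs precomposed with an
  isomorphism; after that, computations use arbitrary legs. Left-cancellativity makes the classes
  rigid: mediating isomorphisms and restrictions are unique, and the order is antisymmetric. For
  ordered groupoids the main tool is uniqueness of restrictions: an arrow below \<open>f\<close> is
  determined by its domain and, after inversion, by its codomain. The codomain version makes
  \<open>L0 G\<close> left-cancellative. The domain version recovers the intermediate functor and
  turns a restricted component into the component at a smaller object, which is why \<open>L\<close>
  preserves horizontal composites strictly. The counit is well defined because an isomorphism of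
  \<open>L0 G\<close> has a trivial vertical part: composing with it involves no restriction, and
  its horizontal part cancels. The two equivalences are proved differently: the pseudo-inverse of
  the unit is obtained by choice, while the counit has an explicit strict section, so only one of
  its two comparison 2-cells needs work.\<close>

context category
begin

lemma Dom_in [simp]: "f \<in> Arr C \<Longrightarrow> Dom C f \<in> Obj C"
  using Dom by auto

lemma Cod_in [simp]: "f \<in> Arr C \<Longrightarrow> Cod C f \<in> Obj C"
  using Cod by auto

lemma Ident_simps [simp]:
  assumes "A \<in> Obj C"
  shows "Ident C A \<in> Arr C" "Dom C (Ident C A) = A" "Cod C (Ident C A) = A"
  using Ident_hom[OF assms] by (auto simp: hom_def)

lemma Comp_simps [simp]:
  assumes "g \<in> Arr C" "f \<in> Arr C" "Dom C g = Cod C f"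
  shows "g \<cdot> f \<in> Arr C" "Dom C (g \<cdot> f) = Dom C f" "Cod C (g \<cdot> f) = Cod C g"
  using Comp_hom[of g f] assms by (auto simp: hom_def composable_def)

lemma Comp_unit [simp]:
  "\<lbrakk>f \<in> Arr C; Dom C f = A\<rbrakk> \<Longrightarrow> f \<cdot> Ident C A = f"
  "\<lbrakk>f \<in> Arr C; Cod C f = A\<rbrakk> \<Longrightarrow> Ident C A \<cdot> f = f"
  using Comp_Ident Ident_Comp by auto

lemma assoc [simp]:
  "\<lbrakk>h \<in> Arr C; g \<in> Arr C; f \<in> Arr C; Dom C h = Cod C g; Dom C g = Cod C f\<rbrakk>
    \<Longrightarrow> (h \<cdot> g) \<cdot> f = h \<cdot> (g \<cdot> f)"
  using Comp_assoc by (simp add: composable_def)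

lemma cancel:
  "\<lbrakk>left_cancellative C; f \<in> Arr C; g \<in> Arr C; h \<in> Arr C; Dom C f = Cod C g; Dom C f = Cod C h;
    Dom C g = Dom C h; f \<cdot> g = f \<cdot> h\<rbrakk> \<Longrightarrow> g = h"
  unfolding left_cancellative_def mono_arrow_def composable_def by blast

lemma isoE:
  assumes "iso C f"
  obtains g where "f \<in> Arr C" "g \<in> Arr C" "iso C g" "Dom C g = Cod C f" "Cod C g = Dom C f"
    "g \<cdot> f = Ident C (Dom C f)" "f \<cdot> g = Ident C (Cod C f)"
proof -
  obtain g where "inverse_arrows C f g" using assms by (auto simp: iso_def)
  moreover from this have "inverse_arrows C g f" by (auto simp: inverse_arrows_def hom_def)
  ultimately show thesis using that unfolding inverse_arrows_def hom_def iso_def by blast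
qed

lemma isoI:
  "\<lbrakk>f \<in> Arr C; g \<in> Arr C; Dom C g = Cod C f; Cod C g = Dom C f;
    g \<cdot> f = Ident C (Dom C f); f \<cdot> g = Ident C (Cod C f)\<rbrakk> \<Longrightarrow> iso C f"
  unfolding iso_def inverse_arrows_def hom_def by blast

lemma iso_Arr: "iso C f \<Longrightarrow> f \<in> Arr C"
  by (auto simp: iso_def inverse_arrows_def)

end

lemma categoryI:
  assumes "Dom C \<in> Arr C \<rightarrow>\<^sub>E Obj C" "Cod C \<in> Arr C \<rightarrow>\<^sub>E Obj C" "Ident C \<in> extensional (Obj C)"
    and "Comp C \<in> extensional (composable C)"
    and "\<And>A. A \<in> Obj C \<Longrightarrow> Ident C A \<in> Arr C \<and> Dom C (Ident C A) = A \<and> Cod C (Ident C A) = A"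
    and "\<And>g f. \<lbrakk>g \<in> Arr C; f \<in> Arr C; Dom C g = Cod C f\<rbrakk> \<Longrightarrow>
      g \<cdot>\<^bsub>C\<^esub> f \<in> Arr C \<and> Dom C (g \<cdot>\<^bsub>C\<^esub> f) = Dom C f \<and> Cod C (g \<cdot>\<^bsub>C\<^esub> f) = Cod C g"
    and "\<And>f. f \<in> Arr C \<Longrightarrow> f \<cdot>\<^bsub>C\<^esub> Ident C (Dom C f) = f \<and> Ident C (Cod C f) \<cdot>\<^bsub>C\<^esub> f = f"
    and "\<And>h g f. \<lbrakk>h \<in> Arr C; g \<in> Arr C; f \<in> Arr C; Dom C h = Cod C g; Dom C g = Cod C f\<rbrakk> \<Longrightarrow>
      (h \<cdot>\<^bsub>C\<^esub> g) \<cdot>\<^bsub>C\<^esub> f = h \<cdot>\<^bsub>C\<^esub> (g \<cdot>\<^bsub>C\<^esub> f)"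
  shows "category C"
  using assms by unfold_locales (auto simp: composable_def hom_def PiE_iff)

text \<open>Source and target are parameters, not projections of \<open>F\<close>: rewriting then
  sees \<open>C\<close> and \<open>D\<close>, and the categories shared by composable functors
  coincide syntactically.\<close>

locale functor_between =
  fixes C D :: "('u, 'm) cat_scheme" and F
  assumes is_functor: "is_functor F" and fdom [simp]: "fdom F = C" and fcod [simp]: "fcod F = D"
begin

sublocale C: category C using is_functor.fdom[OF is_functor] by simp
sublocale D: category D using is_functor.fcod[OF is_functor] by simp

lemma omap_in [simp]: "A \<in> Obj C \<Longrightarrow> omap F A \<in> Obj D"
  using is_functor.omap[OF is_functor] by auto

lemma amap_simps [simp]:
  assumes "f \<in> Arr C"
  shows "amap F f \<in> Arr D" "Dom D (amap F f) = omap F (Dom C f)"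
    "Cod D (amap F f) = omap F (Cod C f)"
  using is_functor.amap_hom[OF is_functor, of f] assms by (auto simp: hom_def)

lemma amap_Ident [simp]: "A \<in> Obj C \<Longrightarrow> amap F (Ident C A) = Ident D (omap F A)"
  using is_functor.amap_Ident[OF is_functor, of A] by simp

lemma amap_Comp [simp]:
  "\<lbrakk>g \<in> Arr C; f \<in> Arr C; Dom C g = Cod C f\<rbrakk>
    \<Longrightarrow> amap F (g \<cdot>\<^bsub>C\<^esub> f) = amap F g \<cdot>\<^bsub>D\<^esub> amap F f"
  using is_functor.amap_Comp[OF is_functor, of g f] by (simp add: composable_def)

lemma extensional: "omap F \<in> extensional (Obj C)" "amap F \<in> extensional (Arr C)"
  using is_functor.omap[OF is_functor] is_functor.amap[OF is_functor] by (auto simp: PiE_iff)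

lemma iso_amap: "iso C f \<Longrightarrow> iso D (amap F f)"
proof (erule C.isoE)
  fix g assume g: "f \<in> Arr C" "g \<in> Arr C" "Dom C g = Cod C f" "Cod C g = Dom C f"
    "g \<cdot>\<^bsub>C\<^esub> f = Ident C (Dom C f)" "f \<cdot>\<^bsub>C\<^esub> g = Ident C (Cod C f)"
  then show ?thesis using amap_Comp[of g f] amap_Comp[of f g]
    by (intro D.isoI[of _ "amap F g"]) auto
qed

end

lemma functor_betweenI:
  assumes "category C" "category D" "fdom F = C" "fcod F = D"
    and "omap F \<in> extensional (Obj C)" "amap F \<in> extensional (Arr C)"
    and arr: "\<And>f. f \<in> Arr C \<Longrightarrow> amap F f \<in> Arr D \<and>
      Dom D (amap F f) = omap F (Dom C f) \<and> Cod D (amap F f) = omap F (Cod C f)"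
    and "\<And>A. A \<in> Obj C \<Longrightarrow> amap F (Ident C A) = Ident D (omap F A)"
    and "\<And>g f. \<lbrakk>g \<in> Arr C; f \<in> Arr C; Dom C g = Cod C f\<rbrakk>
      \<Longrightarrow> amap F (g \<cdot>\<^bsub>C\<^esub> f) = amap F g \<cdot>\<^bsub>D\<^esub> amap F f"
  shows "functor_between C D F"
proof -
  interpret C: category C by fact
  interpret D: category D by fact
  \<comment> \<open>The image of an identity is an arrow whose domain is the image of the object, so
    \<open>arr\<close> already places objects in \<open>D\<close>.\<close>
  have "omap F A \<in> Obj D" if "A \<in> Obj C" for A
    using arr[of "Ident C A"] that D.Dom_in[of "amap F (Ident C A)"] by simp
  then have "is_functor F"
    using assms by (intro is_functor.intro) (auto simp: hom_def composable_def PiE_iff)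
  then show ?thesis using assms by (intro functor_between.intro)
qed

lemma functor_between_self: "is_functor F \<Longrightarrow> functor_between (fdom F) (fcod F) F"
  by (simp add: functor_between.intro)

text \<open>An object is the domain of its identity, so the values on arrows determine those on
  objects; extensionality of both maps does the rest.\<close>

lemma func_eqI:
  assumes "functor_between C D F" "functor_between C D G"
    and arr: "\<And>f. f \<in> Arr C \<Longrightarrow> amap F f = amap G f"
  shows "F = G"
proof -
  interpret F: functor_between C D F by fact
  interpret G: functor_between C D G by fact
  have a: "amap F = amap G"
    using F.extensional G.extensional arr by (intro extensionalityI) auto
  have "omap F A = omap G A" if "A \<in> Obj C" for A
    using that a F.amap_simps(2)[of "Ident C A"] G.amap_simps(2)[of "Ident C A"] by simp
  then have "omap F = omap G"
    using F.extensional G.extensional by (intro extensionalityI) auto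
  then show ?thesis using a F.fdom F.fcod G.fdom G.fcod by (cases F; cases G) simp
qed

lemma id_func_simps [simp]:
  "fdom (id_func C) = C" "fcod (id_func C) = C"
  "A \<in> Obj C \<Longrightarrow> omap (id_func C) A = A" "f \<in> Arr C \<Longrightarrow> amap (id_func C) f = f"
  by (simp_all add: id_func_def)

lemma comp_func_simps [simp]:
  "fdom (comp_func G F) = fdom F" "fcod (comp_func G F) = fcod G"
  "A \<in> Obj (fdom F) \<Longrightarrow> omap (comp_func G F) A = omap G (omap F A)"
  "f \<in> Arr (fdom F) \<Longrightarrow> amap (comp_func G F) f = amap G (amap F f)"
  by (simp_all add: comp_func_def compose_def)

lemma functor_between_id: "category C \<Longrightarrow> functor_between C C (id_func C)"
proof -
  assume "category C"
  then interpret category C .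
  show ?thesis by (rule functor_betweenI) (auto simp: category_axioms id_func_def)
qed

lemma functor_between_comp:
  assumes "functor_between C D F" "functor_between D E G"
  shows "functor_between C E (comp_func G F)"
proof -
  interpret F: functor_between C D F by fact
  interpret G: functor_between D E G by fact
  show ?thesis
    by (rule functor_betweenI)
      (auto simp: F.C.category_axioms G.D.category_axioms comp_func_def compose_def)
qed

lemma comp_func_id:
  assumes "functor_between C D F"
  shows "comp_func F (id_func C) = F" "comp_func (id_func D) F = F"
proof -
  interpret F: functor_between C D F by fact
  have "functor_between C D (comp_func F (id_func C))" "functor_between C D (comp_func (id_func D) F)"
    using functor_between_comp functor_between_id F.C.category_axioms F.D.category_axioms assms
    by blast+
  then show "comp_func F (id_func C) = F" "comp_func (id_func D) F = F"
    using assms by (auto intro!: func_eqI[of C D])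
qed

lemma comp_func_assoc:
  assumes "functor_between B C F" "functor_between C D G" "functor_between D E H"
  shows "comp_func (comp_func H G) F = comp_func H (comp_func G F)"
proof -
  interpret F: functor_between B C F by fact
  interpret G: functor_between C D G by fact
  interpret H: functor_between D E H by fact
  show ?thesis
    by (rule func_eqI[of B E]) (auto intro: functor_between_comp assms)
qed

lemma natural_iff:
  assumes "functor_between C D F" "functor_between C D G"
  shows "natural F G a \<longleftrightarrow> a \<in> extensional (Obj C) \<and>
    (\<forall>X \<in> Obj C. a X \<in> Arr D \<and> Dom D (a X) = omap F X \<and> Cod D (a X) = omap G X) \<and>
    (\<forall>f \<in> Arr C. amap G f \<cdot>\<^bsub>D\<^esub> a (Dom C f) = a (Cod C f) \<cdot>\<^bsub>D\<^esub> amap F f)"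
proof -
  interpret F: functor_between C D F by fact
  show ?thesis by (auto simp: natural_def hom_def)
qed

locale nat_trans = S: functor_between C D "nsrc t" + T: functor_between C D "ntrg t"
  for C D :: "'u cat" and t :: "'u ntrans" +
  assumes extensional: "ncomp t \<in> extensional (Obj C)"
    and ncomp_simps [simp]: "X \<in> Obj C \<Longrightarrow> ncomp t X \<in> Arr D"
      "X \<in> Obj C \<Longrightarrow> Dom D (ncomp t X) = omap (nsrc t) X"
      "X \<in> Obj C \<Longrightarrow> Cod D (ncomp t X) = omap (ntrg t) X"
    and naturality: "f \<in> Arr C \<Longrightarrow>
      amap (ntrg t) f \<cdot>\<^bsub>D\<^esub> ncomp t (Dom C f) = ncomp t (Cod C f) \<cdot>\<^bsub>D\<^esub> amap (nsrc t) f"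

lemmas nat_transI = nat_trans.intro[OF _ _ nat_trans_axioms.intro]

lemma natural_transformation_iff:
  "natural_transformation t \<longleftrightarrow> (\<exists>C D. nat_trans C D t)"
proof
  assume t: "natural_transformation t"
  obtain C D where CD: "fdom (nsrc t) = C" "fcod (nsrc t) = D" by simp
  have f: "functor_between C D (nsrc t)" "functor_between C D (ntrg t)"
    using t CD by (auto simp: natural_transformation_def parallel_def intro!: functor_between.intro)
  have "nat_trans C D t"
    using t natural_iff[OF f, of "ncomp t"]
    by (intro nat_transI f) (auto simp: natural_transformation_def)
  then show "\<exists>C D. nat_trans C D t" by blast
next
  assume "\<exists>C D. nat_trans C D t"
  then obtain C D where "nat_trans C D t" by blast
  then interpret nat_trans C D t .
  show "natural_transformation t"
    using natural_iff[OF S.functor_between_axioms T.functor_between_axioms] extensional naturality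
    by (auto simp: natural_transformation_def parallel_def S.is_functor T.is_functor)
qed

lemma ntrans_eqI:
  assumes "nat_trans C D t" "nat_trans C D u" "nsrc t = nsrc u" "ntrg t = ntrg u"
    and "\<And>X. X \<in> Obj C \<Longrightarrow> ncomp t X = ncomp u X"
  shows "t = u"
proof -
  have "ncomp t = ncomp u"
    using assms by (intro extensionalityI[of _ "Obj C"]) (auto dest: nat_trans.extensional)
  then show ?thesis using assms(3,4) by (intro ntrans.equality) simp_all
qed

lemma nid_simps [simp]:
  "nsrc (nid F) = F" "ntrg (nid F) = F"
  "X \<in> Obj (fdom F) \<Longrightarrow> ncomp (nid F) X = Ident (fcod F) (omap F X)"
  by (simp_all add: nid_def)

lemma nvcomp_simps [simp]:
  "nsrc (nvcomp u t) = nsrc t" "ntrg (nvcomp u t) = ntrg u"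
  "X \<in> Obj (fdom (nsrc t)) \<Longrightarrow> ncomp (nvcomp u t) X = ncomp u X \<cdot>\<^bsub>fcod (nsrc t)\<^esub> ncomp t X"
  by (simp_all add: nvcomp_def)

lemma nhcomp_simps [simp]:
  "nsrc (nhcomp u t) = comp_func (nsrc u) (nsrc t)"
  "ntrg (nhcomp u t) = comp_func (ntrg u) (ntrg t)"
  "X \<in> Obj (fdom (nsrc t)) \<Longrightarrow> ncomp (nhcomp u t) X =
     ncomp u (omap (ntrg t) X) \<cdot>\<^bsub>fcod (nsrc u)\<^esub> amap (nsrc u) (ncomp t X)"
  by (simp_all add: nhcomp_def)

lemma nat_trans_nid:
  assumes "functor_between C D F" shows "nat_trans C D (nid F)"
proof -
  interpret functor_between C D F by fact
  show ?thesis by (rule nat_transI) (auto simp: functor_between_axioms nid_def)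
qed

lemma nat_trans_nvcomp:
  assumes "nat_trans C D t" "nat_trans C D u" "ntrg t = nsrc u"
  shows "nat_trans C D (nvcomp u t)"
proof -
  interpret t: nat_trans C D t by fact
  interpret u: nat_trans C D u by fact
  have [simp]: "nsrc u = ntrg t" using assms by simp
  show ?thesis
  proof (rule nat_transI)
    fix f assume f: "f \<in> Arr C"
    have "amap (ntrg u) f \<cdot>\<^bsub>D\<^esub> (ncomp u (Dom C f) \<cdot>\<^bsub>D\<^esub> ncomp t (Dom C f)) =
      (amap (ntrg u) f \<cdot>\<^bsub>D\<^esub> ncomp u (Dom C f)) \<cdot>\<^bsub>D\<^esub> ncomp t (Dom C f)"
      using f by simp
    also have "\<dots> = ncomp u (Cod C f) \<cdot>\<^bsub>D\<^esub> (amap (ntrg t) f \<cdot>\<^bsub>D\<^esub> ncomp t (Dom C f))"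
      using f u.naturality[OF f] by simp
    also have "\<dots> = (ncomp u (Cod C f) \<cdot>\<^bsub>D\<^esub> ncomp t (Cod C f)) \<cdot>\<^bsub>D\<^esub> amap (nsrc t) f"
      using f t.naturality[OF f] by simp
    finally show "amap (ntrg (nvcomp u t)) f \<cdot>\<^bsub>D\<^esub> ncomp (nvcomp u t) (Dom C f) =
      ncomp (nvcomp u t) (Cod C f) \<cdot>\<^bsub>D\<^esub> amap (nsrc (nvcomp u t)) f"
      using f by simp
  qed (auto simp: t.S.functor_between_axioms u.T.functor_between_axioms, simp add: nvcomp_def)
qed

text \<open>Two squares are pasted: naturality of \<open>u\<close> at
  \<open>amap (ntrg t) f\<close>, and the image under \<open>nsrc u\<close> of the square of
  \<open>t\<close> at \<open>f\<close>.\<close>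

lemma nat_trans_nhcomp:
  assumes "nat_trans C D t" "nat_trans D E u"
  shows "nat_trans C E (nhcomp u t)"
proof -
  interpret t: nat_trans C D t by fact
  interpret u: nat_trans D E u by fact
  interpret S: functor_between C E "comp_func (nsrc u) (nsrc t)"
    by (rule functor_between_comp[OF t.S.functor_between_axioms u.S.functor_between_axioms])
  interpret T: functor_between C E "comp_func (ntrg u) (ntrg t)"
    by (rule functor_between_comp[OF t.T.functor_between_axioms u.T.functor_between_axioms])
  show ?thesis
  proof (rule nat_transI)
    fix f assume f: "f \<in> Arr C"
    have "amap (ntrg u) (amap (ntrg t) f) \<cdot>\<^bsub>E\<^esub>
        (ncomp u (omap (ntrg t) (Dom C f)) \<cdot>\<^bsub>E\<^esub> amap (nsrc u) (ncomp t (Dom C f)))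
      = (amap (ntrg u) (amap (ntrg t) f) \<cdot>\<^bsub>E\<^esub> ncomp u (Dom D (amap (ntrg t) f))) \<cdot>\<^bsub>E\<^esub>
        amap (nsrc u) (ncomp t (Dom C f))"
      using f by simp
    also have "\<dots> = ncomp u (Cod D (amap (ntrg t) f)) \<cdot>\<^bsub>E\<^esub>
        amap (nsrc u) (amap (ntrg t) f \<cdot>\<^bsub>D\<^esub> ncomp t (Dom C f))"
      using f by (subst u.naturality) simp_all
    also have "\<dots> = (ncomp u (omap (ntrg t) (Cod C f)) \<cdot>\<^bsub>E\<^esub> amap (nsrc u) (ncomp t (Cod C f))) \<cdot>\<^bsub>E\<^esub>
        amap (nsrc u) (amap (nsrc t) f)"
      using f by (subst t.naturality) simp_all
    finally show "amap (ntrg (nhcomp u t)) f \<cdot>\<^bsub>E\<^esub> ncomp (nhcomp u t) (Dom C f) =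
      ncomp (nhcomp u t) (Cod C f) \<cdot>\<^bsub>E\<^esub> amap (nsrc (nhcomp u t)) f"
      using f by simp
  qed (auto simp: S.functor_between_axioms T.functor_between_axioms, simp add: nhcomp_def)
qed

section \<open>Full sub-2-categories, and reflection of the 2-category axioms along an
  operation-preserving map\<close>

lemma two_category_full_sub:
  assumes "two_category K"
  shows "two_category (full_sub K P)"
proof -
  interpret two_category K by fact
  have h: "f \<in> hom1 K A B \<longleftrightarrow> f \<in> Mor1 K \<and> src1 K f = A \<and> trg1 K f = B" for f A B
    by (auto simp: hom1_def)
  have h': "a \<in> hom2 K f g \<longleftrightarrow> a \<in> Cell2 K \<and> src2 K a = f \<and> trg2 K a = g" for a f g
    by (auto simp: hom2_def)
  note [simp] = full_sub_def hom1_def hom2_def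
  show ?thesis
  proof
    fix a b assume "a \<in> Cell2 (full_sub K P)" "b \<in> Cell2 (full_sub K P)"
      "trg0 (full_sub K P) a = src0 (full_sub K P) b"
    then show "hcomp (full_sub K P) b a \<in> hom2 (full_sub K P)
      (comp1 (full_sub K P) (src2 (full_sub K P) b) (src2 (full_sub K P) a))
      (comp1 (full_sub K P) (trg2 (full_sub K P) b) (trg2 (full_sub K P) a))"
      using hcomp[unfolded h'] comp1[unfolded h] src2 by auto
  qed (use src1 trg1 id1[unfolded h] comp1[unfolded h] comp1_id1 id1_comp1 comp1_assoc src2
        trg2[unfolded h] id2[unfolded h'] vcomp[unfolded h'] vcomp_id2 id2_vcomp vcomp_assoc
        hcomp_id id_hcomp hcomp_assoc hcomp_id2 interchange in auto)
qed

lemma two_functor_full_sub: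
  assumes "two_functor A B T" and Q: "\<And>X. \<lbrakk>X \<in> Obj0 A; P X\<rbrakk> \<Longrightarrow> Q (map0 T X)"
  shows "two_functor (full_sub A P) (full_sub B Q) T"
proof -
  interpret two_functor A B T by fact
  have h: "f \<in> hom1 K A B \<longleftrightarrow> f \<in> Mor1 K \<and> src1 K f = A \<and> trg1 K f = B" for f A B
    and K :: "('x, 'y, 'z) two_cat"
    by (auto simp: hom1_def)
  have h': "a \<in> hom2 K f g \<longleftrightarrow> a \<in> Cell2 K \<and> src2 K a = f \<and> trg2 K a = g" for a f g
    and K :: "('x, 'y, 'z) two_cat"
    by (auto simp: hom2_def)
  note [simp] = full_sub_def hom1_def hom2_def
  show ?thesis
    by (intro two_functor.intro two_category_full_sub A.two_category_axioms B.two_category_axioms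
          two_functor_axioms.intro)
      (use A.src1 A.trg1 A.src2 map0 map1[unfolded h] map2[unfolded h'] map1_id1 map1_comp1 map2_id2
        map2_vcomp map2_hcomp Q in auto)
qed

text \<open>Each law for 2-cells equates parallel 2-cells whose images under \<open>T\<close> are
  the two sides of the same law in \<open>B\<close>, so \<open>inj\<close> pulls it back. As
  \<open>A\<close> is not yet known to be a 2-category, preservation is assumed in the form
  \<open>two_functor_axioms\<close>, next to the 1-cell laws and the typing of the
  operations.\<close>

lemma two_category_reflect:
  fixes A :: "('o, 'm, 'c) two_cat" and B :: "('p, 'n, 'd) two_cat"
  assumes "two_category B"
    and src1: "\<And>f. f \<in> Mor1 A \<Longrightarrow> src1 A f \<in> Obj0 A" and trg1: "\<And>f. f \<in> Mor1 A \<Longrightarrow> trg1 A f \<in> Obj0 A"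
    and id1: "\<And>X. X \<in> Obj0 A \<Longrightarrow> id1 A X \<in> hom1 A X X"
    and comp1: "\<And>f g. \<lbrakk>f \<in> Mor1 A; g \<in> Mor1 A; trg1 A f = src1 A g\<rbrakk>
      \<Longrightarrow> comp1 A g f \<in> hom1 A (src1 A f) (trg1 A g)"
    and comp1_id1: "\<And>f. f \<in> Mor1 A \<Longrightarrow> comp1 A f (id1 A (src1 A f)) = f"
    and id1_comp1: "\<And>f. f \<in> Mor1 A \<Longrightarrow> comp1 A (id1 A (trg1 A f)) f = f"
    and comp1_assoc: "\<And>f g h. \<lbrakk>f \<in> Mor1 A; g \<in> Mor1 A; h \<in> Mor1 A; trg1 A f = src1 A g;
        trg1 A g = src1 A h\<rbrakk> \<Longrightarrow> comp1 A (comp1 A h g) f = comp1 A h (comp1 A g f)"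
    and src2: "\<And>a. a \<in> Cell2 A \<Longrightarrow> src2 A a \<in> Mor1 A"
    and trg2: "\<And>a. a \<in> Cell2 A \<Longrightarrow> trg2 A a \<in> hom1 A (src0 A a) (trg0 A a)"
    and id2: "\<And>f. f \<in> Mor1 A \<Longrightarrow> id2 A f \<in> hom2 A f f"
    and vcomp: "\<And>a b. \<lbrakk>a \<in> Cell2 A; b \<in> Cell2 A; trg2 A a = src2 A b\<rbrakk>
      \<Longrightarrow> vcomp A b a \<in> hom2 A (src2 A a) (trg2 A b)"
    and hcomp: "\<And>a b. \<lbrakk>a \<in> Cell2 A; b \<in> Cell2 A; trg0 A a = src0 A b\<rbrakk>
      \<Longrightarrow> hcomp A b a \<in> hom2 A (comp1 A (src2 A b) (src2 A a)) (comp1 A (trg2 A b) (trg2 A a))"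
    and axioms: "two_functor_axioms A B T"
    and inj: "\<And>a b. \<lbrakk>a \<in> Cell2 A; b \<in> Cell2 A; src2 A a = src2 A b; trg2 A a = trg2 A b;
      map2 T a = map2 T b\<rbrakk> \<Longrightarrow> a = b"
  shows "two_functor A B T"
proof -
  interpret B: two_category B by fact
  have src1_map1: "src1 B (map1 T f) = map0 T (src1 A f)" if "f \<in> Mor1 A" for f
    using axioms that by (auto simp: two_functor_axioms_def hom1_def)
  have trg1_map1: "trg1 B (map1 T f) = map0 T (trg1 A f)" if "f \<in> Mor1 A" for f
    using axioms that by (auto simp: two_functor_axioms_def hom1_def)
  have Mor1_map1: "map1 T f \<in> Mor1 B" if "f \<in> Mor1 A" for f
    using axioms that by (auto simp: two_functor_axioms_def hom1_def)
  have map2: "map2 T a \<in> Cell2 B" "src2 B (map2 T a) = map1 T (src2 A a)"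
    "trg2 B (map2 T a) = map1 T (trg2 A a)" if "a \<in> Cell2 A" for a
    using axioms that by (auto simp: two_functor_axioms_def hom2_def)
  have pres: "\<And>X. X \<in> Obj0 A \<Longrightarrow> map1 T (id1 A X) = id1 B (map0 T X)"
    "\<And>f g. \<lbrakk>f \<in> Mor1 A; g \<in> Mor1 A; trg1 A f = src1 A g\<rbrakk>
      \<Longrightarrow> map1 T (comp1 A g f) = comp1 B (map1 T g) (map1 T f)"
    "\<And>f. f \<in> Mor1 A \<Longrightarrow> map2 T (id2 A f) = id2 B (map1 T f)"
    "\<And>a b. \<lbrakk>a \<in> Cell2 A; b \<in> Cell2 A; trg2 A a = src2 A b\<rbrakk>
      \<Longrightarrow> map2 T (vcomp A b a) = vcomp B (map2 T b) (map2 T a)"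
    "\<And>a b. \<lbrakk>a \<in> Cell2 A; b \<in> Cell2 A; trg0 A a = src0 A b\<rbrakk>
      \<Longrightarrow> map2 T (hcomp A b a) = hcomp B (map2 T b) (map2 T a)"
    using axioms by (auto simp: two_functor_axioms_def)
  have id1': "id1 A X \<in> Mor1 A" "src1 A (id1 A X) = X" "trg1 A (id1 A X) = X" if "X \<in> Obj0 A" for X
    using id1[OF that] by (auto simp: hom1_def)
  have comp1': "comp1 A g f \<in> Mor1 A" "src1 A (comp1 A g f) = src1 A f" "trg1 A (comp1 A g f) = trg1 A g"
    if "f \<in> Mor1 A" "g \<in> Mor1 A" "trg1 A f = src1 A g" for f g
    using comp1[OF that] by (auto simp: hom1_def)
  have trg2': "trg2 A a \<in> Mor1 A" "src1 A (trg2 A a) = src0 A a" "trg1 A (trg2 A a) = trg0 A a"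
    if "a \<in> Cell2 A" for a
    using trg2[OF that] by (auto simp: hom1_def)
  have id2': "id2 A f \<in> Cell2 A" "src2 A (id2 A f) = f" "trg2 A (id2 A f) = f" if "f \<in> Mor1 A" for f
    using id2[OF that] by (auto simp: hom2_def)
  have vcomp': "vcomp A b a \<in> Cell2 A" "src2 A (vcomp A b a) = src2 A a" "trg2 A (vcomp A b a) = trg2 A b"
    if "a \<in> Cell2 A" "b \<in> Cell2 A" "trg2 A a = src2 A b" for a b
    using vcomp[OF that] by (auto simp: hom2_def)
  have hcomp': "hcomp A b a \<in> Cell2 A" "src2 A (hcomp A b a) = comp1 A (src2 A b) (src2 A a)"
    "trg2 A (hcomp A b a) = comp1 A (trg2 A b) (trg2 A a)"
    if "a \<in> Cell2 A" "b \<in> Cell2 A" "trg0 A a = src0 A b" for a b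
    using hcomp[OF that] by (auto simp: hom2_def)
  note [simp] = src1 trg1 id1' comp1' trg2' id2' vcomp' hcomp' comp1_id1 id1_comp1 comp1_assoc src2
    pres map2 src1_map1 trg1_map1 Mor1_map1
  have "two_category A"
  proof
    fix a assume "a \<in> Cell2 A"
    then show "vcomp A a (id2 A (src2 A a)) = a"
      using B.vcomp_id2[of "map2 T a"] by (intro inj) simp_all
  next
    fix a assume "a \<in> Cell2 A"
    then show "vcomp A (id2 A (trg2 A a)) a = a"
      using B.id2_vcomp[of "map2 T a"] by (intro inj) simp_all
  next
    fix a b c assume "a \<in> Cell2 A" "b \<in> Cell2 A" "c \<in> Cell2 A" "trg2 A a = src2 A b" "trg2 A b = src2 A c"
    then show "vcomp A (vcomp A c b) a = vcomp A c (vcomp A b a)"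
      by (intro inj) (simp_all add: B.vcomp_assoc)
  next
    fix a assume "a \<in> Cell2 A"
    \<comment> \<open>Before \<open>inj\<close> applies, both sides must be seen to have the same
      target. This is the unit law for \<open>trg2 A a\<close>, which speaks of
      \<open>src1 A (trg2 A a)\<close>; the rewrite of that source to \<open>src0 A a\<close> is
      therefore controlled by hand.\<close>
    then show "hcomp A a (id2 A (id1 A (src0 A a))) = a"
      using B.hcomp_id[of "map2 T a"] trg2'(2)[of a] comp1_id1[of "trg2 A a"]
      by (intro inj) (simp_all del: trg2' comp1_id1 add: trg2'(1) comp1_id1[of "src2 A a"])
  next
    fix a assume "a \<in> Cell2 A"
    then show "hcomp A (id2 A (id1 A (trg0 A a))) a = a"
      using B.id_hcomp[of "map2 T a"] trg2'(3)[of a] id1_comp1[of "trg2 A a"]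
      by (intro inj) (simp_all del: trg2' id1_comp1 add: trg2'(1) id1_comp1[of "src2 A a"])
  next
    fix a b c assume "a \<in> Cell2 A" "b \<in> Cell2 A" "c \<in> Cell2 A" "trg0 A a = src0 A b" "trg0 A b = src0 A c"
    then show "hcomp A (hcomp A c b) a = hcomp A c (hcomp A b a)"
      by (intro inj) (simp_all add: B.hcomp_assoc)
  next
    fix f g assume "f \<in> Mor1 A" "g \<in> Mor1 A" "trg1 A f = src1 A g"
    then show "hcomp A (id2 A g) (id2 A f) = id2 A (comp1 A g f)"
      by (intro inj) (simp_all add: B.hcomp_id2)
  next
    fix a a' b b' assume *: "a \<in> Cell2 A" "a' \<in> Cell2 A" "b \<in> Cell2 A" "b' \<in> Cell2 A"
      "trg2 A a = src2 A a'" "trg2 A b = src2 A b'" "trg0 A a = src0 A b"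
    have **: "src0 A a' = src0 A a" "trg0 A a' = trg0 A a" "src0 A b' = src0 A b" "trg0 A b' = trg0 A b"
      using * trg2'[of a] trg2'[of b] by simp_all
    show "hcomp A (vcomp A b' b) (vcomp A a' a) = vcomp A (hcomp A b' a') (hcomp A b a)"
      using * ** by (intro inj) (simp_all add: B.interchange)
  qed (use id1 comp1 trg2 id2 vcomp hcomp in auto)
  then show ?thesis using axioms assms(1) by (intro two_functor.intro)
qed

section \<open>The 2-category of categories\<close>

lemma Cat_simps [simp]:
  "Obj0 Cat = {C. category C}" "Mor1 Cat = {F. is_functor F}" "Cell2 Cat = {t. natural_transformation t}"
  "src1 Cat = fdom" "trg1 Cat = fcod" "src2 Cat = nsrc" "trg2 Cat = ntrg"
  "id1 Cat = id_func" "comp1 Cat = comp_func" "id2 Cat = nid" "vcomp Cat = nvcomp" "hcomp Cat = nhcomp"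
  by (simp_all add: Cat_def)

lemma nat_transD:
  "nat_trans C D t \<Longrightarrow> functor_between C D (nsrc t)"
  "nat_trans C D t \<Longrightarrow> functor_between C D (ntrg t)"
  "nat_trans C D t \<Longrightarrow> fdom (nsrc t) = C" "nat_trans C D t \<Longrightarrow> fcod (nsrc t) = D"
  by (simp_all add: nat_trans_def functor_between_def)

lemma two_category_Cat: "two_category Cat"
proof
  fix F :: "('a, 'a cat) func"
  assume "F \<in> Mor1 Cat"
  then obtain C D where F: "functor_between C D F" by (auto dest: functor_between_self)
  interpret F: functor_between C D F by fact
  show "src1 Cat F \<in> Obj0 Cat" "trg1 Cat F \<in> Obj0 Cat"
    by (simp_all add: F.C.category_axioms F.D.category_axioms)
  show "comp1 Cat F (id1 Cat (src1 Cat F)) = F" "comp1 Cat (id1 Cat (trg1 Cat F)) F = F"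
    using comp_func_id[OF F] by simp_all
  show "id2 Cat F \<in> hom2 Cat F F"
    using nat_trans_nid[OF F] by (auto simp: hom2_def natural_transformation_iff)
  fix G assume "G \<in> Mor1 Cat" "trg1 Cat F = src1 Cat G"
  then obtain E where G: "functor_between D E G" by (auto dest: functor_between_self)
  interpret G: functor_between D E G by fact
  interpret GF: functor_between C E "comp_func G F" by (rule functor_between_comp) fact+
  show "comp1 Cat G F \<in> hom1 Cat (src1 Cat F) (trg1 Cat G)"
    using GF.is_functor by (simp add: hom1_def)
  show "hcomp Cat (id2 Cat G) (id2 Cat F) = id2 Cat (comp1 Cat G F)"
    unfolding Cat_simps
    by (rule ntrans_eqI[OF nat_trans_nhcomp[OF nat_trans_nid[OF F] nat_trans_nid[OF G]]
          nat_trans_nid[OF GF.functor_between_axioms]]) simp_all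
  fix H assume "H \<in> Mor1 Cat" "trg1 Cat G = src1 Cat H"
  then obtain E' where H: "functor_between E E' H" by (auto dest: functor_between_self)
  show "comp1 Cat (comp1 Cat H G) F = comp1 Cat H (comp1 Cat G F)"
    using comp_func_assoc[OF F G H] by simp
next
  fix C :: "'a cat"
  assume "C \<in> Obj0 Cat"
  then show "id1 Cat C \<in> hom1 Cat C C"
    using functor_between_id[of C] by (auto simp: hom1_def functor_between_def)
next
  fix t :: "'a ntrans"
  assume "t \<in> Cell2 Cat"
  then obtain C D where t: "nat_trans C D t" by (auto simp: natural_transformation_iff)
  interpret t: nat_trans C D t by fact
  note S = t.S.functor_between_axioms and T = t.T.functor_between_axioms
  show "src2 Cat t \<in> Mor1 Cat" "trg2 Cat t \<in> hom1 Cat (src0 Cat t) (trg0 Cat t)"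
    by (simp_all add: t.S.is_functor t.T.is_functor hom1_def)
  show "vcomp Cat t (id2 Cat (src2 Cat t)) = t"
    unfolding Cat_simps
    by (rule ntrans_eqI[OF nat_trans_nvcomp[OF nat_trans_nid[OF S] t] t]) simp_all
  show "vcomp Cat (id2 Cat (trg2 Cat t)) t = t"
    unfolding Cat_simps
    by (rule ntrans_eqI[OF nat_trans_nvcomp[OF t nat_trans_nid[OF T]] t]) simp_all
  show "hcomp Cat t (id2 Cat (id1 Cat (src0 Cat t))) = t"
    unfolding Cat_simps t.S.fdom
    by (rule ntrans_eqI[OF nat_trans_nhcomp[OF nat_trans_nid[OF functor_between_id] t] t])
      (simp_all add: t.S.C.category_axioms comp_func_id[OF S] comp_func_id[OF T])
  show "hcomp Cat (id2 Cat (id1 Cat (trg0 Cat t))) t = t"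
    unfolding Cat_simps t.S.fcod
    by (rule ntrans_eqI[OF nat_trans_nhcomp[OF t nat_trans_nid[OF functor_between_id]] t])
      (simp_all add: t.S.D.category_axioms comp_func_id[OF S] comp_func_id[OF T])
next
  fix t u :: "'a ntrans"
  assume "t \<in> Cell2 Cat" "u \<in> Cell2 Cat" and e: "trg2 Cat t = src2 Cat u"
  then obtain C D E E' where t: "nat_trans C D t" and "nat_trans E E' u"
    by (auto simp: natural_transformation_iff)
  moreover from this e have "E = C" "E' = D" using nat_transD[of C D t] nat_transD[of E E' u]
    by (simp_all add: functor_between_def)
  ultimately have u: "nat_trans C D u" by simp
  show "vcomp Cat u t \<in> hom2 Cat (src2 Cat t) (trg2 Cat u)"
    using nat_trans_nvcomp[OF t u] e by (auto simp: hom2_def natural_transformation_iff)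
  fix v assume "v \<in> Cell2 Cat" and e': "trg2 Cat u = src2 Cat v"
  then obtain E E' where "nat_trans E E' v"
    by (auto simp: natural_transformation_iff)
  moreover from this e' have "E = C" "E' = D" using nat_transD[OF u] nat_transD[of E E' v]
    by (simp_all add: functor_between_def)
  ultimately have v: "nat_trans C D v" by simp
  interpret t: nat_trans C D t by fact
  interpret u: nat_trans C D u by fact
  interpret v: nat_trans C D v by fact
  have [simp]: "nsrc u = ntrg t" "nsrc v = ntrg u" using e e' by simp_all
  show "vcomp Cat (vcomp Cat v u) t = vcomp Cat v (vcomp Cat u t)"
    unfolding Cat_simps
    by (rule ntrans_eqI[of C D]) (simp_all add: nat_trans_nvcomp t u v)
next
  fix t u :: "'a ntrans"
  assume "t \<in> Cell2 Cat" "u \<in> Cell2 Cat" and e: "trg0 Cat t = src0 Cat u"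
  then obtain C D E where t: "nat_trans C D t" and u: "nat_trans D E u"
    by (auto simp: natural_transformation_iff nat_transD)
  show "hcomp Cat u t \<in> hom2 Cat (comp1 Cat (src2 Cat u) (src2 Cat t)) (comp1 Cat (trg2 Cat u) (trg2 Cat t))"
    using nat_trans_nhcomp[OF t u] by (auto simp: hom2_def natural_transformation_iff)
  fix v assume "v \<in> Cell2 Cat" and e': "trg0 Cat u = src0 Cat v"
  then obtain E' where v: "nat_trans E E' v"
    using nat_transD[OF u] by (auto simp: natural_transformation_iff nat_transD)
  interpret t: nat_trans C D t by fact
  interpret u: nat_trans D E u by fact
  interpret v: nat_trans E E' v by fact
  show "hcomp Cat (hcomp Cat v u) t = hcomp Cat v (hcomp Cat u t)"
    unfolding Cat_simps
  proof (rule ntrans_eqI[of C E'])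
    show "nat_trans C E' (nhcomp (nhcomp v u) t)" "nat_trans C E' (nhcomp v (nhcomp u t))"
      using t u v by (blast intro: nat_trans_nhcomp)+
  qed (simp_all add: comp_func_assoc[OF nat_transD(1)[OF t] nat_transD(1)[OF u] nat_transD(1)[OF v]]
      comp_func_assoc[OF nat_transD(2)[OF t] nat_transD(2)[OF u] nat_transD(2)[OF v]])
next
  fix t t' u u' :: "'a ntrans"
  assume "t \<in> Cell2 Cat" "t' \<in> Cell2 Cat" "u \<in> Cell2 Cat" "u' \<in> Cell2 Cat"
    and e: "trg2 Cat t = src2 Cat t'" "trg2 Cat u = src2 Cat u'" "trg0 Cat t = src0 Cat u"
  then obtain C D E where t: "nat_trans C D t" and u: "nat_trans D E u"
    by (auto simp: natural_transformation_iff nat_transD)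
  have t': "nat_trans C D t'"
    using \<open>t' \<in> Cell2 Cat\<close> nat_transD[OF t] e by (auto simp: natural_transformation_iff nat_transD functor_between_def)
  have u': "nat_trans D E u'"
    using \<open>u' \<in> Cell2 Cat\<close> nat_transD[OF u] e by (auto simp: natural_transformation_iff nat_transD functor_between_def)
  interpret t: nat_trans C D t by fact
  interpret u: nat_trans D E u by fact
  interpret t': nat_trans C D t' by fact
  interpret u': nat_trans D E u' by fact
  have [simp]: "nsrc t' = ntrg t" "nsrc u' = ntrg u" using e by simp_all
  show "hcomp Cat (vcomp Cat u' u) (vcomp Cat t' t) = vcomp Cat (hcomp Cat u' t') (hcomp Cat u t)"
    unfolding Cat_simps
  proof (rule ntrans_eqI[of C E])
    show "nat_trans C E (nhcomp (nvcomp u' u) (nvcomp t' t))"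
      using t t' u u' by (intro nat_trans_nhcomp[of C D _ E] nat_trans_nvcomp) simp_all
    show "nat_trans C E (nvcomp (nhcomp u' t') (nhcomp u t))"
      using t t' u u' by (intro nat_trans_nvcomp nat_trans_nhcomp[of C D _ E]) simp_all
    fix X assume X: "X \<in> Obj C"
    have "ncomp u (omap (ntrg t') X) \<cdot>\<^bsub>E\<^esub> (amap (nsrc u) (ncomp t' X) \<cdot>\<^bsub>E\<^esub> amap (nsrc u) (ncomp t X)) =
      (ncomp u (Cod D (ncomp t' X)) \<cdot>\<^bsub>E\<^esub> amap (nsrc u) (ncomp t' X)) \<cdot>\<^bsub>E\<^esub> amap (nsrc u) (ncomp t X)"
      using X by simp
    \<comment> \<open>Interchange comes down to naturality of \<open>u\<close> at the component of
      \<open>t'\<close>.\<close>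
    also have "\<dots> = amap (ntrg u) (ncomp t' X) \<cdot>\<^bsub>E\<^esub> (ncomp u (omap (ntrg t) X) \<cdot>\<^bsub>E\<^esub> amap (nsrc u) (ncomp t X))"
      using X by (subst u.naturality[symmetric]) simp_all
    finally show "ncomp (nhcomp (nvcomp u' u) (nvcomp t' t)) X =
        ncomp (nvcomp (nhcomp u' t') (nhcomp u t)) X"
      using X by simp
  qed simp_all
qed

section \<open>Ordered groupoids\<close>

context ordered_groupoid
begin

lemma inverse_arrows_inv_arrow: "f \<in> Arr G \<Longrightarrow> inverse_arrows G f (inv_arrow G f)"
proof -
  assume f: "f \<in> Arr G"
  then obtain g where g: "inverse_arrows G f g" using all_iso by (auto simp: iso_def)
  have "g' = g" if "inverse_arrows G f g'" for g'
  proof -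
    have "g' = g' \<cdot> (f \<cdot> g)" using that g by (simp add: inverse_arrows_def hom_def)
    also have "\<dots> = (g' \<cdot> f) \<cdot> g" using that g by (subst assoc) (simp_all add: inverse_arrows_def hom_def)
    also have "\<dots> = g" using that g by (simp add: inverse_arrows_def hom_def)
    finally show ?thesis .
  qed
  then show ?thesis unfolding inv_arrow_def using g by (metis theI)
qed

lemma inv_simps [simp]:
  assumes "f \<in> Arr G"
  shows "inv_arrow G f \<in> Arr G" "Dom G (inv_arrow G f) = Cod G f" "Cod G (inv_arrow G f) = Dom G f"
    "inv_arrow G f \<cdot> f = Ident G (Dom G f)" "f \<cdot> inv_arrow G f = Ident G (Cod G f)"
  using inverse_arrows_inv_arrow[OF assms] by (simp_all add: inverse_arrows_def hom_def)

text \<open>\<open>assoc\<close> brackets composites to the right, so an arrow and its inverse meet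
  with a tail still attached; these forms let simp cancel them there.\<close>

lemma inv_cancel [simp]:
  assumes "f \<in> Arr G" "g \<in> Arr G"
  shows "Cod G g = Dom G f \<Longrightarrow> inv_arrow G f \<cdot> (f \<cdot> g) = g"
    "Cod G g = Cod G f \<Longrightarrow> f \<cdot> (inv_arrow G f \<cdot> g) = g"
  using assms by (simp_all flip: assoc)

lemma inv_eqI:
  assumes "f \<in> Arr G" "g \<in> Arr G" "Dom G g = Cod G f" "g \<cdot> f = Ident G (Dom G f)"
  shows "inv_arrow G f = g"
proof -
  have "g = (g \<cdot> f) \<cdot> inv_arrow G f" using assms(1-3) by simp
  then show ?thesis using assms(1,4) by simp
qed

lemma inv_Ident [simp]: "A \<in> Obj G \<Longrightarrow> inv_arrow G (Ident G A) = Ident G A"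
  by (rule inv_eqI) simp_all

lemma inv_inv [simp]: "f \<in> Arr G \<Longrightarrow> inv_arrow G (inv_arrow G f) = f"
  by (rule inv_eqI) simp_all

lemma inv_Comp [simp]:
  "\<lbrakk>g \<in> Arr G; f \<in> Arr G; Dom G g = Cod G f\<rbrakk>
    \<Longrightarrow> inv_arrow G (g \<cdot> f) = inv_arrow G f \<cdot> inv_arrow G g"
  by (rule inv_eqI) simp_all

lemma Le_Arr: "(a, b) \<in> Le G \<Longrightarrow> a \<in> Arr G" "(a, b) \<in> Le G \<Longrightarrow> b \<in> Arr G"
  using Le_order by (auto simp: partial_order_on_def preorder_on_def)

lemma Le_refl [simp]: "a \<in> Arr G \<Longrightarrow> (a, a) \<in> Le G"
  using Le_order by (auto simp: partial_order_on_def preorder_on_def refl_on_def)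

lemma Le_trans: "\<lbrakk>(a, b) \<in> Le G; (b, c) \<in> Le G\<rbrakk> \<Longrightarrow> (a, c) \<in> Le G"
  using Le_order by (auto simp: partial_order_on_def preorder_on_def trans_def)

lemma Le_antisym: "\<lbrakk>(a, b) \<in> Le G; (b, a) \<in> Le G\<rbrakk> \<Longrightarrow> a = b"
  using Le_order by (auto simp: partial_order_on_def antisym_def)

lemma Le_Comp':
  "\<lbrakk>(a, b) \<in> Le G; (c, d) \<in> Le G; Dom G a = Cod G c; Dom G b = Cod G d\<rbrakk> \<Longrightarrow> (a \<cdot> c, b \<cdot> d) \<in> Le G"
  using Le_Comp Le_Arr by (simp add: composable_def)

lemma obj_leD: "obj_le G A B \<Longrightarrow> A \<in> Obj G" "obj_le G A B \<Longrightarrow> B \<in> Obj G"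
  by (simp_all add: obj_le_def)

lemma obj_le_refl [simp]: "A \<in> Obj G \<Longrightarrow> obj_le G A A"
  by (simp add: obj_le_def)

lemma obj_le_trans: "\<lbrakk>obj_le G A B; obj_le G B E\<rbrakk> \<Longrightarrow> obj_le G A E"
  using Le_trans by (auto simp: obj_le_def)

lemma obj_le_antisym: "\<lbrakk>obj_le G A B; obj_le G B A\<rbrakk> \<Longrightarrow> A = B"
  using Le_antisym Ident_simps(2) by (metis obj_le_def)

text \<open>The identity on the domain of \<open>a\<close> is the inverse of \<open>a\<close>
  composed with \<open>a\<close>, and both inversion and composition are monotone.\<close>

lemma Le_Dom: "(a, b) \<in> Le G \<Longrightarrow> obj_le G (Dom G a) (Dom G b)"
  using Le_Comp'[OF Le_inv, of a b a b] Le_Arr[of a b] by (simp add: obj_le_def)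

lemma Le_Cod: "(a, b) \<in> Le G \<Longrightarrow> obj_le G (Cod G a) (Cod G b)"
  using Le_Dom[OF Le_inv, of a b] Le_Arr[of a b] by simp

lemma restr_simps [simp]:
  assumes "f \<in> Arr G" "obj_le G A (Dom G f)"
  shows "(restr G f A, f) \<in> Le G" "restr G f A \<in> Arr G" "Dom G (restr G f A) = A"
proof -
  show "(restr G f A, f) \<in> Le G" "Dom G (restr G f A) = A"
    using theI'[OF ex1_restr[OF assms]] by (simp_all add: restr_def)
  then show "restr G f A \<in> Arr G" using Le_Arr by blast
qed

text \<open>The working form of uniqueness: a restriction is computed by exhibiting an arrow below
  \<open>f\<close> with the right domain.\<close>

lemma restr_eqI: "(f', f) \<in> Le G \<Longrightarrow> restr G f (Dom G f') = f'"
  using ex1_restr[OF Le_Arr(2) Le_Dom, of f' f f'] restr_simps[OF Le_Arr(2) Le_Dom, of f' f f'] by blast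

lemma Le_eq: "\<lbrakk>(a, b) \<in> Le G; (a', b) \<in> Le G; Dom G a = Dom G a'\<rbrakk> \<Longrightarrow> a = a'"
  using restr_eqI by metis

text \<open>Inversion is monotone and exchanges domain and codomain, so this is \<open>Le_eq\<close>
  for the inverses.\<close>

lemma Le_eq_Cod: "\<lbrakk>(a, b) \<in> Le G; (a', b) \<in> Le G; Cod G a = Cod G a'\<rbrakk> \<Longrightarrow> a = a'"
  using Le_eq[OF Le_inv Le_inv, of a b a'] inv_inv Le_Arr inv_simps(2) by metis

lemma Cod_restr: "\<lbrakk>f \<in> Arr G; obj_le G A (Dom G f)\<rbrakk> \<Longrightarrow> obj_le G (Cod G (restr G f A)) (Cod G f)"
  by (simp add: Le_Cod)

lemma restr_Dom [simp]: "\<lbrakk>f \<in> Arr G; A = Dom G f\<rbrakk> \<Longrightarrow> restr G f A = f"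
  using restr_eqI[of f f] by simp

text \<open>Restrict \<open>f'\<close> in two stages, to \<open>A'\<close> and then to
  \<open>A\<close>. The result lies below \<open>f'\<close> and has domain \<open>A\<close>, as does
  \<open>restr G f A\<close>, so the two coincide.\<close>

lemma restr_Le:
  assumes "(f, f') \<in> Le G" "obj_le G A (Dom G f)" "obj_le G A' (Dom G f')" "obj_le G A A'"
  shows "(restr G f A, restr G f' A') \<in> Le G"
proof -
  have f: "f \<in> Arr G" "f' \<in> Arr G" using assms Le_Arr by auto
  have 1: "(restr G f' A', f') \<in> Le G" "restr G f' A' \<in> Arr G" "Dom G (restr G f' A') = A'"
    using assms(3) f by simp_all
  have 2: "(restr G f A, f) \<in> Le G" "Dom G (restr G f A) = A"
    using assms(2) f by simp_all
  have 3: "(restr G (restr G f' A') A, restr G f' A') \<in> Le G" "Dom G (restr G (restr G f' A') A) = A"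
    using restr_simps[OF 1(2)] assms(4) 1(3) by simp_all
  have "restr G f A = restr G (restr G f' A') A"
    using Le_eq[OF Le_trans[OF 2(1) assms(1)] Le_trans[OF 3(1) 1(1)]] 2(2) 3(2) by metis
  then show ?thesis using 3(1) by simp
qed

lemma restr_restr [simp]:
  "\<lbrakk>f \<in> Arr G; obj_le G A (Dom G f); obj_le G B A\<rbrakk> \<Longrightarrow> restr G (restr G f A) B = restr G f B"
  using restr_Le[of f f B A] restr_eqI[of "restr G f B" "restr G f A"] obj_le_trans[of B A] by simp

lemma restr_Ident [simp]: "obj_le G A B \<Longrightarrow> restr G (Ident G B) A = Ident G A"
  using restr_eqI[of "Ident G A" "Ident G B"] by (simp add: obj_le_def)

text \<open>The composite of the two restrictions lies below \<open>g \<cdot> f\<close> and starts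
  at \<open>A\<close>, so \<open>restr_eqI\<close> recognises it.\<close>

lemma restr_Comp:
  assumes "g \<in> Arr G" "f \<in> Arr G" "Dom G g = Cod G f" "obj_le G A (Dom G f)"
  shows "restr G (g \<cdot> f) A = restr G g (Cod G (restr G f A)) \<cdot> restr G f A"
  using restr_eqI[OF Le_Comp', of "restr G g (Cod G (restr G f A))" g "restr G f A" f]
    assms Cod_restr[of f A] by simp

end

locale ordered_functor =
  functor_between C D F + C: ordered_groupoid C + D: ordered_groupoid D
  for C D :: "'u ogpd" and F +
  assumes Le_amap: "(a, b) \<in> Le C \<Longrightarrow> (amap F a, amap F b) \<in> Le D"
begin

lemma obj_le_omap [simp]: "obj_le C A B \<Longrightarrow> obj_le D (omap F A) (omap F B)"
  using Le_amap[of "Ident C A" "Ident C B"] by (simp add: obj_le_def)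

lemma amap_restr [simp]:
  "\<lbrakk>f \<in> Arr C; obj_le C A (Dom C f)\<rbrakk> \<Longrightarrow> amap F (restr C f A) = restr D (amap F f) (omap F A)"
  using D.restr_eqI[OF Le_amap, of "restr C f A" f] by simp

lemma amap_inv [simp]: "f \<in> Arr C \<Longrightarrow> amap F (inv_arrow C f) = inv_arrow D (amap F f)"
  using amap_Comp[of "inv_arrow C f" f] by (intro D.inv_eqI[symmetric]) simp_all

end

lemmas ordered_functorI = ordered_functor.intro[OF _ _ _ ordered_functor_axioms.intro]

lemma double_functor_iff: "double_functor F \<longleftrightarrow> (\<exists>C D. ordered_functor C D F)"
  by (auto simp: double_functor_def ordered_functor_def ordered_functor_axioms_def functor_between_def)

lemma ordered_functorD:
  "ordered_functor C D F \<Longrightarrow> functor_between C D F"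
  "ordered_functor C D F \<Longrightarrow> fdom F = C" "ordered_functor C D F \<Longrightarrow> fcod F = D"
  by (auto simp: ordered_functor_def functor_between_def)

lemma ordered_functor_id: "ordered_groupoid G \<Longrightarrow> ordered_functor G G (id_func G)"
proof -
  assume "ordered_groupoid G"
  then interpret ordered_groupoid G .
  show ?thesis
    by (rule ordered_functorI)
      (simp_all add: functor_between_id category_axioms ordered_groupoid_axioms Le_Arr)
qed

lemma ordered_functor_comp:
  assumes "ordered_functor C D F" "ordered_functor D E G"
  shows "ordered_functor C E (comp_func G F)"
proof -
  interpret F: ordered_functor C D F by fact
  interpret G: ordered_functor D E G by fact
  show ?thesis
    by (rule ordered_functorI)
      (use F.Le_amap G.Le_amap functor_between_comp[OF F.functor_between_axioms G.functor_between_axioms]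
        F.C.Le_Arr in \<open>auto simp: F.C.ordered_groupoid_axioms G.D.ordered_groupoid_axioms\<close>)
qed

text \<open>
  The intermediate functor of a \<open>\<Lambda>\<close>-transformation is determined by the components and the target:
  it sends \<open>X\<close> to the codomain of the component at \<open>X\<close>, and arrows to restrictions of their images
  under the target.
\<close>

locale lambda_trans = S: ordered_functor C D "lsrc t" + T: ordered_functor C D "ltrg t"
  for C D :: "'u ogpd" and t :: "'u ltrans" +
  assumes extensional: "lcomp t \<in> extensional (Obj C)"
    and lcomp_simps [simp]: "X \<in> Obj C \<Longrightarrow> lcomp t X \<in> Arr D"
      "X \<in> Obj C \<Longrightarrow> Dom D (lcomp t X) = omap (lsrc t) X"
      "X \<in> Obj C \<Longrightarrow> obj_le D (Cod D (lcomp t X)) (omap (ltrg t) X)"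
    and naturality: "f \<in> Arr C \<Longrightarrow>
      restr D (amap (ltrg t) f) (Cod D (lcomp t (Dom C f))) \<cdot>\<^bsub>D\<^esub> lcomp t (Dom C f) =
      lcomp t (Cod C f) \<cdot>\<^bsub>D\<^esub> amap (lsrc t) f"
    and Le_lcomp: "obj_le C X Y \<Longrightarrow> (lcomp t X, lcomp t Y) \<in> Le D"
    and lmid: "lmid t = \<lparr>fdom = C, fcod = D, omap = (\<lambda>X \<in> Obj C. Cod D (lcomp t X)),
      amap = (\<lambda>f \<in> Arr C. restr D (amap (ltrg t) f) (Cod D (lcomp t (Dom C f))))\<rparr>"
begin

text \<open>The two sides of the naturality square have the same codomain. This makes the formula
  for \<open>lmid\<close> well typed on arrows.\<close>

lemma Cod_restr_ltrg [simp]: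
  assumes f: "f \<in> Arr C"
  shows "Cod D (restr D (amap (ltrg t) f) (Cod D (lcomp t (Dom C f)))) = Cod D (lcomp t (Cod C f))"
proof -
  have "Cod D (restr D (amap (ltrg t) f) (Cod D (lcomp t (Dom C f)))) =
    Cod D (restr D (amap (ltrg t) f) (Cod D (lcomp t (Dom C f))) \<cdot>\<^bsub>D\<^esub> lcomp t (Dom C f))"
    using f by simp
  also have "\<dots> = Cod D (lcomp t (Cod C f))"
    using f by (subst naturality) simp_all
  finally show ?thesis .
qed

text \<open>Restriction respects composition and order, so cutting the target functor down along the
  codomains of the components, which increase with the object, leaves a double functor.\<close>

lemma lmid_ordered_functor: "ordered_functor C D (lmid t)"
proof (rule ordered_functorI)
  show "functor_between C D (lmid t)"
    by (rule functor_betweenI)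
      (auto simp: lmid S.C.category_axioms S.D.category_axioms S.D.restr_Comp)
  fix a b assume ab: "(a, b) \<in> Le C"
  then have [simp]: "a \<in> Arr C" "b \<in> Arr C" using S.C.Le_Arr by auto
  show "(amap (lmid t) a, amap (lmid t) b) \<in> Le D"
    using S.D.restr_Le[OF T.Le_amap[OF ab]] S.D.Le_Cod[OF Le_lcomp[OF S.C.Le_Dom[OF ab]]]
    by (simp add: lmid)
qed (auto simp: S.C.ordered_groupoid_axioms S.D.ordered_groupoid_axioms)

lemma lambda_transformation: "lambda_transformation t"
proof -
  interpret M: ordered_functor C D "lmid t" by (rule lmid_ordered_functor)
  have [simp]: "omap (lmid t) X = Cod D (lcomp t X)" if "X \<in> Obj C" for X
    using that by (simp add: lmid)
  have [simp]: "amap (lmid t) f = restr D (amap (ltrg t) f) (Cod D (lcomp t (Dom C f)))"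
    if "f \<in> Arr C" for f
    using that by (simp add: lmid)
  have "double_functor (lsrc t)" "double_functor (ltrg t)" "double_functor (lmid t)"
    using S.ordered_functor_axioms T.ordered_functor_axioms M.ordered_functor_axioms
      double_functor_iff by blast+
  then show ?thesis
    using extensional Le_lcomp naturality natural_iff[OF S.functor_between_axioms M.functor_between_axioms]
    by (auto simp: lambda_transformation_def horizontal_transformation_def func_le_def parallel_def)
qed

end

lemmas lambda_transI = lambda_trans.intro[OF _ _ lambda_trans_axioms.intro]

lemma lambda_transD:
  "lambda_trans C D t \<Longrightarrow> ordered_functor C D (lsrc t)"
  "lambda_trans C D t \<Longrightarrow> ordered_functor C D (ltrg t)"
  "lambda_trans C D t \<Longrightarrow> fdom (lsrc t) = C" "lambda_trans C D t \<Longrightarrow> fcod (lsrc t) = D"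
  "lambda_trans C D t \<Longrightarrow> fdom (ltrg t) = C" "lambda_trans C D t \<Longrightarrow> fcod (ltrg t) = D"
  by (simp_all add: lambda_trans_def ordered_functor_def functor_between_def)

lemma lambda_transformation_iff: "lambda_transformation t \<longleftrightarrow> (\<exists>C D. lambda_trans C D t)"
proof
  assume t: "lambda_transformation t"
  obtain C D where CD: "fdom (lsrc t) = C" "fcod (lsrc t) = D" by simp
  have "ordered_functor C D (lsrc t)" "ordered_functor C D (ltrg t)" "ordered_functor C D (lmid t)"
    using t CD unfolding lambda_transformation_def horizontal_transformation_def func_le_def parallel_def
      double_functor_def
    by (auto intro!: ordered_functorI functor_between.intro)
  then interpret S: ordered_functor C D "lsrc t" + T: ordered_functor C D "ltrg t" +
    M: ordered_functor C D "lmid t" .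
  have nat: "lcomp t \<in> extensional (Obj C)"
    "\<And>X. X \<in> Obj C \<Longrightarrow> lcomp t X \<in> Arr D \<and> Dom D (lcomp t X) = omap (lsrc t) X \<and>
       Cod D (lcomp t X) = omap (lmid t) X"
    "\<And>f. f \<in> Arr C \<Longrightarrow> amap (lmid t) f \<cdot>\<^bsub>D\<^esub> lcomp t (Dom C f) = lcomp t (Cod C f) \<cdot>\<^bsub>D\<^esub> amap (lsrc t) f"
    using t natural_iff[OF S.functor_between_axioms M.functor_between_axioms]
    by (auto simp: lambda_transformation_def horizontal_transformation_def)
  have le: "(amap (lmid t) f, amap (ltrg t) f) \<in> Le D" if "f \<in> Arr C" for f
    using t that by (auto simp: lambda_transformation_def func_le_def)
  have obj_le: "obj_le D (omap (lmid t) X) (omap (ltrg t) X)" if "X \<in> Obj C" for X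
    using le[of "Ident C X"] that by (simp add: obj_le_def)
  \<comment> \<open>\<open>lmid t\<close> lies below \<open>ltrg t\<close>, hence on arrows it is
    the restriction of \<open>ltrg t\<close> to its own domain.\<close>
  have eq: "amap (lmid t) f = restr D (amap (ltrg t) f) (omap (lmid t) (Dom C f))" if "f \<in> Arr C" for f
    using S.D.restr_eqI[OF le[OF that]] that by simp
  have mono: "(lcomp t X, lcomp t Y) \<in> Le D" if "obj_le C X Y" for X Y
    using t that by (auto simp: lambda_transformation_def horizontal_transformation_def)
  have "omap (lmid t) = (\<lambda>X \<in> Obj C. Cod D (lcomp t X))"
    by (rule extensionalityI[OF M.extensional(1)]) (auto simp: nat)
  moreover have "amap (lmid t) = (\<lambda>f \<in> Arr C. restr D (amap (ltrg t) f) (Cod D (lcomp t (Dom C f))))"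
    by (rule extensionalityI[OF M.extensional(2)]) (auto simp: nat eq)
  ultimately have lmid: "lmid t = \<lparr>fdom = C, fcod = D, omap = (\<lambda>X \<in> Obj C. Cod D (lcomp t X)),
      amap = (\<lambda>f \<in> Arr C. restr D (amap (ltrg t) f) (Cod D (lcomp t (Dom C f))))\<rparr>"
    by (intro func.equality) simp_all
  have "lambda_trans C D t"
    by (rule lambda_transI)
      (use nat obj_le mono lmid in \<open>auto simp: S.ordered_functor_axioms T.ordered_functor_axioms simp flip: eq\<close>)
  then show "\<exists>C D. lambda_trans C D t" by blast
next
  assume "\<exists>C D. lambda_trans C D t"
  then show "lambda_transformation t" using lambda_trans.lambda_transformation by blast
qed

lemma ltrans_eqI:
  assumes "lambda_trans C D t" "lambda_trans C D u" "lsrc t = lsrc u" "ltrg t = ltrg u"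
    and "\<And>X. X \<in> Obj C \<Longrightarrow> lcomp t X = lcomp u X"
  shows "t = u"
proof -
  have "lcomp t = lcomp u"
    using assms by (intro extensionalityI[of _ "Obj C"]) (auto dest: lambda_trans.extensional)
  moreover from this have "lmid t = lmid u"
    using assms lambda_trans.lmid[OF assms(1)] lambda_trans.lmid[OF assms(2)] by simp
  ultimately show ?thesis using assms(3,4) by (intro ltrans.equality) simp_all
qed

lemma lid_simps [simp]:
  "lsrc (lid F) = F" "ltrg (lid F) = F"
  "X \<in> Obj (fdom F) \<Longrightarrow> lcomp (lid F) X = Ident (fcod F) (omap F X)"
  by (simp_all add: lid_def)

lemma lvcomp_simps [simp]:
  "lsrc (lvcomp u t) = lsrc t" "ltrg (lvcomp u t) = ltrg u"
  by (simp_all add: lvcomp_def Let_def)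

lemma lambda_trans_lid:
  assumes "ordered_functor C D F" shows "lambda_trans C D (lid F)"
proof -
  interpret ordered_functor C D F by fact
  have "lmid (lid F) = \<lparr>fdom = C, fcod = D, omap = (\<lambda>X \<in> Obj C. Cod D (lcomp (lid F) X)),
      amap = (\<lambda>f \<in> Arr C. restr D (amap (ltrg (lid F)) f) (Cod D (lcomp (lid F) (Dom C f))))\<rparr>"
    by (rule func.equality) (auto simp: lid_def extensional intro!: extensionalityI[OF extensional(1)]
        extensionalityI[OF extensional(2)])
  moreover have "(Ident D (omap F X), Ident D (omap F Y)) \<in> Le D" if "obj_le C X Y" for X Y
    using obj_le_omap[OF that] by (simp add: obj_le_def)
  ultimately show ?thesis
    by (intro lambda_transI) (auto simp: ordered_functor_axioms lid_def dest: C.obj_leD)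
qed

lemma lcomp_lvcomp:
  assumes "lambda_trans C D t" "X \<in> Obj C"
  shows "lcomp (lvcomp u t) X = restr D (lcomp u X) (Cod D (lcomp t X)) \<cdot>\<^bsub>D\<^esub> lcomp t X"
  using assms lambda_trans.lmid[OF assms(1)] by (simp add: lvcomp_def Let_def lambda_transD)

lemma lambda_trans_lvcomp:
  assumes t: "lambda_trans C D t" and u: "lambda_trans C D u" and e: "ltrg t = lsrc u"
  shows "lambda_trans C D (lvcomp u t)"
proof -
  interpret t: lambda_trans C D t by fact
  interpret u: lambda_trans C D u by fact
  have [simp]: "lsrc u = ltrg t" using e by simp
  define g where "g X = restr D (lcomp u X) (Cod D (lcomp t X))" for X
  have g [simp]: "g X \<in> Arr D" "Dom D (g X) = Cod D (lcomp t X)"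
    "obj_le D (Cod D (g X)) (Cod D (lcomp u X))" if "X \<in> Obj C" for X
    using that t.S.D.Cod_restr[of "lcomp u X" "Cod D (lcomp t X)"] by (simp_all add: g_def)
  have g' [simp]: "obj_le D (Cod D (g X)) (omap (ltrg u) X)" if "X \<in> Obj C" for X
    using t.S.D.obj_le_trans[OF g(3) u.lcomp_simps(3)] that by blast
  have lc [simp]: "lcomp (lvcomp u t) X = g X \<cdot>\<^bsub>D\<^esub> lcomp t X" if "X \<in> Obj C" for X
    using that by (simp add: lcomp_lvcomp[OF t] g_def)
  \<comment> \<open>Both sides of the naturality square of \<open>u\<close> at \<open>f\<close> are
    restricted to the codomain of \<open>lcomp t (Dom C f)\<close>, and \<open>restr_Comp\<close>
    distributes the restriction over the composites. The resulting square is pasted to that of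
    \<open>t\<close> below.\<close>
  have g_nat: "restr D (amap (ltrg u) f) (Cod D (g (Dom C f))) \<cdot>\<^bsub>D\<^esub> g (Dom C f) =
    g (Cod C f) \<cdot>\<^bsub>D\<^esub> restr D (amap (ltrg t) f) (Cod D (lcomp t (Dom C f)))" if f: "f \<in> Arr C" for f
  proof -
    have "restr D (restr D (amap (ltrg u) f) (Cod D (lcomp u (Dom C f))) \<cdot>\<^bsub>D\<^esub> lcomp u (Dom C f))
        (Cod D (lcomp t (Dom C f))) =
      restr D (lcomp u (Cod C f) \<cdot>\<^bsub>D\<^esub> amap (ltrg t) f) (Cod D (lcomp t (Dom C f)))"
      using u.naturality[OF f] by simp
    then show ?thesis
      using f g(3)[of "Dom C f"] by (simp add: t.S.D.restr_Comp flip: g_def)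
  qed
  show ?thesis
  proof (rule lambda_transI)
    fix f assume f: "f \<in> Arr C"
    have "restr D (amap (ltrg u) f) (Cod D (g (Dom C f))) \<cdot>\<^bsub>D\<^esub> (g (Dom C f) \<cdot>\<^bsub>D\<^esub> lcomp t (Dom C f)) =
      (restr D (amap (ltrg u) f) (Cod D (g (Dom C f))) \<cdot>\<^bsub>D\<^esub> g (Dom C f)) \<cdot>\<^bsub>D\<^esub> lcomp t (Dom C f)"
      using f by simp
    also have "\<dots> = g (Cod C f) \<cdot>\<^bsub>D\<^esub> (restr D (amap (ltrg t) f) (Cod D (lcomp t (Dom C f))) \<cdot>\<^bsub>D\<^esub> lcomp t (Dom C f))"
      using f by (subst g_nat) simp_all
    also have "\<dots> = (g (Cod C f) \<cdot>\<^bsub>D\<^esub> lcomp t (Cod C f)) \<cdot>\<^bsub>D\<^esub> amap (lsrc t) f"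
      using f by (subst t.naturality) simp_all
    finally show "restr D (amap (ltrg (lvcomp u t)) f) (Cod D (lcomp (lvcomp u t) (Dom C f)))
        \<cdot>\<^bsub>D\<^esub> lcomp (lvcomp u t) (Dom C f) = lcomp (lvcomp u t) (Cod C f) \<cdot>\<^bsub>D\<^esub> amap (lsrc (lvcomp u t)) f"
      using f by simp
  next
    fix X Y assume XY: "obj_le C X Y"
    then have [simp]: "X \<in> Obj C" "Y \<in> Obj C" using t.S.C.obj_leD by auto
    have "(g X, g Y) \<in> Le D"
      unfolding g_def using u.Le_lcomp[OF XY] t.Le_lcomp[OF XY]
      by (intro t.S.D.restr_Le) (simp_all add: t.S.D.Le_Cod)
    then show "(lcomp (lvcomp u t) X, lcomp (lvcomp u t) Y) \<in> Le D"
      using t.Le_lcomp[OF XY] by (simp add: t.S.D.Le_Comp')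
  next
    show "lmid (lvcomp u t) = \<lparr>fdom = C, fcod = D, omap = (\<lambda>X \<in> Obj C. Cod D (lcomp (lvcomp u t) X)),
      amap = (\<lambda>f \<in> Arr C. restr D (amap (ltrg (lvcomp u t)) f) (Cod D (lcomp (lvcomp u t) (Dom C f))))\<rparr>"
      by (rule func.equality) (auto simp: lvcomp_def Let_def t.lmid u.lmid simp flip: g_def intro!: restrict_ext)
  qed (auto simp: t.S.ordered_functor_axioms u.T.ordered_functor_axioms, simp add: lvcomp_def Let_def)
qed

lemma lambda_trans_lwhisk_right:
  assumes F: "ordered_functor C D F" and t: "lambda_trans D E t"
  shows "lambda_trans C E (lwhisk_right t F)"
proof -
  interpret F: ordered_functor C D F by fact
  interpret t: lambda_trans D E t by fact
  show ?thesis
  proof (rule lambda_transI)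
    show "ordered_functor C E (lsrc (lwhisk_right t F))" "ordered_functor C E (ltrg (lwhisk_right t F))"
      using ordered_functor_comp F t.S.ordered_functor_axioms t.T.ordered_functor_axioms
      by (auto simp: lwhisk_right_def)
  next
    show "lmid (lwhisk_right t F) = \<lparr>fdom = C, fcod = E, omap = (\<lambda>X \<in> Obj C. Cod E (lcomp (lwhisk_right t F) X)),
      amap = (\<lambda>f \<in> Arr C. restr E (amap (ltrg (lwhisk_right t F)) f) (Cod E (lcomp (lwhisk_right t F) (Dom C f))))\<rparr>"
      by (rule func.equality)
        (auto simp: lwhisk_right_def comp_func_def t.lmid compose_def intro!: restrict_ext)
  next
    fix f assume f: "f \<in> Arr C"
    then show "restr E (amap (ltrg (lwhisk_right t F)) f) (Cod E (lcomp (lwhisk_right t F) (Dom C f)))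
      \<cdot>\<^bsub>E\<^esub> lcomp (lwhisk_right t F) (Dom C f) = lcomp (lwhisk_right t F) (Cod C f) \<cdot>\<^bsub>E\<^esub> amap (lsrc (lwhisk_right t F)) f"
      using t.naturality[of "amap F f"] by (simp add: lwhisk_right_def compose_def)
  next
    fix X Y assume XY: "obj_le C X Y"
    then show "(lcomp (lwhisk_right t F) X, lcomp (lwhisk_right t F) Y) \<in> Le E"
      using F.C.obj_leD[OF XY] t.Le_lcomp[of "omap F X" "omap F Y"] by (simp add: lwhisk_right_def compose_def)
  qed (auto simp: lwhisk_right_def compose_def)
qed

lemma lambda_trans_lwhisk_left:
  assumes t: "lambda_trans C D t" and H: "ordered_functor D E H"
  shows "lambda_trans C E (lwhisk_left H t)"
proof -
  interpret H: ordered_functor D E H by fact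
  interpret t: lambda_trans C D t by fact
  show ?thesis
  proof (rule lambda_transI)
    show "ordered_functor C E (lsrc (lwhisk_left H t))" "ordered_functor C E (ltrg (lwhisk_left H t))"
      using ordered_functor_comp H t.S.ordered_functor_axioms t.T.ordered_functor_axioms
      by (auto simp: lwhisk_left_def)
  next
    show "lmid (lwhisk_left H t) = \<lparr>fdom = C, fcod = E, omap = (\<lambda>X \<in> Obj C. Cod E (lcomp (lwhisk_left H t) X)),
      amap = (\<lambda>f \<in> Arr C. restr E (amap (ltrg (lwhisk_left H t)) f) (Cod E (lcomp (lwhisk_left H t) (Dom C f))))\<rparr>"
      by (rule func.equality)
        (auto simp: lwhisk_left_def comp_func_def t.lmid compose_def intro!: restrict_ext)
  next
    fix f assume f: "f \<in> Arr C"
    have "amap H (restr D (amap (ltrg t) f) (Cod D (lcomp t (Dom C f))) \<cdot>\<^bsub>D\<^esub> lcomp t (Dom C f)) =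
      amap H (lcomp t (Cod C f) \<cdot>\<^bsub>D\<^esub> amap (lsrc t) f)"
      using t.naturality[OF f] by simp
    with f show "restr E (amap (ltrg (lwhisk_left H t)) f) (Cod E (lcomp (lwhisk_left H t) (Dom C f)))
      \<cdot>\<^bsub>E\<^esub> lcomp (lwhisk_left H t) (Dom C f) = lcomp (lwhisk_left H t) (Cod C f) \<cdot>\<^bsub>E\<^esub> amap (lsrc (lwhisk_left H t)) f"
      by (simp add: lwhisk_left_def compose_def)
  next
    fix X Y assume XY: "obj_le C X Y"
    then show "(lcomp (lwhisk_left H t) X, lcomp (lwhisk_left H t) Y) \<in> Le E"
      using t.S.C.obj_leD[OF XY] t.Le_lcomp[OF XY] by (simp add: lwhisk_left_def compose_def H.Le_amap)
  qed (auto simp: lwhisk_left_def compose_def)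
qed

lemma lhcomp_simps [simp]:
  "lsrc (lhcomp u t) = comp_func (lsrc u) (lsrc t)"
  "ltrg (lhcomp u t) = comp_func (ltrg u) (ltrg t)"
  by (simp_all add: lhcomp_def lwhisk_left_def lwhisk_right_def)

lemma lambda_trans_lhcomp:
  assumes t: "lambda_trans C D t" and u: "lambda_trans D E u"
  shows "lambda_trans C E (lhcomp u t)"
  unfolding lhcomp_def
  by (rule lambda_trans_lvcomp[OF lambda_trans_lwhisk_left[OF t lambda_transD(1)[OF u]]
        lambda_trans_lwhisk_right[OF lambda_transD(2)[OF t] u]])
    (simp add: lwhisk_left_def lwhisk_right_def)

text \<open>The definition restricts the component of \<open>u\<close> at
  \<open>omap (ltrg t) X\<close>. Components of \<open>u\<close> are monotone in the object, so this
  restriction is the component at the smaller object \<open>Cod D (lcomp t X)\<close>.\<close>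

lemma lcomp_lhcomp:
  assumes t: "lambda_trans C D t" and u: "lambda_trans D E u" and X: "X \<in> Obj C"
  shows "lcomp (lhcomp u t) X = lcomp u (Cod D (lcomp t X)) \<cdot>\<^bsub>E\<^esub> amap (lsrc u) (lcomp t X)"
proof -
  interpret t: lambda_trans C D t by fact
  interpret u: lambda_trans D E u by fact
  have "lcomp (lhcomp u t) X = restr E (lcomp u (omap (ltrg t) X)) (omap (lsrc u) (Cod D (lcomp t X)))
      \<cdot>\<^bsub>E\<^esub> amap (lsrc u) (lcomp t X)"
    using X lcomp_lvcomp[OF lambda_trans_lwhisk_left[OF t lambda_transD(1)[OF u]] X]
    by (simp add: lhcomp_def lwhisk_left_def lwhisk_right_def compose_def)
  moreover have "restr E (lcomp u (omap (ltrg t) X)) (omap (lsrc u) (Cod D (lcomp t X))) =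
      lcomp u (Cod D (lcomp t X))"
    using X u.S.D.restr_eqI[OF u.Le_lcomp[OF t.lcomp_simps(3)[OF X]]] by simp
  ultimately show ?thesis by simp
qed

section \<open>The 2-functor L\<close>

lemma pair_eq [simp]: "pair (a, b) = pair (c, d) \<longleftrightarrow> a = c \<and> b = d"
  using inj_pair by (auto dest: injD)

lemma L0_simps [simp]:
  "Obj (L0 G) = Obj G"
  "pair (h, B) \<in> Arr (L0 G) \<longleftrightarrow> h \<in> Arr G \<and> obj_le G (Cod G h) B"
  "\<lbrakk>h \<in> Arr G; obj_le G (Cod G h) B\<rbrakk> \<Longrightarrow> Dom (L0 G) (pair (h, B)) = Dom G h"
  "\<lbrakk>h \<in> Arr G; obj_le G (Cod G h) B\<rbrakk> \<Longrightarrow> Cod (L0 G) (pair (h, B)) = B"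
  "A \<in> Obj G \<Longrightarrow> Ident (L0 G) A = pair (Ident G A, A)"
  "\<lbrakk>h \<in> Arr G; obj_le G (Cod G h) B; k \<in> Arr G; obj_le G (Cod G k) E; Dom G k = B\<rbrakk>
    \<Longrightarrow> pair (k, E) \<cdot>\<^bsub>L0 G\<^esub> pair (h, B) = pair (restr G k (Cod G h) \<cdot>\<^bsub>G\<^esub> h, E)"
  by (auto simp: L0_def L_arr_def)

lemma L_arrE:
  assumes "x \<in> Arr (L0 G)"
  obtains h B where "x = pair (h, B)" "h \<in> Arr G" "obj_le G (Cod G h) B" "B \<in> Obj G"
  using assms by (auto simp: L0_def L_arr_def obj_le_def)

lemma category_L0:
  assumes "ordered_groupoid G" shows "category (L0 G)"
proof -
  interpret ordered_groupoid G by fact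
  show ?thesis
  proof (rule categoryI)
    show "Dom (L0 G) \<in> Arr (L0 G) \<rightarrow>\<^sub>E Obj (L0 G)"
      by (auto simp: L0_def L_arr_def)
    show "Cod (L0 G) \<in> Arr (L0 G) \<rightarrow>\<^sub>E Obj (L0 G)"
      by (auto simp: L0_def L_arr_def dest: obj_leD)
    show "Ident (L0 G) \<in> extensional (Obj (L0 G))"
      by (simp add: L0_def)
    show "Comp (L0 G) \<in> extensional (composable (L0 G))"
      by (auto simp: L0_def composable_def extensional_def)
    fix A assume "A \<in> Obj (L0 G)"
    then show "Ident (L0 G) A \<in> Arr (L0 G) \<and> Dom (L0 G) (Ident (L0 G) A) = A \<and> Cod (L0 G) (Ident (L0 G) A) = A"
      by simp
  next
    fix x assume "x \<in> Arr (L0 G)"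
    then obtain h B where x: "x = pair (h, B)" "h \<in> Arr G" "obj_le G (Cod G h) B" by (rule L_arrE)
    then show "x \<cdot>\<^bsub>L0 G\<^esub> Ident (L0 G) (Dom (L0 G) x) = x \<and> Ident (L0 G) (Cod (L0 G) x) \<cdot>\<^bsub>L0 G\<^esub> x = x"
      using obj_leD by simp
    fix y assume "y \<in> Arr (L0 G)" and e: "Dom (L0 G) y = Cod (L0 G) x"
    then obtain k E where y: "y = pair (k, E)" "k \<in> Arr G" "obj_le G (Cod G k) E" by (auto elim: L_arrE)
    have yx: "Dom G k = B" using x y e by simp
    moreover have "obj_le G (Cod G (restr G k (Cod G h))) E"
      using obj_le_trans[OF Cod_restr y(3)] x y yx by simp
    ultimately show "y \<cdot>\<^bsub>L0 G\<^esub> x \<in> Arr (L0 G) \<and> Dom (L0 G) (y \<cdot>\<^bsub>L0 G\<^esub> x) = Dom (L0 G) x \<and>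
        Cod (L0 G) (y \<cdot>\<^bsub>L0 G\<^esub> x) = Cod (L0 G) y"
      using x y by simp
    fix z assume "z \<in> Arr (L0 G)" and e': "Dom (L0 G) z = Cod (L0 G) y"
    then obtain l F where z: "z = pair (l, F)" "l \<in> Arr G" "obj_le G (Cod G l) F" by (auto elim: L_arrE)
    have zy: "Dom G l = E" using z y e' by simp
    have "obj_le G (Cod G (restr G l (Cod G k))) F"
      using obj_le_trans[OF Cod_restr z(3)] y z zy by simp
    \<comment> \<open>Associativity comes down to collapsing the two-stage restriction of
      \<open>l\<close>, to \<open>Cod G k\<close> and then to the codomain of the restricted
      \<open>k\<close>; this inequality allows \<open>restr_restr\<close> to do so.\<close>
    moreover have "obj_le G (Cod G (restr G k (Cod G h))) (Cod G k)"
      using Cod_restr x y yx by simp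
    ultimately show "(z \<cdot>\<^bsub>L0 G\<^esub> y) \<cdot>\<^bsub>L0 G\<^esub> x = z \<cdot>\<^bsub>L0 G\<^esub> (y \<cdot>\<^bsub>L0 G\<^esub> x)"
      using x y z yx zy \<open>obj_le G (Cod G (restr G k (Cod G h))) E\<close> by (simp add: restr_Comp)
  qed
qed

text \<open>Suppose \<open>p \<cdot> h = q \<cdot> l\<close> with \<open>p\<close> and
  \<open>q\<close> restrictions of the same \<open>k\<close>. They have the same codomain, so
  \<open>p = q\<close> by \<open>Le_eq_Cod\<close>, and cancelling in the groupoid gives
  \<open>h = l\<close>. The vertical parts agree because both arrows end where \<open>k\<close>
  starts.\<close>

lemma left_cancellative_L0:
  assumes "ordered_groupoid G" shows "left_cancellative (L0 G)"
proof -
  interpret ordered_groupoid G by fact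
  show ?thesis
    unfolding left_cancellative_def mono_arrow_def
  proof (intro ballI conjI allI impI)
    fix x y z assume "x \<in> Arr (L0 G)"
      and *: "(x, y) \<in> composable (L0 G) \<and> (x, z) \<in> composable (L0 G) \<and> Dom (L0 G) y = Dom (L0 G) z \<and>
        x \<cdot>\<^bsub>L0 G\<^esub> y = x \<cdot>\<^bsub>L0 G\<^esub> z"
    then have "y \<in> Arr (L0 G)" "z \<in> Arr (L0 G)" by (auto simp: composable_def)
    with \<open>x \<in> Arr (L0 G)\<close> obtain k E h B l F where x: "x = pair (k, E)" "k \<in> Arr G" "obj_le G (Cod G k) E"
      and y: "y = pair (h, B)" "h \<in> Arr G" "obj_le G (Cod G h) B"
      and z: "z = pair (l, F)" "l \<in> Arr G" "obj_le G (Cod G l) F"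
      by (metis L_arrE)
    have B: "B = Dom G k" "F = Dom G k" using * x y z by (auto simp: composable_def)
    define p q where "p = restr G k (Cod G h)" and "q = restr G k (Cod G l)"
    have p: "p \<in> Arr G" "Dom G p = Cod G h" "(p, k) \<in> Le G" using x y B by (simp_all add: p_def)
    have q: "q \<in> Arr G" "Dom G q = Cod G l" "(q, k) \<in> Le G" using x z B by (simp_all add: q_def)
    have e: "p \<cdot>\<^bsub>G\<^esub> h = q \<cdot>\<^bsub>G\<^esub> l" using * x y z B by (simp add: p_def q_def)
    then have "Cod G p = Cod G q" using p q y z Comp_simps(3) by metis
    then have "p = q" using p q Le_eq_Cod by blast
    then have "inv_arrow G p \<cdot>\<^bsub>G\<^esub> (p \<cdot>\<^bsub>G\<^esub> h) = inv_arrow G p \<cdot>\<^bsub>G\<^esub> (p \<cdot>\<^bsub>G\<^esub> l)" using e by simp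
    then have "h = l" using p q y(2) z(2) \<open>p = q\<close> by simp
    then show "y = z" using y z B by simp
  qed
qed

lemma L1_simps [simp]:
  "fdom (L1 F) = L0 (fdom F)" "fcod (L1 F) = L0 (fcod F)" "omap (L1 F) = omap F"
  "\<lbrakk>h \<in> Arr (fdom F); obj_le (fdom F) (Cod (fdom F) h) B\<rbrakk>
    \<Longrightarrow> amap (L1 F) (pair (h, B)) = pair (amap F h, omap F B)"
  by (auto simp: L1_def L_arr_def)

lemma functor_between_L1:
  assumes "ordered_functor C D F" shows "functor_between (L0 C) (L0 D) (L1 F)"
proof -
  interpret ordered_functor C D F by fact
  show ?thesis
  proof (rule functor_betweenI)
    show "omap (L1 F) \<in> extensional (Obj (L0 C))" "amap (L1 F) \<in> extensional (Arr (L0 C))"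
      using extensional by (simp_all add: L1_def L0_def)
    fix x assume "x \<in> Arr (L0 C)"
    then obtain h B where x: "x = pair (h, B)" "h \<in> Arr C" "obj_le C (Cod C h) B" by (rule L_arrE)
    then show "amap (L1 F) x \<in> Arr (L0 D) \<and> Dom (L0 D) (amap (L1 F) x) = omap (L1 F) (Dom (L0 C) x) \<and>
        Cod (L0 D) (amap (L1 F) x) = omap (L1 F) (Cod (L0 C) x)"
      using obj_le_omap[OF x(3)] by simp
    fix y assume "y \<in> Arr (L0 C)" and e: "Dom (L0 C) y = Cod (L0 C) x"
    then obtain k E where y: "y = pair (k, E)" "k \<in> Arr C" "obj_le C (Cod C k) E" by (auto elim: L_arrE)
    have "Dom C k = B" using x y e by simp
    moreover have "obj_le C (Cod C (restr C k (Cod C h))) E"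
      using C.obj_le_trans[OF C.Cod_restr y(3)] x y \<open>Dom C k = B\<close> by simp
    ultimately show "amap (L1 F) (y \<cdot>\<^bsub>L0 C\<^esub> x) = amap (L1 F) y \<cdot>\<^bsub>L0 D\<^esub> amap (L1 F) x"
      using x y obj_le_omap[OF x(3)] obj_le_omap[OF y(3)] by simp
  qed (auto simp: category_L0 C.ordered_groupoid_axioms D.ordered_groupoid_axioms)
qed

lemma L1_comp_func:
  assumes F: "ordered_functor C D F" and H: "ordered_functor D E H"
  shows "L1 (comp_func H F) = comp_func (L1 H) (L1 F)"
proof -
  interpret F: ordered_functor C D F by fact
  interpret H: ordered_functor D E H by fact
  show ?thesis
    by (rule func_eqI[OF functor_between_L1[OF ordered_functor_comp[OF F H]]
          functor_between_comp[OF functor_between_L1[OF F] functor_between_L1[OF H]]])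
      (auto elim!: L_arrE dest: F.obj_le_omap F.C.obj_leD)
qed

lemma L2_simps [simp]:
  "nsrc (L2 t) = L1 (lsrc t)" "ntrg (L2 t) = L1 (ltrg t)"
  "X \<in> Obj (fdom (lsrc t)) \<Longrightarrow> ncomp (L2 t) X = pair (lcomp t X, omap (ltrg t) X)"
  by (simp_all add: L2_def)

text \<open>Monotonicity of the components handles the vertical part of \<open>(h, B)\<close>: the
  component at \<open>B\<close>, restricted to the image of \<open>Cod C h\<close>, is the component
  at \<open>Cod C h\<close>. What remains is the naturality square of \<open>t\<close> at
  \<open>h\<close>.\<close>

lemma nat_trans_L2:
  assumes "lambda_trans C D t" shows "nat_trans (L0 C) (L0 D) (L2 t)"
proof -
  interpret lambda_trans C D t by fact
  show ?thesis
  proof (rule nat_transI)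
    fix x assume "x \<in> Arr (L0 C)"
    then obtain h B where x: "x = pair (h, B)" "h \<in> Arr C" "obj_le C (Cod C h) B" by (rule L_arrE)
    have "restr D (lcomp t B) (omap (lsrc t) (Cod C h)) = lcomp t (Cod C h)"
      using S.D.restr_eqI[OF Le_lcomp[OF x(3)]] x by simp
    moreover have "B \<in> Obj C" using x S.C.obj_leD by blast
    moreover note S.obj_le_omap[OF x(3)] T.obj_le_omap[OF x(3)]
    ultimately show "amap (ntrg (L2 t)) x \<cdot>\<^bsub>L0 D\<^esub> ncomp (L2 t) (Dom (L0 C) x) =
        ncomp (L2 t) (Cod (L0 C) x) \<cdot>\<^bsub>L0 D\<^esub> amap (nsrc (L2 t)) x"
      using x naturality[OF x(2)] by simp
  qed (auto simp: functor_between_L1 S.ordered_functor_axioms T.ordered_functor_axioms, simp add: L2_def)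
qed

lemma oGpd_simps [simp]:
  "Obj0 oGpd = {G. ordered_groupoid G}" "Mor1 oGpd = {F. double_functor F}"
  "Cell2 oGpd = {t. lambda_transformation t}"
  "src1 oGpd = fdom" "trg1 oGpd = fcod" "src2 oGpd = lsrc" "trg2 oGpd = ltrg"
  "id1 oGpd = id_func" "comp1 oGpd = comp_func" "id2 oGpd = lid" "vcomp oGpd = lvcomp" "hcomp oGpd = lhcomp"
  by (simp_all add: oGpd_def)

lemma ordered_functor_self: "double_functor F \<Longrightarrow> ordered_functor (fdom F) (fcod F) F"
  by (auto simp: double_functor_iff ordered_functorD)

lemma lambda_trans_self: "lambda_transformation t \<Longrightarrow> lambda_trans (fdom (lsrc t)) (fcod (lsrc t)) t"
  by (auto simp: lambda_transformation_iff lambda_transD)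

lemma ordered_functor_double: "ordered_functor C D F \<Longrightarrow> double_functor F"
  by (auto simp: double_functor_iff)

text \<open>Stated for the axioms alone: that \<open>oGpd\<close> is a 2-category is derived from
  this by \<open>two_category_reflect\<close>.\<close>

lemma L_two_functor_axioms: "two_functor_axioms oGpd Cat Lfun"
proof -
  note [simp] = Lfun_def hom1_def hom2_def
  show ?thesis
  proof
    fix G :: "'a ogpd" assume "G \<in> Obj0 oGpd"
    then have G: "ordered_groupoid G" by simp
    then interpret ordered_groupoid G .
    show "map0 Lfun G \<in> Obj0 Cat" using G by (simp add: category_L0)
    have "L1 (id_func G) = id_func (L0 G)"
      by (rule func_eqI[OF functor_between_L1[OF ordered_functor_id[OF G]] functor_between_id[OF category_L0[OF G]]])
        (auto elim!: L_arrE dest: obj_leD)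
    then show "map1 Lfun (id1 oGpd G) = id1 Cat (map0 Lfun G)" by simp
  next
    fix F :: "'a ofunc" assume "F \<in> Mor1 oGpd"
    then obtain C D where F: "ordered_functor C D F" by (auto simp: double_functor_iff)
    interpret F: ordered_functor C D F by fact
    interpret L: functor_between "L0 C" "L0 D" "L1 F" by (rule functor_between_L1[OF F])
    show "map1 Lfun F \<in> hom1 Cat (map0 Lfun (src1 oGpd F)) (map0 Lfun (trg1 oGpd F))"
      using L.is_functor by simp
    have "L2 (lid F) = nid (L1 F)"
      by (rule ntrans_eqI[OF nat_trans_L2[OF lambda_trans_lid[OF F]] nat_trans_nid[OF functor_between_L1[OF F]]]) auto
    then show "map2 Lfun (id2 oGpd F) = id2 Cat (map1 Lfun F)" by simp
    fix H assume "H \<in> Mor1 oGpd" "trg1 oGpd F = src1 oGpd H"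
    then obtain E where H: "ordered_functor D E H" by (auto dest: ordered_functor_self)
    show "map1 Lfun (comp1 oGpd H F) = comp1 Cat (map1 Lfun H) (map1 Lfun F)" by (simp add: L1_comp_func[OF F H])
  next
    fix t :: "'a ltrans" assume "t \<in> Cell2 oGpd"
    then obtain C D where t: "lambda_trans C D t" by (auto simp: lambda_transformation_iff)
    show "map2 Lfun t \<in> hom2 Cat (map1 Lfun (src2 oGpd t)) (map1 Lfun (trg2 oGpd t))"
      using nat_trans_L2[OF t] by (auto simp: natural_transformation_iff)
  next
    fix t u :: "'a ltrans" assume "t \<in> Cell2 oGpd" "u \<in> Cell2 oGpd" and e: "trg2 oGpd t = src2 oGpd u"
    then obtain C D where t: "lambda_trans C D t" by (auto simp: lambda_transformation_iff)
    then have u: "lambda_trans C D u"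
      using \<open>u \<in> Cell2 oGpd\<close> e lambda_trans_self[of u] lambda_transD(5,6)[OF t] by simp
    interpret t: lambda_trans C D t by fact
    interpret u: lambda_trans C D u by fact
    have [simp]: "lsrc u = ltrg t" using e by simp
    have "L2 (lvcomp u t) = nvcomp (L2 u) (L2 t)"
      by (rule ntrans_eqI[OF nat_trans_L2[OF lambda_trans_lvcomp[OF t u]] nat_trans_nvcomp[OF nat_trans_L2[OF t] nat_trans_L2[OF u]]])
        (auto simp: lcomp_lvcomp[OF t])
    then show "map2 Lfun (vcomp oGpd u t) = vcomp Cat (map2 Lfun u) (map2 Lfun t)" by simp
  next
    fix t u :: "'a ltrans" assume "t \<in> Cell2 oGpd" "u \<in> Cell2 oGpd" and e: "trg0 oGpd t = src0 oGpd u"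
    then obtain C D E where t: "lambda_trans C D t" and u: "lambda_trans D E u"
      by (auto simp: lambda_transformation_iff lambda_transD)
    interpret t: lambda_trans C D t by fact
    interpret u: lambda_trans D E u by fact
    \<comment> \<open>The collapse of \<open>lcomp_lhcomp\<close>, here for the restriction that
      composition in \<open>L0 E\<close> introduces into \<open>nhcomp\<close>.\<close>
    have "restr E (lcomp u (omap (ltrg t) X)) (omap (lsrc u) (Cod D (lcomp t X))) =
        lcomp u (Cod D (lcomp t X))" if "X \<in> Obj C" for X
      using that u.S.D.restr_eqI[OF u.Le_lcomp[OF t.lcomp_simps(3)[OF that]]] by simp
    then have "L2 (lhcomp u t) = nhcomp (L2 u) (L2 t)"
      by (intro ntrans_eqI[OF nat_trans_L2[OF lambda_trans_lhcomp[OF t u]]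
            nat_trans_nhcomp[OF nat_trans_L2[OF t] nat_trans_L2[OF u]]])
        (simp_all add: lcomp_lhcomp[OF t u] L1_comp_func[OF lambda_transD(1)[OF t] lambda_transD(1)[OF u]]
          L1_comp_func[OF lambda_transD(2)[OF t] lambda_transD(2)[OF u]])
    then show "map2 Lfun (hcomp oGpd u t) = hcomp Cat (map2 Lfun u) (map2 Lfun t)" by simp
  qed
qed

lemma two_functor_L: "two_functor oGpd Cat Lfun"
proof (rule two_category_reflect[OF two_category_Cat _ _ _ _ _ _ _ _ _ _ _ _ L_two_functor_axioms])
  fix F :: "'a ofunc"
  assume "F \<in> Mor1 oGpd"
  then obtain C D where F: "ordered_functor C D F" by (auto simp: double_functor_iff)
  interpret F: ordered_functor C D F by fact
  show "src1 oGpd F \<in> Obj0 oGpd" "trg1 oGpd F \<in> Obj0 oGpd"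
    by (simp_all add: F.C.ordered_groupoid_axioms F.D.ordered_groupoid_axioms)
  show "comp1 oGpd F (id1 oGpd (src1 oGpd F)) = F" "comp1 oGpd (id1 oGpd (trg1 oGpd F)) F = F"
    using comp_func_id[OF F.functor_between_axioms] by simp_all
  show "id2 oGpd F \<in> hom2 oGpd F F"
    using lambda_trans_lid[OF F] by (auto simp: hom2_def lambda_transformation_iff)
  fix H assume "H \<in> Mor1 oGpd" "trg1 oGpd F = src1 oGpd H"
  then obtain E where H: "ordered_functor D E H" by (auto dest: ordered_functor_self)
  interpret H: ordered_functor D E H by fact
  show "comp1 oGpd H F \<in> hom1 oGpd (src1 oGpd F) (trg1 oGpd H)"
    using ordered_functor_comp[OF F H] by (simp add: hom1_def ordered_functor_double)
  fix I assume "I \<in> Mor1 oGpd" "trg1 oGpd H = src1 oGpd I"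
  then obtain E' where I: "ordered_functor E E' I" by (auto dest: ordered_functor_self)
  show "comp1 oGpd (comp1 oGpd I H) F = comp1 oGpd I (comp1 oGpd H F)"
    using comp_func_assoc[OF ordered_functorD(1)[OF F] ordered_functorD(1)[OF H] ordered_functorD(1)[OF I]] by simp
next
  fix G :: "'a ogpd"
  assume "G \<in> Obj0 oGpd"
  then show "id1 oGpd G \<in> hom1 oGpd G G"
    using ordered_functor_id[of G] by (auto simp: hom1_def ordered_functor_double)
next
  fix t :: "'a ltrans"
  assume "t \<in> Cell2 oGpd"
  then obtain C D where t: "lambda_trans C D t" by (auto simp: lambda_transformation_iff)
  interpret t: lambda_trans C D t by fact
  show "src2 oGpd t \<in> Mor1 oGpd" "trg2 oGpd t \<in> hom1 oGpd (src0 oGpd t) (trg0 oGpd t)"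
    using t.S.ordered_functor_axioms t.T.ordered_functor_axioms
    by (simp_all add: hom1_def ordered_functor_double)
next
  fix t u :: "'a ltrans" assume "t \<in> Cell2 oGpd" "u \<in> Cell2 oGpd" and e: "trg2 oGpd t = src2 oGpd u"
  then obtain C D where t: "lambda_trans C D t" by (auto simp: lambda_transformation_iff)
  then have u: "lambda_trans C D u"
    using \<open>u \<in> Cell2 oGpd\<close> e lambda_trans_self[of u] lambda_transD(5,6)[OF t] by simp
  show "vcomp oGpd u t \<in> hom2 oGpd (src2 oGpd t) (trg2 oGpd u)"
    using lambda_trans_lvcomp[OF t u] e by (auto simp: hom2_def lambda_transformation_iff)
next
  fix t u :: "'a ltrans" assume "t \<in> Cell2 oGpd" "u \<in> Cell2 oGpd" and e: "trg0 oGpd t = src0 oGpd u"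
  then obtain C D E where t: "lambda_trans C D t" and u: "lambda_trans D E u"
    by (auto simp: lambda_transformation_iff lambda_transD)
  show "hcomp oGpd u t \<in> hom2 oGpd (comp1 oGpd (src2 oGpd u) (src2 oGpd t)) (comp1 oGpd (trg2 oGpd u) (trg2 oGpd t))"
    using lambda_trans_lhcomp[OF t u] by (auto simp: hom2_def lambda_transformation_iff)
next
  fix t u :: "'a ltrans"
  assume "t \<in> Cell2 oGpd" "u \<in> Cell2 oGpd"
    and e: "src2 oGpd t = src2 oGpd u" "trg2 oGpd t = trg2 oGpd u" "map2 Lfun t = map2 Lfun u"
  then obtain C D where t: "lambda_trans C D t" by (auto simp: lambda_transformation_iff)
  then have u: "lambda_trans C D u"
    using \<open>u \<in> Cell2 oGpd\<close> e lambda_trans_self[of u] lambda_transD[OF t] by simp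
  \<comment> \<open>The component of \<open>L2 t\<close> at \<open>X\<close> is a coded pair, and
    \<open>pair\<close> is injective, so its horizontal part can be read off.\<close>
  have "lcomp t X = lcomp u X" if "X \<in> Obj C" for X
    using arg_cong[OF e(3), of "\<lambda>v. ncomp v X"] that lambda_transD[OF t] lambda_transD[OF u] by (simp add: Lfun_def)
  then show "t = u" using e ltrans_eqI[OF t u] by simp
qed

section \<open>The 2-functor G\<close>

locale lc_category = category C for C :: "'u::infinite cat" (structure) +
  assumes lc: "left_cancellative C"
begin

lemma span_Comp_iso:
  assumes "iso C h" "m \<in> Arr C" "n \<in> Arr C" "Dom C m = Cod C h" "Dom C n = Cod C h"
  shows "span C (m \<cdot> h) (n \<cdot> h) = span C m n"
  using assms iso_Arr[OF assms(1)]
  by (subst span_eq_iff[OF category_axioms]) (auto simp: composable_def)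

lemma sub_Comp_iso:
  assumes "iso C h" "m \<in> Arr C" "Dom C m = Cod C h"
  shows "sub C (m \<cdot> h) = sub C m"
  using assms iso_Arr[OF assms(1)]
  by (subst sub_eq_iff[OF category_axioms]) (auto simp: composable_def)

lemma sub_eqE:
  assumes "sub C m = sub C n" "m \<in> Arr C" "n \<in> Arr C"
  obtains h where "iso C h" "h \<in> Arr C" "Cod C h = Dom C n" "Dom C h = Dom C m" "m = n \<cdot> h"
  using assms sub_eq_iff[OF category_axioms assms(2,3)] iso_Arr by (auto simp: composable_def)

lemma span_eqE:
  assumes "span C m n = span C m' n'" "m \<in> Arr C" "n \<in> Arr C" "Dom C m = Dom C n"
    "m' \<in> Arr C" "n' \<in> Arr C" "Dom C m' = Dom C n'"
  obtains h where "iso C h" "h \<in> Arr C" "Cod C h = Dom C m'" "Dom C h = Dom C m" "m = m' \<cdot> h" "n = n' \<cdot> h"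
  using assms span_eq_iff[OF category_axioms assms(2-7)] iso_Arr by (auto simp: composable_def)

text \<open>The isomorphism \<open>h\<close> relating the two spans satisfies
  \<open>m = m \<cdot> h\<close>; cancelling \<open>m\<close> forces \<open>h\<close> to be an
  identity.\<close>

lemma span_eq_right_iff:
  assumes "m \<in> Arr C" "n \<in> Arr C" "Dom C m = Dom C n" "n' \<in> Arr C" "Dom C m = Dom C n'"
  shows "span C m n = span C m n' \<longleftrightarrow> n = n'"
proof
  assume "span C m n = span C m n'"
  then obtain h where h: "h \<in> Arr C" "Cod C h = Dom C m" "Dom C h = Dom C m" "m = m \<cdot> h" "n = n' \<cdot> h"
    using assms span_eqE[of m n m n'] by metis
  have e: "m \<cdot> h = m \<cdot> Ident C (Dom C m)" using h(4)[symmetric] assms(1) by simp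
  have hh: "h = Ident C (Dom C m)"
    by (rule cancel[OF lc assms(1) h(1) _ _ _ _ e]) (use h(2,3) assms(1) in simp_all)
  have "n' \<cdot> h = n'" unfolding hh using assms(4,5) by simp
  then show "n = n'" using h(5) by (rule trans[rotated])
qed simp

text \<open>Operations on classes act on the stored representative. Having it in the form
  \<open>m \<cdot> k\<close> reduces their value at the class of an arbitrary \<open>m\<close> to
  invariance under isomorphisms; \<open>span_rep\<close> serves spans in the same way.\<close>

lemma sub_rep:
  assumes "m \<in> Arr C"
  obtains k where "iso C k" "k \<in> Arr C" "Cod C k = Dom C m" "sub C m = m \<cdot> k"
proof -
  have "m \<in> sub_class C m"
    using assms iso_Ident[of "Dom C m"] by (auto simp: sub_class_def composable_def intro!: exI[of _ "Ident C (Dom C m)"])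
  then have "sub C m \<in> sub_class C m" unfolding sub_def by (rule someI)
  then obtain j where s: "sub C m \<in> Arr C" and "iso C j" "(sub C m, j) \<in> composable C" "m = sub C m \<cdot> j"
    by (auto simp: sub_class_def)
  \<comment> \<open>Membership gives \<open>m\<close> as the representative precomposed with
    \<open>j\<close>. Passing through equality of classes, which is symmetric, gives the
    representative in terms of \<open>m\<close>.\<close>
  then have "sub C (sub C m) = sub C m" using sub_Comp_iso[of j "sub C m"] by (simp add: composable_def)
  with s assms obtain k where "iso C k" "k \<in> Arr C" "Cod C k = Dom C m" "sub C m = m \<cdot> k"
    by (elim sub_eqE)
  then show thesis by (rule that)
qed

lemma span_rep:
  assumes "m \<in> Arr C" "n \<in> Arr C" "Dom C m = Dom C n"
  obtains k where "iso C k" "k \<in> Arr C" "Cod C k = Dom C m" "span C m n = pair (m \<cdot> k, n \<cdot> k)"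
proof -
  have "(m, n) \<in> span_class C m n"
    using span_class_eq_iff(2)[OF category_axioms assms assms] .
  then have *: "(SOME p. p \<in> span_class C m n) \<in> span_class C m n" by (rule someI)
  obtain m' n' where e: "(SOME p. p \<in> span_class C m n) = (m', n')" by fastforce
  have s: "span C m n = pair (m', n')" using e by (simp add: span_def)
  have "m' \<in> Arr C" "n' \<in> Arr C" "Dom C m' = Dom C n'" using * e by (auto simp: span_class_def)
  moreover from this have "span C m' n' = span C m n"
    using * e span_eq_iff[OF category_axioms assms, of m' n'] by (auto simp: span_class_def)
  ultimately obtain k where "iso C k" "k \<in> Arr C" "Cod C k = Dom C m" "m' = m \<cdot> k" "n' = n \<cdot> k"
    using assms by (elim span_eqE)
  then show thesis using s that by simp
qed

lemma
  assumes m: "m \<in> Arr C"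
  shows sub_Arr [simp]: "sub C m \<in> Arr C" and sub_sub [simp]: "sub C (sub C m) = sub C m"
    and span_sub_sub: "span C (sub C m) (sub C m) = span C m m"
proof -
  obtain k where k: "iso C k" "k \<in> Arr C" "Cod C k = Dom C m" "sub C m = m \<cdot> k" using m by (rule sub_rep)
  show "sub C m \<in> Arr C" "span C (sub C m) (sub C m) = span C m m"
    using k m by (simp_all add: span_Comp_iso)
  show "sub C (sub C m) = sub C m" using sub_Comp_iso[OF k(1) m] k by simp
qed

lemma G_domcod [simp]:
  assumes "m \<in> Arr C" "n \<in> Arr C" "Dom C m = Dom C n"
  shows "G_dom C (span C m n) = sub C m" "G_cod C (span C m n) = sub C n"
  using span_rep[OF assms] assms sub_Comp_iso unpair_pair
  by (metis G_dom_def fst_conv, metis G_cod_def snd_conv)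

lemma G_arrE:
  assumes "x \<in> G_arr C"
  obtains m n where "x = pair (m, n)" "x = span C m n" "m \<in> Arr C" "n \<in> Arr C" "Dom C m = Dom C n"
proof -
  obtain m n where *: "x = span C m n" "m \<in> Arr C" "n \<in> Arr C" "Dom C m = Dom C n"
    using assms by (auto simp: G_arr_def)
  obtain k where k: "iso C k" "k \<in> Arr C" "Cod C k = Dom C m" "span C m n = pair (m \<cdot> k, n \<cdot> k)"
    using span_rep[OF *(2-4)] .
  have "span C (m \<cdot> k) (n \<cdot> k) = span C m n"
    using *(2-4) k(1-3) by (simp add: span_Comp_iso)
  then have "x = span C (m \<cdot> k) (n \<cdot> k)" using *(1) by (rule trans[OF _ sym, rotated])
  then show thesis by (rule that[OF trans[OF *(1) k(4)]]) (use *(2-4) k(2,3) in simp_all)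
qed

text \<open>With stored legs \<open>(k \<cdot> a, m \<cdot> a)\<close> and
  \<open>(m \<cdot> b, n \<cdot> b)\<close> the mediating isomorphism is the inverse of
  \<open>b\<close> after \<open>a\<close>. Left-cancellativity makes it the only one, so
  \<open>THE\<close> finds it; then \<open>b\<close> cancels in the right leg and
  \<open>span_Comp_iso\<close> removes \<open>a\<close>.\<close>

lemma G_comp [simp]:
  assumes "k \<in> Arr C" "m \<in> Arr C" "n \<in> Arr C" "Dom C k = Dom C m" "Dom C n = Dom C m"
  shows "G_comp C (span C m n) (span C k m) = span C k n"
proof -
  obtain a where a: "iso C a" "a \<in> Arr C" "Cod C a = Dom C m" "span C k m = pair (k \<cdot> a, m \<cdot> a)"
    using span_rep[OF assms(1,2,4)] assms by metis
  obtain b where b: "iso C b" "b \<in> Arr C" "Cod C b = Dom C m" "span C m n = pair (m \<cdot> b, n \<cdot> b)"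
    using span_rep[OF assms(2,3) assms(5)[symmetric]] assms by metis
  obtain b' where b': "iso C b'" "b' \<in> Arr C" "Dom C b' = Dom C m" "Cod C b' = Dom C b" "b \<cdot> b' = Ident C (Dom C m)"
    using isoE[OF b(1)] b(3) by metis
  have mb: "m \<cdot> b \<cdot> (b' \<cdot> a) = m \<cdot> a" if "m \<in> Arr C" "Dom C m = Cod C b" for m
  proof -
    have "m \<cdot> b \<cdot> (b' \<cdot> a) = m \<cdot> ((b \<cdot> b') \<cdot> a)" using that a b b' by (subst assoc[of b]) simp_all
    then show ?thesis using that a b b' by simp
  qed
  have "(THE h. iso C h \<and> (m \<cdot> b, h) \<in> composable C \<and> m \<cdot> a = m \<cdot> b \<cdot> h) = b' \<cdot> a"
  proof (rule the_equality)
    show h: "iso C (b' \<cdot> a) \<and> (m \<cdot> b, b' \<cdot> a) \<in> composable C \<and> m \<cdot> a = m \<cdot> b \<cdot> (b' \<cdot> a)"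
      using a b b' assms mb[of m] by (auto simp: composable_def intro!: iso_Comp)
    fix h assume *: "iso C h \<and> (m \<cdot> b, h) \<in> composable C \<and> m \<cdot> a = m \<cdot> b \<cdot> h"
    then have hA: "h \<in> Arr C" "Cod C h = Dom C b" using b assms by (auto simp: composable_def)
    have Dh: "Dom C h = Dom C a"
      using * a b hA assms Comp_simps(2)[of m a] Comp_simps(2)[of "m \<cdot> b" h] by (metis Comp_simps(1,2))
    have e: "m \<cdot> b \<cdot> h = m \<cdot> b \<cdot> (b' \<cdot> a)" using * h by metis
    show "h = b' \<cdot> a"
      by (rule cancel[OF lc _ hA(1) _ _ _ _ e]) (use Dh hA a(1-3) b(1-3) b' assms in simp_all)
  qed
  then have "G_comp C (span C m n) (span C k m) = span C (k \<cdot> a) (n \<cdot> b \<cdot> (b' \<cdot> a))"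
    by (simp add: G_comp_def a b)
  also have "\<dots> = span C (k \<cdot> a) (n \<cdot> a)" using mb[of n] b assms by simp
  also have "\<dots> = span C k n" using a assms by (simp add: span_Comp_iso)
  finally show ?thesis .
qed

lemma Arr_G0_simps: "Arr (G0 C) = G_arr C" "Obj (G0 C) = G_obj C"
  by (simp_all add: G0_def)

lemma span_in [simp]: "\<lbrakk>m \<in> Arr C; n \<in> Arr C; Dom C m = Dom C n\<rbrakk> \<Longrightarrow> span C m n \<in> Arr (G0 C)"
  by (auto simp: G0_def G_arr_def)

lemma sub_in [simp]: "m \<in> Arr C \<Longrightarrow> sub C m \<in> Obj (G0 C)"
  by (simp add: G0_def G_obj_def)

lemma G0_simps [simp]:
  "\<lbrakk>m \<in> Arr C; n \<in> Arr C; Dom C m = Dom C n\<rbrakk> \<Longrightarrow> Dom (G0 C) (span C m n) = sub C m"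
  "\<lbrakk>m \<in> Arr C; n \<in> Arr C; Dom C m = Dom C n\<rbrakk> \<Longrightarrow> Cod (G0 C) (span C m n) = sub C n"
  "m \<in> Arr C \<Longrightarrow> Ident (G0 C) (sub C m) = span C m m"
  "\<lbrakk>k \<in> Arr C; m \<in> Arr C; n \<in> Arr C; Dom C k = Dom C m; Dom C n = Dom C m\<rbrakk>
    \<Longrightarrow> span C m n \<cdot>\<^bsub>G0 C\<^esub> span C k m = span C k n"
  using span_in[of m n] span_in[of k m] sub_in[of m] by (simp_all add: G0_def span_sub_sub)

lemma G0_arrE:
  assumes "x \<in> Arr (G0 C)"
  obtains m n where "x = span C m n" "m \<in> Arr C" "n \<in> Arr C" "Dom C m = Dom C n"
  using assms by (auto simp: G0_def elim: G_arrE)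

lemma G0_objE:
  assumes "X \<in> Obj (G0 C)"
  obtains m where "X = sub C m" "m \<in> Arr C"
  using assms by (auto simp: G0_def G_obj_def)

text \<open>
  Hence composable arrows of \<open>G(C)\<close> can be taken to be \<open>[k, l]\<close> and \<open>[l, n]\<close>, with composite \<open>[k, n]\<close>:
  no mediating isomorphism has to be carried along.
\<close>

lemma G0_arr_DomE:
  assumes "y \<in> Arr (G0 C)" "Dom (G0 C) y = sub C l" "l \<in> Arr C"
  obtains n where "y = span C l n" "n \<in> Arr C" "Dom C n = Dom C l"
proof -
  obtain m n where y: "y = span C m n" "m \<in> Arr C" "n \<in> Arr C" "Dom C m = Dom C n"
    using assms by (auto elim: G0_arrE)
  then have "sub C l = sub C m" using assms by simp
  then obtain h where h: "iso C h" "h \<in> Arr C" "Cod C h = Dom C m" "Dom C h = Dom C l" "l = m \<cdot> h"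
    using assms y by (elim sub_eqE)
  have "y = span C l (n \<cdot> h)" using y h(1-3,5) by (simp add: span_Comp_iso)
  then show thesis
    by (rule that) (use y(2-4) h(2-4) in simp_all)
qed

lemma category_G0: "category (G0 C)"
proof (rule categoryI)
  show "Dom (G0 C) \<in> Arr (G0 C) \<rightarrow>\<^sub>E Obj (G0 C)" "Cod (G0 C) \<in> Arr (G0 C) \<rightarrow>\<^sub>E Obj (G0 C)"
  proof -
    have "Dom (G0 C) x \<in> Obj (G0 C)" "Cod (G0 C) x \<in> Obj (G0 C)" if "x \<in> Arr (G0 C)" for x
      using that by (auto elim: G0_arrE)
    then show "Dom (G0 C) \<in> Arr (G0 C) \<rightarrow>\<^sub>E Obj (G0 C)" "Cod (G0 C) \<in> Arr (G0 C) \<rightarrow>\<^sub>E Obj (G0 C)"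
      by (simp_all add: PiE_iff) (simp_all add: G0_def)
  qed
  show "Ident (G0 C) \<in> extensional (Obj (G0 C))" by (simp add: G0_def)
  show "Comp (G0 C) \<in> extensional (composable (G0 C))"
    by (auto simp: G0_def composable_def extensional_def)
  fix X assume "X \<in> Obj (G0 C)"
  then show "Ident (G0 C) X \<in> Arr (G0 C) \<and> Dom (G0 C) (Ident (G0 C) X) = X \<and> Cod (G0 C) (Ident (G0 C) X) = X"
    by (auto elim: G0_objE)
next
  fix x assume "x \<in> Arr (G0 C)"
  then obtain k l where x: "x = span C k l" "k \<in> Arr C" "l \<in> Arr C" "Dom C k = Dom C l" by (rule G0_arrE)
  then show "x \<cdot>\<^bsub>G0 C\<^esub> Ident (G0 C) (Dom (G0 C) x) = x \<and> Ident (G0 C) (Cod (G0 C) x) \<cdot>\<^bsub>G0 C\<^esub> x = x"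
    by simp
  fix y assume "y \<in> Arr (G0 C)" "Dom (G0 C) y = Cod (G0 C) x"
  then obtain n where y: "y = span C l n" "n \<in> Arr C" "Dom C n = Dom C l"
    using x by (auto elim: G0_arr_DomE)
  then show "y \<cdot>\<^bsub>G0 C\<^esub> x \<in> Arr (G0 C) \<and> Dom (G0 C) (y \<cdot>\<^bsub>G0 C\<^esub> x) = Dom (G0 C) x \<and>
      Cod (G0 C) (y \<cdot>\<^bsub>G0 C\<^esub> x) = Cod (G0 C) y"
    using x by simp
  fix z assume "z \<in> Arr (G0 C)" "Dom (G0 C) z = Cod (G0 C) y"
  then obtain p where z: "z = span C n p" "p \<in> Arr C" "Dom C p = Dom C n"
    using x y by (auto elim: G0_arr_DomE)
  then show "(z \<cdot>\<^bsub>G0 C\<^esub> y) \<cdot>\<^bsub>G0 C\<^esub> x = z \<cdot>\<^bsub>G0 C\<^esub> (y \<cdot>\<^bsub>G0 C\<^esub> x)"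
    using x y by simp
qed

text \<open>The order compares stored representatives, and that of \<open>span C m n\<close> is
  \<open>(m \<cdot> k, n \<cdot> k)\<close>. Composing the factoring arrow with \<open>k\<close> or
  with its inverse \<open>k'\<close> converts a factorisation through the stored legs into one
  through \<open>m\<close> and \<open>n\<close>, and back.\<close>

lemma G_le_iff:
  assumes "m \<in> Arr C" "n \<in> Arr C" "Dom C m = Dom C n"
  shows "(x, span C m n) \<in> Le (G0 C) \<longleftrightarrow>
    (\<exists>h. h \<in> Arr C \<and> Cod C h = Dom C m \<and> x = span C (m \<cdot> h) (n \<cdot> h))"
proof -
  obtain k where k: "iso C k" "k \<in> Arr C" "Cod C k = Dom C m" "span C m n = pair (m \<cdot> k, n \<cdot> k)"
    using span_rep[OF assms] .
  show ?thesis
  proof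
    assume "(x, span C m n) \<in> Le (G0 C)"
    then have "x \<in> G_arr C" and *: "case unpair x of (m', n') \<Rightarrow>
        \<exists>h. (m \<cdot> k, h) \<in> composable C \<and> m' = m \<cdot> k \<cdot> h \<and> n' = n \<cdot> k \<cdot> h"
      by (simp_all add: G0_def G_le_def k(4))
    obtain m' n' where x: "x = pair (m', n')" "x = span C m' n'" using \<open>x \<in> G_arr C\<close> by (rule G_arrE)
    then obtain h where "h \<in> Arr C" "Cod C h = Dom C k" "m' = m \<cdot> k \<cdot> h" "n' = n \<cdot> k \<cdot> h"
      using * k assms by (auto simp: composable_def)
    then have "k \<cdot> h \<in> Arr C \<and> Cod C (k \<cdot> h) = Dom C m \<and> x = span C (m \<cdot> (k \<cdot> h)) (n \<cdot> (k \<cdot> h))"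
      using x k assms by simp
    then show "\<exists>h. h \<in> Arr C \<and> Cod C h = Dom C m \<and> x = span C (m \<cdot> h) (n \<cdot> h)" by blast
  next
    assume "\<exists>h. h \<in> Arr C \<and> Cod C h = Dom C m \<and> x = span C (m \<cdot> h) (n \<cdot> h)"
    then obtain h where h: "h \<in> Arr C" "Cod C h = Dom C m" "x = span C (m \<cdot> h) (n \<cdot> h)" by blast
    obtain j where j: "iso C j" "j \<in> Arr C" "Cod C j = Dom C h" "x = pair (m \<cdot> h \<cdot> j, n \<cdot> h \<cdot> j)"
      using span_rep[of "m \<cdot> h" "n \<cdot> h"] h assms by auto
    obtain k' where k': "k' \<in> Arr C" "Dom C k' = Dom C m" "Cod C k' = Dom C k" "k \<cdot> k' = Ident C (Dom C m)"
      using isoE[OF k(1)] k(3) by metis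
    have "p \<cdot> h \<cdot> j = p \<cdot> k \<cdot> (k' \<cdot> (h \<cdot> j))" if "p \<in> Arr C" "Dom C p = Dom C m" for p
    proof -
      have "p \<cdot> k \<cdot> (k' \<cdot> (h \<cdot> j)) = p \<cdot> ((k \<cdot> k') \<cdot> (h \<cdot> j))"
        using that h j k k' by (subst assoc[of k]) simp_all
      then show ?thesis using that h j k k' by simp
    qed
    moreover have "x \<in> G_arr C" "span C m n \<in> G_arr C"
      using h assms span_in[of m n] span_in[of "m \<cdot> h" "n \<cdot> h"] by (simp_all add: Arr_G0_simps)
    moreover have "(m \<cdot> k, k' \<cdot> (h \<cdot> j)) \<in> composable C"
      using assms h j k k' by (simp add: composable_def)
    ultimately show "(x, span C m n) \<in> Le (G0 C)"
      using assms unfolding G0_def G_le_def by (auto simp: k(4) j(4))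
  qed
qed

lemma Le_G0_Arr: "(x, y) \<in> Le (G0 C) \<Longrightarrow> x \<in> Arr (G0 C) \<and> y \<in> Arr (G0 C)"
  by (auto simp: G0_def G_le_def)

lemma Le_G0E:
  assumes "(x, y) \<in> Le (G0 C)"
  obtains m n h where "y = span C m n" "x = span C (m \<cdot> h) (n \<cdot> h)"
    "m \<in> Arr C" "n \<in> Arr C" "h \<in> Arr C" "Dom C m = Dom C n" "Cod C h = Dom C n"
proof -
  have "y \<in> Arr (G0 C)" using Le_G0_Arr assms by blast
  then obtain m n where y: "y = span C m n" "m \<in> Arr C" "n \<in> Arr C" "Dom C m = Dom C n" by (rule G0_arrE)
  then obtain h where "h \<in> Arr C" "Cod C h = Dom C m" "x = span C (m \<cdot> h) (n \<cdot> h)"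
    using G_le_iff assms by metis
  then show thesis using y that by simp
qed

lemma Le_G0I:
  "\<lbrakk>m \<in> Arr C; n \<in> Arr C; h \<in> Arr C; Dom C m = Dom C n; Cod C h = Dom C n\<rbrakk>
    \<Longrightarrow> (span C (m \<cdot> h) (n \<cdot> h), span C m n) \<in> Le (G0 C)"
  by (subst G_le_iff) auto

lemma obj_le_G0_iff:
  assumes "n \<in> Arr C"
  shows "obj_le (G0 C) X (sub C n) \<longleftrightarrow> (\<exists>h. h \<in> Arr C \<and> Cod C h = Dom C n \<and> X = sub C (n \<cdot> h))"
proof
  assume X: "obj_le (G0 C) X (sub C n)"
  then have "(Ident (G0 C) X, span C n n) \<in> Le (G0 C)" "X \<in> Obj (G0 C)" using assms by (auto simp: obj_le_def)
  then obtain h where "h \<in> Arr C" "Cod C h = Dom C n" "Ident (G0 C) X = span C (n \<cdot> h) (n \<cdot> h)"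
    using assms G_le_iff by blast
  moreover from this have "X = sub C (n \<cdot> h)"
    using category.Ident_simps(2)[OF category_G0 \<open>X \<in> Obj (G0 C)\<close>] assms by simp
  ultimately show "\<exists>h. h \<in> Arr C \<and> Cod C h = Dom C n \<and> X = sub C (n \<cdot> h)" by blast
qed (auto simp: obj_le_def assms intro!: Le_G0I)

lemma obj_le_G0I [simp]:
  "\<lbrakk>n \<in> Arr C; h \<in> Arr C; Cod C h = Dom C n\<rbrakk> \<Longrightarrow> obj_le (G0 C) (sub C (n \<cdot> h)) (sub C n)"
  by (auto simp: obj_le_G0_iff)

lemma inverse_arrows_G0:
  "\<lbrakk>m \<in> Arr C; n \<in> Arr C; Dom C m = Dom C n\<rbrakk> \<Longrightarrow> inverse_arrows (G0 C) (span C m n) (span C n m)"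
  by (simp add: inverse_arrows_def hom_def)

text \<open>Inversion swaps the legs of a span and restriction precomposes both legs.
  Left-cancellativity enters through the uniqueness of inverses and of restrictions, and through
  antisymmetry.\<close>

lemma ordered_groupoid_G0: "ordered_groupoid (G0 C)"
proof -
  interpret G: category "G0 C" by (rule category_G0)
  have iso: "iso (G0 C) x" if "x \<in> Arr (G0 C)" for x
    using that inverse_arrows_G0 by (auto simp: iso_def elim!: G0_arrE)
  have inv: "inv_arrow (G0 C) (span C m n) = span C n m"
    if mn: "m \<in> Arr C" "n \<in> Arr C" "Dom C m = Dom C n" for m n
    unfolding inv_arrow_def
  proof (rule the_equality, rule inverse_arrows_G0[OF mn])
    fix y assume "inverse_arrows (G0 C) (span C m n) y"
    then have y: "y \<in> Arr (G0 C)" "Dom (G0 C) y = sub C n" "y \<cdot>\<^bsub>G0 C\<^esub> span C m n = span C m m"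
      using mn by (simp_all add: inverse_arrows_def hom_def)
    then obtain p where p: "y = span C n p" "p \<in> Arr C" "Dom C p = Dom C n"
      using mn by (elim G0_arr_DomE)
    then have "span C m p = span C m m" using y mn by simp
    then show "y = span C n m" using p mn span_eq_right_iff[of m p m] by simp
  qed
  have restr: "\<exists>!x. (x, f) \<in> Le (G0 C) \<and> Dom (G0 C) x = A"
    if f: "f \<in> Arr (G0 C)" and A: "obj_le (G0 C) A (Dom (G0 C) f)" for f A
  proof -
    obtain m n where mn: "f = span C m n" "m \<in> Arr C" "n \<in> Arr C" "Dom C m = Dom C n"
      using f by (rule G0_arrE)
    with A obtain h where h: "h \<in> Arr C" "Cod C h = Dom C m" "A = sub C (m \<cdot> h)"
      using obj_le_G0_iff[of m A] by auto
    show ?thesis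
    proof
      show "(span C (m \<cdot> h) (n \<cdot> h), f) \<in> Le (G0 C) \<and> Dom (G0 C) (span C (m \<cdot> h) (n \<cdot> h)) = A"
        using mn h by (simp add: Le_G0I)
      fix x assume x: "(x, f) \<in> Le (G0 C) \<and> Dom (G0 C) x = A"
      then obtain h' where h': "h' \<in> Arr C" "Cod C h' = Dom C m" "x = span C (m \<cdot> h') (n \<cdot> h')"
        using mn G_le_iff by metis
      then have "sub C (m \<cdot> h') = sub C (m \<cdot> h)" using x mn h by simp
      moreover have mh: "m \<cdot> h' \<in> Arr C" "Dom C (m \<cdot> h') = Dom C h'" "m \<cdot> h \<in> Arr C" "Dom C (m \<cdot> h) = Dom C h"
        using mn(2-4) h(1,2) h'(1,2) by simp_all
      ultimately obtain j where j: "iso C j" "j \<in> Arr C" "Cod C j = Dom C h" "Dom C j = Dom C h'"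
        and j': "m \<cdot> h' = m \<cdot> h \<cdot> j"
        using sub_eqE[of "m \<cdot> h'" "m \<cdot> h"] by metis
      have e: "m \<cdot> h' = m \<cdot> (h \<cdot> j)"
        using mn(2-4) h(1,2) j unfolding j' by simp
      \<comment> \<open>Equality of the domains speaks about the left legs only. Cancelling
        \<open>m\<close> frees \<open>j\<close> from them, so that it relates the right legs as
        well.\<close>
      have "h' = h \<cdot> j"
        by (rule cancel[OF lc mn(2) h'(1) _ _ _ _ e]) (use mn(2-4) h(1,2) h'(1,2) j(2-4) in simp_all)
      then show "x = span C (m \<cdot> h) (n \<cdot> h)"
        using mn h h' j span_Comp_iso[of j "m \<cdot> h" "n \<cdot> h"] by simp
    qed
  qed
  have order: "partial_order_on (Arr (G0 C)) (Le (G0 C))"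
    unfolding partial_order_on_def preorder_on_def
  proof (intro conjI)
    show "Le (G0 C) \<subseteq> Arr (G0 C) \<times> Arr (G0 C)" using Le_G0_Arr by auto
    show "refl_on (Arr (G0 C)) (Le (G0 C))"
    proof (rule refl_onI)
      fix x assume "x \<in> Arr (G0 C)"
      then obtain m n where "x = span C m n" "m \<in> Arr C" "n \<in> Arr C" "Dom C m = Dom C n" by (rule G0_arrE)
      then show "(x, x) \<in> Le (G0 C)" using Le_G0I[of m n "Ident C (Dom C n)"] by simp
    qed
    show "trans (Le (G0 C))"
    proof (rule transI)
      fix x y z assume xy: "(x, y) \<in> Le (G0 C)" and "(y, z) \<in> Le (G0 C)"
      from this(2) obtain m n h where h: "z = span C m n" "y = span C (m \<cdot> h) (n \<cdot> h)"
        "m \<in> Arr C" "n \<in> Arr C" "h \<in> Arr C" "Dom C m = Dom C n" "Cod C h = Dom C n" by (rule Le_G0E)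
      with xy obtain g where g: "g \<in> Arr C" "Cod C g = Dom C h" "x = span C (m \<cdot> (h \<cdot> g)) (n \<cdot> (h \<cdot> g))"
        using G_le_iff[of "m \<cdot> h" "n \<cdot> h" x] by auto
      then show "(x, z) \<in> Le (G0 C)" using h Le_G0I[of m n "h \<cdot> g"] by simp
    qed
    show "antisym (Le (G0 C))"
    proof (rule antisymI)
      fix x y assume xy: "(x, y) \<in> Le (G0 C)" and "(y, x) \<in> Le (G0 C)"
      from this(2) obtain m n h where h: "x = span C m n" "y = span C (m \<cdot> h) (n \<cdot> h)"
        "m \<in> Arr C" "n \<in> Arr C" "h \<in> Arr C" "Dom C m = Dom C n" "Cod C h = Dom C n" by (rule Le_G0E)
      with xy obtain g where g: "g \<in> Arr C" "Cod C g = Dom C h" "span C m n = span C (m \<cdot> (h \<cdot> g)) (n \<cdot> (h \<cdot> g))"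
        using G_le_iff[of "m \<cdot> h" "n \<cdot> h" x] by auto
      then obtain j where j: "iso C j" "j \<in> Arr C" "Cod C j = Dom C g" "Dom C j = Dom C m"
        "m = m \<cdot> (h \<cdot> g) \<cdot> j"
        using h span_eqE[of m n "m \<cdot> (h \<cdot> g)" "n \<cdot> (h \<cdot> g)"] by auto
      have e: "m \<cdot> (h \<cdot> (g \<cdot> j)) = m \<cdot> Ident C (Dom C m)"
        using j(5)[symmetric] j(1-4) g(1,2) h(3-7) by simp
      have 1: "h \<cdot> (g \<cdot> j) = Ident C (Dom C m)"
        by (rule cancel[OF lc h(3) _ _ _ _ _ e]) (use j(1-4) g(1,2) h(3-7) in simp_all)
      then have e': "h \<cdot> (g \<cdot> j \<cdot> h) = h \<cdot> Ident C (Dom C h)"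
        using j(1-4) g(1,2) h(3-7) by (subst assoc[symmetric]) simp_all
      \<comment> \<open>\<open>h\<close> has the right inverse \<open>g \<cdot> j\<close> and is a
        monomorphism, so that inverse is two-sided; an inequality induced by an isomorphism is an
        equality of spans.\<close>
      have "g \<cdot> j \<cdot> h = Ident C (Dom C h)"
        by (rule cancel[OF lc h(5) _ _ _ _ _ e']) (use j(1-4) g(1,2) h(3-7) in simp_all)
      then have "iso C h"
        by (intro isoI[of h "g \<cdot> j"]) (use 1 j(1-4) g(1,2) h(3-7) in simp_all)
      then have "span C (m \<cdot> h) (n \<cdot> h) = span C m n" using h(3-7) by (simp add: span_Comp_iso)
      then show "x = y" using h(1,2) by simp
    qed
  qed
  show ?thesis
  proof (intro ordered_groupoid.intro category_G0 ordered_groupoid_axioms.intro iso order restr)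
    fix x y assume "(x, y) \<in> Le (G0 C)"
    then show "(inv_arrow (G0 C) x, inv_arrow (G0 C) y) \<in> Le (G0 C)"
      by (elim Le_G0E) (simp add: inv Le_G0I)
  next
    fix a b c d assume "(a, b) \<in> Le (G0 C)" and cd: "(c, d) \<in> Le (G0 C)" "(a, c) \<in> composable (G0 C)"
      "(b, d) \<in> composable (G0 C)"
    from cd(1) obtain k m g where d: "d = span C k m" "c = span C (k \<cdot> g) (m \<cdot> g)"
      "k \<in> Arr C" "m \<in> Arr C" "g \<in> Arr C" "Dom C k = Dom C m" "Cod C g = Dom C m" by (rule Le_G0E)
    have "b \<in> Arr (G0 C)" "Dom (G0 C) b = sub C m" using cd d by (auto simp: composable_def)
    then obtain n where n: "b = span C m n" "n \<in> Arr C" "Dom C n = Dom C m" using d by (elim G0_arr_DomE)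
    have 1: "Dom (G0 C) a = sub C (m \<cdot> g)" using cd d by (simp add: composable_def)
    have 2: "obj_le (G0 C) (sub C (m \<cdot> g)) (Dom (G0 C) b)"
      "(span C (m \<cdot> g) (n \<cdot> g), b) \<in> Le (G0 C)" "Dom (G0 C) (span C (m \<cdot> g) (n \<cdot> g)) = sub C (m \<cdot> g)"
      using n d(3-7) by (simp_all add: Le_G0I)
    \<comment> \<open>\<open>a\<close> lies below \<open>b\<close>, and its domain is the codomain
      of \<open>c\<close>. Uniqueness of restrictions gives it a left leg equal to the right leg of
      \<open>c\<close>, so the composite can be computed.\<close>
    have "a = span C (m \<cdot> g) (n \<cdot> g)"
      using restr[OF \<open>b \<in> Arr (G0 C)\<close> 2(1)] 1 2(2,3) \<open>(a, b) \<in> Le (G0 C)\<close> by blast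
    then show "(a \<cdot>\<^bsub>G0 C\<^esub> c, b \<cdot>\<^bsub>G0 C\<^esub> d) \<in> Le (G0 C)" using n d by (simp add: Le_G0I)
  qed
qed

lemma restr_G0 [simp]:
  "\<lbrakk>m \<in> Arr C; n \<in> Arr C; h \<in> Arr C; Dom C m = Dom C n; Cod C h = Dom C n\<rbrakk>
    \<Longrightarrow> restr (G0 C) (span C m n) (sub C (m \<cdot> h)) = span C (m \<cdot> h) (n \<cdot> h)"
  using ordered_groupoid.restr_eqI[OF ordered_groupoid_G0 Le_G0I[of m n h]] by simp

lemma inv_G0 [simp]:
  "\<lbrakk>m \<in> Arr C; n \<in> Arr C; Dom C m = Dom C n\<rbrakk> \<Longrightarrow> inv_arrow (G0 C) (span C m n) = span C n m"
  by (rule ordered_groupoid.inv_eqI[OF ordered_groupoid_G0]) simp_all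

text \<open>Precomposition does not change the codomain of a subobject, so comparable classes share
  their codomain. Since \<open>[n]\<close> always lies below the class of the identity on
  \<open>Cod C n\<close>, these identities give exactly the maximal objects.\<close>

lemma has_unique_maximal_G0: "has_unique_maximal (G0 C)"
  unfolding has_unique_maximal_def
proof (intro ballI)
  interpret G: ordered_groupoid "G0 C" by (rule ordered_groupoid_G0)
  fix X assume "X \<in> Obj (G0 C)"
  then obtain m where m: "X = sub C m" "m \<in> Arr C" by (rule G0_objE)
  have top: "obj_le (G0 C) (sub C n) (sub C (Ident C (Cod C n)))" if "n \<in> Arr C" for n
    using that obj_le_G0I[of "Ident C (Cod C n)" n] by simp
  have maxI: "maximal_obj (G0 C) (sub C (Ident C (Cod C m)))"
    unfolding maximal_obj_def
  proof (intro conjI allI impI)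
    fix Y assume Y: "obj_le (G0 C) (sub C (Ident C (Cod C m))) Y"
    then obtain n where n: "Y = sub C n" "n \<in> Arr C" using G.obj_leD by (blast elim: G0_objE)
    then obtain h where h: "h \<in> Arr C" "Cod C h = Dom C n" "sub C (Ident C (Cod C m)) = sub C (n \<cdot> h)"
      using Y obj_le_G0_iff by blast
    then obtain j where "Ident C (Cod C m) = n \<cdot> h \<cdot> j" "j \<in> Arr C" "Cod C j = Dom C h"
      using m n sub_eqE[of "Ident C (Cod C m)" "n \<cdot> h"] by auto
    then have "Cod C (Ident C (Cod C m)) = Cod C n" using n h by simp
    then have "Cod C n = Cod C m" using m by simp
    then show "Y = sub C (Ident C (Cod C m))"
      using top[OF n(2)] Y n G.obj_le_antisym by simp
  qed (use m in simp)
  show "\<exists>!M. maximal_obj (G0 C) M \<and> obj_le (G0 C) X M"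
  proof
    show "maximal_obj (G0 C) (sub C (Ident C (Cod C m))) \<and> obj_le (G0 C) X (sub C (Ident C (Cod C m)))"
      using maxI top m by simp
    fix M assume M: "maximal_obj (G0 C) M \<and> obj_le (G0 C) X M"
    then obtain n where n: "M = sub C n" "n \<in> Arr C" by (auto simp: maximal_obj_def elim: G0_objE)
    then have "M = sub C (Ident C (Cod C n))" using M top[OF n(2)] unfolding maximal_obj_def by metis
    moreover obtain h where h: "h \<in> Arr C" "Cod C h = Dom C n" "sub C m = sub C (n \<cdot> h)"
      using M m n obj_le_G0_iff by blast
    then obtain j where "m = n \<cdot> h \<cdot> j" "j \<in> Arr C" "Cod C j = Dom C h"
      using m n sub_eqE[of m "n \<cdot> h"] by auto
    then have "Cod C m = Cod C n" using n h by simp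
    ultimately show "M = sub C (Ident C (Cod C m))" by simp
  qed
qed

end

section \<open>The action of \<open>G\<close> on functors and natural transformations\<close>

lemma lc_categoryI: "\<lbrakk>category C; left_cancellative C\<rbrakk> \<Longrightarrow> lc_category C"
  by (intro lc_category.intro lc_category_axioms.intro)

lemma lc_category_L0: "ordered_groupoid G \<Longrightarrow> lc_category (L0 G)"
  by (intro lc_categoryI category_L0 left_cancellative_L0)

locale lc_functor = functor_between C D K + C: lc_category C + D: lc_category D
  for C D :: "'u::infinite cat" and K
begin

text \<open>A functor preserves isomorphisms, so the stored legs may be replaced by any legs of the
  same span.\<close>

lemma amap_G1 [simp]:
  assumes "m \<in> Arr C" "n \<in> Arr C" "Dom C m = Dom C n"
  shows "amap (G1 K) (span C m n) = span D (amap K m) (amap K n)"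
proof -
  obtain k where k: "iso C k" "k \<in> Arr C" "Cod C k = Dom C m" "span C m n = pair (m \<cdot>\<^bsub>C\<^esub> k, n \<cdot>\<^bsub>C\<^esub> k)"
    using C.span_rep[OF assms] .
  have "amap (G1 K) (span C m n) = span D (amap K (m \<cdot>\<^bsub>C\<^esub> k)) (amap K (n \<cdot>\<^bsub>C\<^esub> k))"
    using C.span_in[OF assms] k(4) by (simp add: G1_def C.Arr_G0_simps)
  also have "\<dots> = span D (amap K m) (amap K n)"
    using assms k(1-3) iso_amap[OF k(1)] by (simp add: D.span_Comp_iso)
  finally show ?thesis .
qed

lemma omap_G1 [simp]:
  assumes "m \<in> Arr C" shows "omap (G1 K) (sub C m) = sub D (amap K m)"
proof -
  obtain k where k: "iso C k" "k \<in> Arr C" "Cod C k = Dom C m" "sub C m = m \<cdot>\<^bsub>C\<^esub> k"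
    using C.sub_rep[OF assms] .
  have "omap (G1 K) (sub C m) = sub D (amap K (m \<cdot>\<^bsub>C\<^esub> k))"
    using C.sub_in[OF assms] k(4) by (simp add: G1_def C.Arr_G0_simps)
  also have "\<dots> = sub D (amap K m)"
    using assms k(1-3) iso_amap[OF k(1)] by (simp add: D.sub_Comp_iso)
  finally show ?thesis .
qed

lemma ordered_functor_G1: "ordered_functor (G0 C) (G0 D) (G1 K)"
proof (rule ordered_functorI)
  show "functor_between (G0 C) (G0 D) (G1 K)"
  proof (rule functor_betweenI)
    show "omap (G1 K) \<in> extensional (Obj (G0 C))" "amap (G1 K) \<in> extensional (Arr (G0 C))"
      by (simp_all add: G1_def C.Arr_G0_simps)
    fix x assume "x \<in> Arr (G0 C)"
    then obtain k m where x: "x = span C k m" "k \<in> Arr C" "m \<in> Arr C" "Dom C k = Dom C m"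
      by (rule C.G0_arrE)
    then show "amap (G1 K) x \<in> Arr (G0 D) \<and> Dom (G0 D) (amap (G1 K) x) = omap (G1 K) (Dom (G0 C) x) \<and>
        Cod (G0 D) (amap (G1 K) x) = omap (G1 K) (Cod (G0 C) x)"
      by simp
    fix y assume "y \<in> Arr (G0 C)" "Dom (G0 C) y = Cod (G0 C) x"
    then obtain n where "y = span C m n" "n \<in> Arr C" "Dom C n = Dom C m"
      using x by (auto elim: C.G0_arr_DomE)
    then show "amap (G1 K) (y \<cdot>\<^bsub>G0 C\<^esub> x) = amap (G1 K) y \<cdot>\<^bsub>G0 D\<^esub> amap (G1 K) x"
      using x by simp
  next
    fix X assume "X \<in> Obj (G0 C)"
    then show "amap (G1 K) (Ident (G0 C) X) = Ident (G0 D) (omap (G1 K) X)"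
      by (auto elim!: C.G0_objE)
  qed (simp_all add: G1_def C.category_G0 D.category_G0)
  fix x y assume "(x, y) \<in> Le (G0 C)"
  then show "(amap (G1 K) x, amap (G1 K) y) \<in> Le (G0 D)"
    by (elim C.Le_G0E) (simp add: D.Le_G0I)
qed (simp_all add: C.ordered_groupoid_G0 D.ordered_groupoid_G0)

end

lemma lc_functorI:
  "\<lbrakk>functor_between C D K; left_cancellative C; left_cancellative D\<rbrakk> \<Longrightarrow> lc_functor C D K"
  by (simp add: lc_functor_def lc_category_def lc_category_axioms_def functor_between_def
      is_functor.fdom is_functor.fcod) (metis is_functor.fdom is_functor.fcod)

lemma lc_functor_comp: "\<lbrakk>lc_functor C D F; lc_functor D E G\<rbrakk> \<Longrightarrow> lc_functor C E (comp_func G F)"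
  by (auto simp: lc_functor_def intro: functor_between_comp)

locale lc_nat_trans = nat_trans C D t + C: lc_category C + D: lc_category D
  for C D :: "'u::infinite cat" and t
begin

sublocale S: lc_functor C D "nsrc t"
  by (intro lc_functor.intro S.functor_between_axioms C.lc_category_axioms D.lc_category_axioms)

sublocale T: lc_functor C D "ntrg t"
  by (intro lc_functor.intro T.functor_between_axioms C.lc_category_axioms D.lc_category_axioms)

lemma G2_simps [simp]: "lsrc (G2 t) = G1 (nsrc t)" "ltrg (G2 t) = G1 (ntrg t)"
  by (simp_all add: G2_def Let_def)

definition w :: "'u \<Rightarrow> 'u" where "w m = amap (ntrg t) m \<cdot>\<^bsub>D\<^esub> ncomp t (Dom C m)"

lemma w_simps [simp]:
  assumes "m \<in> Arr C"
  shows "w m \<in> Arr D" "Dom D (w m) = omap (nsrc t) (Dom C m)"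
  using assms by (simp_all add: w_def)

text \<open>Naturality at \<open>h\<close> turns precomposition with \<open>h\<close> in
  \<open>C\<close> into precomposition with its image under the source functor. Invariance under
  isomorphisms and monotonicity of the components of \<open>G2 t\<close> both rest on this.\<close>

lemma w_Comp: "\<lbrakk>m \<in> Arr C; h \<in> Arr C; Dom C m = Cod C h\<rbrakk> \<Longrightarrow> w (m \<cdot>\<^bsub>C\<^esub> h) = w m \<cdot>\<^bsub>D\<^esub> amap (nsrc t) h"
  by (simp add: w_def naturality)

lemma w_Comp_iso:
  assumes "m \<in> Arr C" "iso C k" "Cod C k = Dom C m"
  shows "sub D (w (m \<cdot>\<^bsub>C\<^esub> k)) = sub D (w m)"
    "n \<in> Arr C \<Longrightarrow> Dom C n = Dom C m \<Longrightarrow> span D (w (m \<cdot>\<^bsub>C\<^esub> k)) (w (n \<cdot>\<^bsub>C\<^esub> k)) = span D (w m) (w n)"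
    "span D (amap (nsrc t) (m \<cdot>\<^bsub>C\<^esub> k)) (w (m \<cdot>\<^bsub>C\<^esub> k)) = span D (amap (nsrc t) m) (w m)"
  using assms S.C.iso_Arr[OF assms(2)] S.iso_amap[OF assms(2)]
  by (simp_all add: w_Comp D.sub_Comp_iso D.span_Comp_iso)

lemma lcomp_G2 [simp]:
  assumes "m \<in> Arr C" shows "lcomp (G2 t) (sub C m) = span D (amap (nsrc t) m) (w m)"
proof -
  obtain k where k: "iso C k" "k \<in> Arr C" "Cod C k = Dom C m" "sub C m = m \<cdot>\<^bsub>C\<^esub> k"
    using C.sub_rep[OF assms] .
  have "lcomp (G2 t) (sub C m) = span D (amap (nsrc t) (m \<cdot>\<^bsub>C\<^esub> k)) (w (m \<cdot>\<^bsub>C\<^esub> k))"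
    using C.sub_in[OF assms] k(4) by (simp add: G2_def Let_def C.Arr_G0_simps w_def)
  then show ?thesis using w_Comp_iso(3)[OF assms k(1,3)] by simp
qed

text \<open>\<open>w m\<close> and \<open>w n\<close> arise from the images of \<open>m\<close> and
  \<open>n\<close> by precomposing with the same component of \<open>t\<close>, because the two legs
  share their domain; \<open>restr_G0\<close> then applies.\<close>

lemma restr_G1_w:
  "\<lbrakk>m \<in> Arr C; n \<in> Arr C; Dom C m = Dom C n\<rbrakk> \<Longrightarrow>
    restr (G0 D) (span D (amap (ntrg t) m) (amap (ntrg t) n)) (sub D (w m)) = span D (w m) (w n)"
  by (simp add: w_def)

lemma lambda_trans_G2: "lambda_trans (G0 C) (G0 D) (G2 t)"
proof (rule lambda_transI)
  show "ordered_functor (G0 C) (G0 D) (lsrc (G2 t))" "ordered_functor (G0 C) (G0 D) (ltrg (G2 t))"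
    by (simp_all add: S.ordered_functor_G1 T.ordered_functor_G1)
  show "lcomp (G2 t) \<in> extensional (Obj (G0 C))"
    by (simp add: G2_def Let_def C.Arr_G0_simps)
  fix X assume "X \<in> Obj (G0 C)"
  then obtain m where m: "X = sub C m" "m \<in> Arr C" by (rule C.G0_objE)
  then show "lcomp (G2 t) X \<in> Arr (G0 D)" "Dom (G0 D) (lcomp (G2 t) X) = omap (lsrc (G2 t)) X"
    by simp_all
  show "obj_le (G0 D) (Cod (G0 D) (lcomp (G2 t) X)) (omap (ltrg (G2 t)) X)"
    using m by (simp, simp add: w_def)
next
  fix x assume "x \<in> Arr (G0 C)"
  then obtain m n where x: "x = span C m n" "m \<in> Arr C" "n \<in> Arr C" "Dom C m = Dom C n"
    by (rule C.G0_arrE)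
  then show "restr (G0 D) (amap (ltrg (G2 t)) x) (Cod (G0 D) (lcomp (G2 t) (Dom (G0 C) x))) \<cdot>\<^bsub>G0 D\<^esub>
      lcomp (G2 t) (Dom (G0 C) x) = lcomp (G2 t) (Cod (G0 C) x) \<cdot>\<^bsub>G0 D\<^esub> amap (lsrc (G2 t)) x"
    by (simp add: restr_G1_w)
next
  fix X Y assume XY: "obj_le (G0 C) X Y"
  then obtain m where m: "Y = sub C m" "m \<in> Arr C" by (auto simp: obj_le_def elim: C.G0_objE)
  then obtain h where "h \<in> Arr C" "Cod C h = Dom C m" "X = sub C (m \<cdot>\<^bsub>C\<^esub> h)"
    using XY C.obj_le_G0_iff by blast
  then show "(lcomp (G2 t) X, lcomp (G2 t) Y) \<in> Le (G0 D)"
    using m by (simp add: w_Comp D.Le_G0I)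
next
  \<comment> \<open>The definition of \<open>lmid\<close> applies its formula to the stored
    representative. That representative is itself an arrow with \<open>sub C m = m\<close>, so the
    rule for \<open>lcomp (G2 t)\<close> on classes covers it.\<close>
  have "sub D (amap (ntrg t) m \<cdot>\<^bsub>D\<^esub> ncomp t (Dom C m)) = Cod (G0 D) (lcomp (G2 t) m)" if "m \<in> G_obj C" for m
  proof -
    have "m \<in> Obj (G0 C)" using that by (simp add: C.Arr_G0_simps)
    then obtain n where "m = sub C n" "n \<in> Arr C" by (rule C.G0_objE)
    then have "m \<in> Arr C" "sub C m = m" by simp_all
    then show ?thesis using lcomp_G2[of m] by (simp flip: w_def)
  qed
  moreover have "(case unpair x of (m, n) \<Rightarrow> span D (amap (ntrg t) m \<cdot>\<^bsub>D\<^esub> ncomp t (Dom C m))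
      (amap (ntrg t) n \<cdot>\<^bsub>D\<^esub> ncomp t (Dom C n))) =
    restr (G0 D) (amap (G1 (ntrg t)) x) (Cod (G0 D) (lcomp (G2 t) (Dom (G0 C) x)))" if xG: "x \<in> G_arr C" for x
  proof -
    obtain m n where x: "x = pair (m, n)" "x = span C m n" "m \<in> Arr C" "n \<in> Arr C" "Dom C m = Dom C n"
      using xG by (rule C.G_arrE)
    have "restr (G0 D) (amap (G1 (ntrg t)) x) (Cod (G0 D) (lcomp (G2 t) (Dom (G0 C) x))) = span D (w m) (w n)"
      unfolding x(2) using x(3-5) by (simp add: restr_G1_w)
    then show ?thesis using x(1) by (simp add: w_def)
  qed
  ultimately show "lmid (G2 t) = \<lparr>fdom = G0 C, fcod = G0 D, omap = \<lambda>X\<in>Obj (G0 C). Cod (G0 D) (lcomp (G2 t) X),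
      amap = \<lambda>f\<in>Arr (G0 C). restr (G0 D) (amap (ltrg (G2 t)) f) (Cod (G0 D) (lcomp (G2 t) (Dom (G0 C) f)))\<rparr>"
    by (intro func.equality) (auto simp: G2_def Let_def C.Arr_G0_simps intro!: restrict_ext)
qed

end

lemma lc_nat_transI:
  "\<lbrakk>nat_trans C D t; left_cancellative C; left_cancellative D\<rbrakk> \<Longrightarrow> lc_nat_trans C D t"
  by (metis lc_nat_trans_def lc_functorI lc_functor_def nat_transD(1))

lemma G1_id_func:
  assumes "lc_category C" shows "G1 (id_func C) = id_func (G0 C)"
proof -
  interpret lc_category C by fact
  interpret I: lc_functor C C "id_func C"
    by (intro lc_functorI functor_between_id category_axioms lc)
  show ?thesis
    by (rule func_eqI[OF ordered_functorD(1)[OF I.ordered_functor_G1] functor_between_id[OF category_G0]])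
      (auto elim!: G0_arrE)
qed

lemma G1_comp_func:
  assumes "lc_functor C D F" "lc_functor D E H" shows "G1 (comp_func H F) = comp_func (G1 H) (G1 F)"
proof -
  interpret F: lc_functor C D F by fact
  interpret H: lc_functor D E H by fact
  interpret HF: lc_functor C E "comp_func H F" by (rule lc_functor_comp) fact+
  have [simp]: "fdom (G1 F) = G0 C" by (simp add: G1_def)
  show ?thesis
    by (rule func_eqI[OF ordered_functorD(1)[OF HF.ordered_functor_G1]
          functor_between_comp[OF ordered_functorD(1)[OF F.ordered_functor_G1] ordered_functorD(1)[OF H.ordered_functor_G1]]])
      (auto elim!: F.C.G0_arrE)
qed

lemma G2_nid:
  assumes "lc_functor C D F" shows "G2 (nid F) = lid (G1 F)"
proof -
  interpret F: lc_functor C D F by fact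
  interpret N: lc_nat_trans C D "nid F"
    by (intro lc_nat_transI nat_trans_nid F.functor_between_axioms F.C.lc F.D.lc)
  have [simp]: "fdom (G1 F) = G0 C" "fcod (G1 F) = G0 D" by (simp_all add: G1_def)
  show ?thesis
    by (rule ltrans_eqI[OF N.lambda_trans_G2 lambda_trans_lid[OF F.ordered_functor_G1]])
      (auto elim!: F.C.G0_objE simp: N.w_def)
qed

lemma G2_nvcomp:
  assumes "lc_nat_trans C D t" "lc_nat_trans C D u" and e: "ntrg t = nsrc u"
  shows "G2 (nvcomp u t) = lvcomp (G2 u) (G2 t)"
proof -
  interpret t: lc_nat_trans C D t by fact
  interpret u: lc_nat_trans C D u by fact
  interpret v: lc_nat_trans C D "nvcomp u t"
    by (intro lc_nat_transI nat_trans_nvcomp t.nat_trans_axioms u.nat_trans_axioms e t.C.lc t.D.lc)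
  have [simp]: "nsrc u = ntrg t" using e by simp
  show ?thesis
  proof (rule ltrans_eqI[OF v.lambda_trans_G2 lambda_trans_lvcomp[OF t.lambda_trans_G2 u.lambda_trans_G2]])
    fix X assume "X \<in> Obj (G0 C)"
    then obtain m where m: "X = sub C m" "m \<in> Arr C" by (rule t.C.G0_objE)
    \<comment> \<open>\<open>t.w m\<close> is \<open>amap (ntrg t) m\<close> precomposed with the
      component of \<open>t\<close>, so restricting to its class precomposes both legs with that
      component. The new right leg is \<open>v.w m\<close>, which is fact \<open>2\<close>.\<close>
    have 1: "restr (G0 D) (span D (amap (ntrg t) m) (u.w m)) (sub D (t.w m)) =
        span D (t.w m) (u.w m \<cdot>\<^bsub>D\<^esub> ncomp t (Dom C m))"
      using m(2) by (simp add: t.w_def)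
    have 2: "v.w m = u.w m \<cdot>\<^bsub>D\<^esub> ncomp t (Dom C m)"
      using m(2) by (simp add: u.w_def v.w_def)
    show "lcomp (G2 (nvcomp u t)) X = lcomp (lvcomp (G2 u) (G2 t)) X"
      using m(2) unfolding m(1) lcomp_lvcomp[OF t.lambda_trans_G2 t.C.sub_in[OF m(2)]]
      by (simp add: 1 2)
  qed simp_all
qed

lemma G2_nhcomp:
  assumes "lc_nat_trans C D t" "lc_nat_trans D E u"
  shows "G2 (nhcomp u t) = lhcomp (G2 u) (G2 t)"
proof -
  interpret t: lc_nat_trans C D t by fact
  interpret u: lc_nat_trans D E u by fact
  interpret v: lc_nat_trans C E "nhcomp u t"
    by (intro lc_nat_transI nat_trans_nhcomp[OF t.nat_trans_axioms u.nat_trans_axioms] t.C.lc u.D.lc)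
  show ?thesis
  proof (rule ltrans_eqI[OF v.lambda_trans_G2 lambda_trans_lhcomp[OF t.lambda_trans_G2 u.lambda_trans_G2]])
    fix X assume "X \<in> Obj (G0 C)"
    then obtain m where m: "X = sub C m" "m \<in> Arr C" by (rule t.C.G0_objE)
    \<comment> \<open>The horizontal composite uses the component of \<open>G2 u\<close> at the
      class of \<open>t.w m\<close>. Naturality of \<open>u\<close> at the component of
      \<open>t\<close> identifies its right leg with the one for \<open>nhcomp u t\<close>.\<close>
    have "u.w (t.w m) = v.w m"
      using m(2) u.naturality[of "ncomp t (Dom C m)"] by (simp add: u.w_def v.w_def t.w_def)
    then show "lcomp (G2 (nhcomp u t)) X = lcomp (lhcomp (G2 u) (G2 t)) X"
      using m(2) unfolding m(1) lcomp_lhcomp[OF t.lambda_trans_G2 u.lambda_trans_G2 t.C.sub_in[OF m(2)]]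
      by simp
  qed (simp_all add: G1_comp_func[OF t.S.lc_functor_axioms u.S.lc_functor_axioms]
      G1_comp_func[OF t.T.lc_functor_axioms u.T.lc_functor_axioms])
qed

section \<open>The 2-functors between \<open>lcCat\<close> and \<open>oGpd_max\<close>\<close>

lemma lcCat_simps [simp]:
  "C \<in> Obj0 lcCat \<longleftrightarrow> category C \<and> left_cancellative C"
  "F \<in> Mor1 lcCat \<longleftrightarrow> is_functor F \<and> left_cancellative (fdom F) \<and> left_cancellative (fcod F)"
  "t \<in> Cell2 lcCat \<longleftrightarrow> natural_transformation t \<and> left_cancellative (fdom (nsrc t)) \<and>
     left_cancellative (fcod (nsrc t))"
  "src1 lcCat = fdom" "trg1 lcCat = fcod" "src2 lcCat = nsrc" "trg2 lcCat = ntrg"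
  "id1 lcCat = id_func" "comp1 lcCat = comp_func" "id2 lcCat = nid" "vcomp lcCat = nvcomp" "hcomp lcCat = nhcomp"
  by (simp_all add: lcCat_def full_sub_def)

lemma oGpd_max_simps [simp]:
  "G \<in> Obj0 oGpd_max \<longleftrightarrow> ordered_groupoid G \<and> has_unique_maximal G"
  "F \<in> Mor1 oGpd_max \<longleftrightarrow> double_functor F \<and> has_unique_maximal (fdom F) \<and> has_unique_maximal (fcod F)"
  "t \<in> Cell2 oGpd_max \<longleftrightarrow> lambda_transformation t \<and> has_unique_maximal (fdom (lsrc t)) \<and>
     has_unique_maximal (fcod (lsrc t))"
  "src1 oGpd_max = fdom" "trg1 oGpd_max = fcod" "src2 oGpd_max = lsrc" "trg2 oGpd_max = ltrg"
  "id1 oGpd_max = id_func" "comp1 oGpd_max = comp_func" "id2 oGpd_max = lid" "vcomp oGpd_max = lvcomp"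
  "hcomp oGpd_max = lhcomp"
  by (simp_all add: oGpd_max_def full_sub_def)

lemma lcCat_Mor1E:
  assumes "F \<in> Mor1 lcCat" obtains C D where "lc_functor C D F"
  using assms lc_functorI[OF functor_between_self] by auto

lemma lcCat_Cell2E:
  assumes "t \<in> Cell2 lcCat" obtains C D where "lc_nat_trans C D t"
proof -
  obtain C D where t: "nat_trans C D t" using assms by (auto simp: natural_transformation_iff)
  show thesis by (rule that[OF lc_nat_transI[OF t]]) (use assms nat_transD[OF t] in simp_all)
qed

lemma lc_functorD:
  "lc_functor C D F \<Longrightarrow> fdom F = C" "lc_functor C D F \<Longrightarrow> fcod F = D"
  by (simp_all add: lc_functor_def functor_between_def)

lemma lc_nat_transD:
  "lc_nat_trans C D t \<Longrightarrow> fdom (nsrc t) = C" "lc_nat_trans C D t \<Longrightarrow> fcod (nsrc t) = D"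
  "lc_nat_trans C D t \<Longrightarrow> fdom (ntrg t) = C" "lc_nat_trans C D t \<Longrightarrow> fcod (ntrg t) = D"
  using nat_transD[of C D t] by (simp_all add: lc_nat_trans_def functor_between_def)

lemma two_functor_L_max: "two_functor oGpd_max lcCat Lfun"
  unfolding oGpd_max_def lcCat_def
  by (rule two_functor_full_sub[OF two_functor_L]) (simp add: Lfun_def left_cancellative_L0)

lemma two_functor_G: "two_functor lcCat oGpd_max Gfun"
proof (intro two_functor.intro two_functor_axioms.intro)
  \<comment> \<open>Both 2-category structures are already contained in the statement that
    \<open>L\<close> is a 2-functor.\<close>
  show "two_category (lcCat :: 'a Cat2)" "two_category (oGpd_max :: 'a oGpd2)"
    using two_functor_L_max[where 'a = 'a] by (simp_all add: two_functor_def)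
  note [simp] = Gfun_def hom1_def hom2_def
  fix C :: "'a cat" assume "C \<in> Obj0 lcCat"
  then interpret C: lc_category C by (simp add: lc_categoryI)
  show "map0 Gfun C \<in> Obj0 oGpd_max"
    by (simp add: C.ordered_groupoid_G0 C.has_unique_maximal_G0)
  show "map1 Gfun (id1 lcCat C) = id1 oGpd_max (map0 Gfun C)"
    by (simp add: G1_id_func C.lc_category_axioms)
next
  note [simp] = Gfun_def hom1_def hom2_def
  fix F :: "('a, 'a cat) func" assume "F \<in> Mor1 lcCat"
  then obtain C D where F: "lc_functor C D F" by (rule lcCat_Mor1E)
  then interpret F: lc_functor C D F .
  show "map1 Gfun F \<in> hom1 oGpd_max (map0 Gfun (src1 lcCat F)) (map0 Gfun (trg1 lcCat F))"
    using ordered_functor_double[OF F.ordered_functor_G1] F.C.has_unique_maximal_G0 F.D.has_unique_maximal_G0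
    by (simp add: G1_def)
  show "map2 Gfun (id2 lcCat F) = id2 oGpd_max (map1 Gfun F)" using G2_nid[OF F] by simp
  fix H :: "('a, 'a cat) func" assume "H \<in> Mor1 lcCat" "trg1 lcCat F = src1 lcCat H"
  then obtain E where "lc_functor D E H" by (metis lcCat_Mor1E lc_functorD lcCat_simps(4,5) F.fcod)
  then show "map1 Gfun (comp1 lcCat H F) = comp1 oGpd_max (map1 Gfun H) (map1 Gfun F)"
    using G1_comp_func[OF F] by simp
next
  note [simp] = Gfun_def hom1_def hom2_def
  fix t :: "'a ntrans" assume "t \<in> Cell2 lcCat"
  then obtain C D where t: "lc_nat_trans C D t" by (rule lcCat_Cell2E)
  then interpret t: lc_nat_trans C D t .
  show "map2 Gfun t \<in> hom2 oGpd_max (map1 Gfun (src2 lcCat t)) (map1 Gfun (trg2 lcCat t))"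
    using t.lambda_trans_G2 t.C.has_unique_maximal_G0 t.D.has_unique_maximal_G0
    by (auto simp: lambda_transformation_iff G1_def)
  fix u :: "'a ntrans" assume u: "u \<in> Cell2 lcCat"
  then obtain E E' where u: "lc_nat_trans E E' u" by (rule lcCat_Cell2E)
  show "map2 Gfun (vcomp lcCat u t) = vcomp oGpd_max (map2 Gfun u) (map2 Gfun t)"
    if "trg2 lcCat t = src2 lcCat u"
    using G2_nvcomp[OF t] u that lc_nat_transD[OF u] lc_nat_transD[OF t] by simp
  show "map2 Gfun (hcomp lcCat u t) = hcomp oGpd_max (map2 Gfun u) (map2 Gfun t)"
    if "trg0 lcCat t = src0 lcCat u"
    using G2_nhcomp[OF t] u that lc_nat_transD[OF u] lc_nat_transD[OF t] by simp
qed

section \<open>The 2-adjunction\<close>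

lemma two_functor_id: "two_category K \<Longrightarrow> two_functor K K id_two_fun"
  by (intro two_functor.intro two_functor_axioms.intro)
    (auto simp: id_two_fun_def hom1_def hom2_def two_category.trg2[unfolded hom1_def])

lemma two_functor_comp:
  assumes "two_functor A B T" "two_functor B C S"
  shows "two_functor A C (comp_two_fun S T)"
proof -
  interpret T: two_functor A B T by fact
  interpret S: two_functor B C S by fact
  have T1: "map1 T f \<in> Mor1 B" "src1 B (map1 T f) = map0 T (src1 A f)" "trg1 B (map1 T f) = map0 T (trg1 A f)"
    if "f \<in> Mor1 A" for f
    using T.map1[OF that] by (simp_all add: hom1_def)
  have T2: "map2 T a \<in> Cell2 B" "src2 B (map2 T a) = map1 T (src2 A a)" "trg2 B (map2 T a) = map1 T (trg2 A a)"
    if "a \<in> Cell2 A" for a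
    using T.map2[OF that] by (simp_all add: hom2_def)
  have S1: "map1 S f \<in> Mor1 C" "src1 C (map1 S f) = map0 S (src1 B f)" "trg1 C (map1 S f) = map0 S (trg1 B f)"
    if "f \<in> Mor1 B" for f
    using S.map1[OF that] by (simp_all add: hom1_def)
  have S2: "map2 S a \<in> Cell2 C" "src2 C (map2 S a) = map1 S (src2 B a)" "trg2 C (map2 S a) = map1 S (trg2 B a)"
    if "a \<in> Cell2 B" for a
    using S.map2[OF that] by (simp_all add: hom2_def)
  show ?thesis
    by (intro two_functor.intro two_functor_axioms.intro T.A.two_category_axioms S.B.two_category_axioms)
      (simp_all add: comp_two_fun_def hom1_def hom2_def T1 T2 S1 S2 T.map0 S.map0 T.A.src2 T.map1_id1 S.map1_id1
        T.map1_comp1 S.map1_comp1 T.map2_id2 S.map2_id2 T.map2_vcomp S.map2_vcomp T.map2_hcomp S.map2_hcomp)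
qed

section \<open>The unit\<close>

definition eta :: "'u::infinite cat \<Rightarrow> ('u, 'u cat) func" where
  "eta C = \<lparr>fdom = C, fcod = L0 (G0 C), omap = (\<lambda>A \<in> Obj C. sub C (Ident C A)),
     amap = (\<lambda>f \<in> Arr C. pair (span C (Ident C (Dom C f)) f, sub C (Ident C (Cod C f))))\<rparr>"

lemma eta_simps [simp]:
  "fdom (eta C) = C" "fcod (eta C) = L0 (G0 C)"
  "A \<in> Obj C \<Longrightarrow> omap (eta C) A = sub C (Ident C A)"
  "f \<in> Arr C \<Longrightarrow> amap (eta C) f = pair (span C (Ident C (Dom C f)) f, sub C (Ident C (Cod C f)))"
  by (simp_all add: eta_def)

context lc_category
begin

lemma obj_le_sub_Ident [simp]:
  assumes "f \<in> Arr C" "B = Cod C f"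
  shows "obj_le (G0 C) (sub C f) (sub C (Ident C B))"
proof -
  have "obj_le (G0 C) (sub C (Ident C B \<cdot> f)) (sub C (Ident C B))"
    by (rule obj_le_G0I) (use assms in simp_all)
  then show ?thesis using assms by simp
qed

text \<open>This makes the unit functorial: \<open>[1, g]\<close> restricted to \<open>[f]\<close>
  is \<open>[f, g f]\<close>, whose composite with \<open>[1, f]\<close> is
  \<open>[1, g f]\<close>.\<close>

lemma restr_span_Ident [simp]:
  assumes "f \<in> Arr C" "g \<in> Arr C" "B = Cod C f" "Dom C g = B"
  shows "restr (G0 C) (span C (Ident C B) g) (sub C f) = span C f (g \<cdot> f)"
proof -
  have "restr (G0 C) (span C (Ident C B) g) (sub C (Ident C B \<cdot> f)) = span C (Ident C B \<cdot> f) (g \<cdot> f)"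
    by (rule restr_G0) (use assms in simp_all)
  then show ?thesis using assms by simp
qed

lemma lc_functor_eta: "lc_functor C (L0 (G0 C)) (eta C)"
proof -
  have "functor_between C (L0 (G0 C)) (eta C)"
    by (rule functor_betweenI)
      (auto simp: category_axioms category_L0 ordered_groupoid_G0 eta_def)
  then show ?thesis
    by (intro lc_functorI lc left_cancellative_L0 ordered_groupoid_G0)
qed

end

section \<open>The counit\<close>

definition hor :: "'u::infinite \<Rightarrow> 'u" where "hor x = fst (unpair x)"

lemma hor_pair [simp]: "hor (pair (h, B)) = h"
  by (simp add: hor_def)

text \<open>A span is evaluated on horizontal parts, back along the left leg and out along the right
  one; the inequalities of the legs are forgotten. The formulas act on the stored representatives,
  and \<open>omap_eps\<close> and \<open>amap_eps\<close> extend them to arbitrary legs.\<close>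

definition eps :: "'u::infinite ogpd \<Rightarrow> 'u ofunc" where
  "eps G = \<lparr>fdom = G0 (L0 G), fcod = G, omap = (\<lambda>X \<in> Obj (G0 (L0 G)). Cod G (hor X)),
     amap = (\<lambda>x \<in> Arr (G0 (L0 G)). let (m, n) = unpair x in hor n \<cdot>\<^bsub>G\<^esub> inv_arrow G (hor m))\<rparr>"

lemma eps_simps [simp]: "fdom (eps G) = G0 (L0 G)" "fcod (eps G) = G"
  by (simp_all add: eps_def)

locale infinite_ordered_groupoid = ordered_groupoid G for G :: "'u::infinite ogpd" (structure)
begin

sublocale L: lc_category "L0 G"
  by (rule lc_category_L0) (rule ordered_groupoid_axioms)

lemma hor_simps [simp]:
  assumes "m \<in> Arr (L0 G)"
  shows "hor m \<in> Arr G" "Dom G (hor m) = Dom (L0 G) m" "obj_le G (Cod G (hor m)) (Cod (L0 G) m)"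
    "pair (hor m, Cod (L0 G) m) = m"
  using assms by (auto elim!: L_arrE)

lemma hor_Comp [simp]:
  assumes "m \<in> Arr (L0 G)" "n \<in> Arr (L0 G)" "Dom (L0 G) n = Cod (L0 G) m"
  shows "hor (n \<cdot>\<^bsub>L0 G\<^esub> m) = restr G (hor n) (Cod G (hor m)) \<cdot> hor m"
  using assms by (auto elim!: L_arrE)

lemma hor_Ident [simp]: "A \<in> Obj G \<Longrightarrow> hor (Ident (L0 G) A) = Ident G A"
  by simp

text \<open>Composing with an inverse shows that \<open>Cod (L0 G) m\<close> is the codomain of a
  restriction of \<open>hor m\<close>, hence lies below the codomain of \<open>hor m\<close>. The
  other inequality belongs to every arrow of \<open>L0 G\<close>.\<close>

lemma Cod_hor_iso:
  assumes "iso (L0 G) m" shows "Cod G (hor m) = Cod (L0 G) m"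
proof -
  obtain n where n: "m \<in> Arr (L0 G)" "n \<in> Arr (L0 G)" "Dom (L0 G) n = Cod (L0 G) m"
    "Cod (L0 G) n = Dom (L0 G) m" "m \<cdot>\<^bsub>L0 G\<^esub> n = Ident (L0 G) (Cod (L0 G) m)"
    using L.isoE[OF assms] by metis
  have le: "obj_le G (Cod G (hor n)) (Dom G (hor m))" using n hor_simps(3)[OF n(2)] by simp
  have "hor (m \<cdot>\<^bsub>L0 G\<^esub> n) = Ident G (Cod (L0 G) m)"
    using n(1) unfolding n(5) by (subst hor_Ident) (auto dest: L.Cod_in)
  then have "restr G (hor m) (Cod G (hor n)) \<cdot> hor n = Ident G (Cod (L0 G) m)"
    using n(1-4) by simp
  then have "Cod G (restr G (hor m) (Cod G (hor n)) \<cdot> hor n) = Cod (L0 G) m"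
    using n(1) L.Cod_in[OF n(1)] by simp
  then have "Cod G (restr G (hor m) (Cod G (hor n))) = Cod (L0 G) m"
    using n(1,2) le by simp
  then have "obj_le G (Cod (L0 G) m) (Cod G (hor m))"
    using Cod_restr[OF _ le] n(1) by simp
  then show ?thesis using obj_le_antisym hor_simps(3)[OF n(1)] by blast
qed

lemma hor_Comp_iso:
  assumes "iso (L0 G) k" "m \<in> Arr (L0 G)" "Cod (L0 G) k = Dom (L0 G) m"
  shows "hor (m \<cdot>\<^bsub>L0 G\<^esub> k) = hor m \<cdot> hor k" "Cod G (hor k) = Dom (L0 G) m"
proof -
  show 1: "Cod G (hor k) = Dom (L0 G) m" using Cod_hor_iso[OF assms(1)] assms(3) by simp
  show "hor (m \<cdot>\<^bsub>L0 G\<^esub> k) = hor m \<cdot> hor k"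
    using L.iso_Arr[OF assms(1)] assms(2,3) 1 by simp
qed

lemma omap_eps [simp]:
  assumes "m \<in> Arr (L0 G)" shows "omap (eps G) (sub (L0 G) m) = Cod G (hor m)"
proof -
  obtain k where k: "iso (L0 G) k" "k \<in> Arr (L0 G)" "Cod (L0 G) k = Dom (L0 G) m" "sub (L0 G) m = m \<cdot>\<^bsub>L0 G\<^esub> k"
    using L.sub_rep[OF assms] .
  have "omap (eps G) (sub (L0 G) m) = Cod G (hor (m \<cdot>\<^bsub>L0 G\<^esub> k))"
    using L.sub_in[OF assms] k(4) by (simp add: eps_def)
  then show ?thesis using hor_Comp_iso[OF k(1) assms k(3)] k(2) assms by simp
qed

text \<open>Changing the representative composes both horizontal parts with the same
  \<open>hor k\<close>, unrestricted by \<open>hor_Comp_iso\<close>, and the two copies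
  cancel.\<close>

lemma amap_eps [simp]:
  assumes "m \<in> Arr (L0 G)" "n \<in> Arr (L0 G)" "Dom (L0 G) m = Dom (L0 G) n"
  shows "amap (eps G) (span (L0 G) m n) = hor n \<cdot> inv_arrow G (hor m)"
proof -
  obtain k where k: "iso (L0 G) k" "k \<in> Arr (L0 G)" "Cod (L0 G) k = Dom (L0 G) m"
    "span (L0 G) m n = pair (m \<cdot>\<^bsub>L0 G\<^esub> k, n \<cdot>\<^bsub>L0 G\<^esub> k)"
    using L.span_rep[OF assms] .
  have k': "Cod (L0 G) k = Dom (L0 G) n" using k(3) assms(3) by simp
  have "amap (eps G) (span (L0 G) m n) = hor (n \<cdot>\<^bsub>L0 G\<^esub> k) \<cdot> inv_arrow G (hor (m \<cdot>\<^bsub>L0 G\<^esub> k))"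
    using L.span_in[OF assms] k(4) by (simp add: eps_def)
  also have "\<dots> = hor n \<cdot> hor k \<cdot> inv_arrow G (hor m \<cdot> hor k)"
    using hor_Comp_iso[OF k(1) assms(1) k(3)] hor_Comp_iso[OF k(1) assms(2) k'] by simp
  also have "\<dots> = hor n \<cdot> inv_arrow G (hor m)"
    using hor_Comp_iso(2)[OF k(1) assms(1) k(3)] k(2) assms by simp
  finally show ?thesis .
qed

lemma ordered_functor_eps: "ordered_functor (G0 (L0 G)) G (eps G)"
proof (rule ordered_functorI)
  show "functor_between (G0 (L0 G)) G (eps G)"
  proof (rule functor_betweenI)
    show "omap (eps G) \<in> extensional (Obj (G0 (L0 G)))" "amap (eps G) \<in> extensional (Arr (G0 (L0 G)))"
      by (simp_all add: eps_def)
    fix x assume "x \<in> Arr (G0 (L0 G))"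
    then obtain k m where x: "x = span (L0 G) k m" "k \<in> Arr (L0 G)" "m \<in> Arr (L0 G)" "Dom (L0 G) k = Dom (L0 G) m"
      by (rule L.G0_arrE)
    then show "amap (eps G) x \<in> Arr G \<and> Dom G (amap (eps G) x) = omap (eps G) (Dom (G0 (L0 G)) x) \<and>
        Cod G (amap (eps G) x) = omap (eps G) (Cod (G0 (L0 G)) x)"
      by simp
    fix y assume "y \<in> Arr (G0 (L0 G))" "Dom (G0 (L0 G)) y = Cod (G0 (L0 G)) x"
    then obtain n where "y = span (L0 G) m n" "n \<in> Arr (L0 G)" "Dom (L0 G) n = Dom (L0 G) m"
      using x by (auto elim: L.G0_arr_DomE)
    then show "amap (eps G) (y \<cdot>\<^bsub>G0 (L0 G)\<^esub> x) = amap (eps G) y \<cdot> amap (eps G) x"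
      using x by simp
  next
    fix X assume "X \<in> Obj (G0 (L0 G))"
    then show "amap (eps G) (Ident (G0 (L0 G)) X) = Ident G (omap (eps G) X)"
      by (auto elim!: L.G0_objE)
  qed (simp_all add: L.category_G0 category_axioms)
  fix x y assume "(x, y) \<in> Le (G0 (L0 G))"
  then obtain m n h where x: "y = span (L0 G) m n" "x = span (L0 G) (m \<cdot>\<^bsub>L0 G\<^esub> h) (n \<cdot>\<^bsub>L0 G\<^esub> h)"
    "m \<in> Arr (L0 G)" "n \<in> Arr (L0 G)" "h \<in> Arr (L0 G)" "Dom (L0 G) m = Dom (L0 G) n" "Cod (L0 G) h = Dom (L0 G) n"
    by (rule L.Le_G0E)
  have c: "obj_le G (Cod G (hor h)) (Dom (L0 G) n)" using hor_simps(3)[OF x(5)] x(7) by simp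
  \<comment> \<open>Precomposition with \<open>h\<close> restricts the horizontal parts of both legs
    to the codomain of \<open>hor h\<close> and then composes them with \<open>hor h\<close>, which
    cancels. Monotonicity of inversion and composition remains.\<close>
  have "amap (eps G) x = restr G (hor n) (Cod G (hor h)) \<cdot> inv_arrow G (restr G (hor m) (Cod G (hor h)))"
    using x c by simp
  moreover have "amap (eps G) y = hor n \<cdot> inv_arrow G (hor m)" using x by simp
  ultimately show "(amap (eps G) x, amap (eps G) y) \<in> Le G"
    using x(3-6) c by (simp add: Le_Comp' Le_inv)
qed (simp_all add: L.ordered_groupoid_G0 ordered_groupoid_axioms)

end

section \<open>Strict naturality and the triangle identities\<close>

lemma hor_amap_L1:
  assumes "ordered_functor C D F" "m \<in> Arr (L0 C)" shows "hor (amap (L1 F) m) = amap F (hor m)"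
proof -
  interpret ordered_functor C D F by fact
  show ?thesis using assms(2) by (auto elim!: L_arrE)
qed

lemma eps_natural1:
  assumes F: "ordered_functor C D F"
  shows "comp_func F (eps C) = comp_func (eps D) (G1 (L1 F))"
proof -
  interpret F: ordered_functor C D F by fact
  interpret C: infinite_ordered_groupoid C by (intro infinite_ordered_groupoid.intro F.C.ordered_groupoid_axioms)
  interpret D: infinite_ordered_groupoid D by (intro infinite_ordered_groupoid.intro F.D.ordered_groupoid_axioms)
  interpret L: lc_functor "L0 C" "L0 D" "L1 F"
    by (intro lc_functorI functor_between_L1 F C.L.lc D.L.lc)
  note LF = L.ordered_functor_G1
  have [simp]: "fdom (G1 (L1 F)) = G0 (L0 C)" using ordered_functorD(2)[OF LF] .
  show ?thesis
  proof (rule func_eqI)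
    show "functor_between (G0 (L0 C)) D (comp_func F (eps C))"
      "functor_between (G0 (L0 C)) D (comp_func (eps D) (G1 (L1 F)))"
      by (blast intro: ordered_functorD(1) ordered_functor_comp F LF C.ordered_functor_eps D.ordered_functor_eps)+
    fix x assume "x \<in> Arr (G0 (L0 C))"
    then obtain m n where "x = span (L0 C) m n" "m \<in> Arr (L0 C)" "n \<in> Arr (L0 C)" "Dom (L0 C) m = Dom (L0 C) n"
      by (rule C.L.G0_arrE)
    then show "amap (comp_func F (eps C)) x = amap (comp_func (eps D) (G1 (L1 F))) x"
      by (simp add: hor_amap_L1[OF F])
  qed
qed

lemma eps_natural2:
  assumes t: "lambda_trans C D t"
  shows "lhcomp t (lid (eps C)) = lhcomp (lid (eps D)) (G2 (L2 t))"
proof -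
  interpret t: lambda_trans C D t by fact
  interpret C: infinite_ordered_groupoid C by (intro infinite_ordered_groupoid.intro t.S.C.ordered_groupoid_axioms)
  interpret D: infinite_ordered_groupoid D by (intro infinite_ordered_groupoid.intro t.S.D.ordered_groupoid_axioms)
  interpret L: lc_nat_trans "L0 C" "L0 D" "L2 t"
    by (intro lc_nat_transI nat_trans_L2 t C.L.lc D.L.lc)
  note eC = lambda_trans_lid[OF C.ordered_functor_eps] and eD = lambda_trans_lid[OF D.ordered_functor_eps]
  show ?thesis
  proof (rule ltrans_eqI[OF lambda_trans_lhcomp[OF eC t] lambda_trans_lhcomp[OF L.lambda_trans_G2 eD]])
    fix X assume X: "X \<in> Obj (G0 (L0 C))"
    then obtain m where m: "X = sub (L0 C) m" "m \<in> Arr (L0 C)" by (rule C.L.G0_objE)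
    then obtain h B where h: "m = pair (h, B)" "h \<in> Arr C" "obj_le C (Cod C h) B" by (auto elim: L_arrE)
    \<comment> \<open>This is the left side of the naturality square of \<open>t\<close> at
      \<open>h\<close>. Once it is replaced by the right side, the counit's factor inverse to
      \<open>amap (lsrc t) h\<close> cancels, leaving \<open>lcomp t (Cod C h)\<close>.\<close>
    have "hor (L.w m) = restr D (amap (ltrg t) h) (Cod D (lcomp t (Dom C h))) \<cdot>\<^bsub>D\<^esub> lcomp t (Dom C h)"
      using h t.T.obj_le_omap[OF h(3)] by (simp add: L.w_def)
    then have w: "hor (L.w m) = lcomp t (Cod C h) \<cdot>\<^bsub>D\<^esub> amap (lsrc t) h" using t.naturality[OF h(2)] by simp
    have "lcomp (lhcomp t (lid (eps C))) X = lcomp t (Cod C h)"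
      unfolding lcomp_lhcomp[OF eC t X] using X m h by simp
    moreover have "lcomp (lhcomp (lid (eps D)) (G2 (L2 t))) X = hor (L.w m) \<cdot>\<^bsub>D\<^esub> inv_arrow D (hor (amap (L1 (lsrc t)) m))"
    proof -
      have 1: "lcomp (G2 (L2 t)) X = span (L0 D) (amap (L1 (lsrc t)) m) (L.w m)" using m by simp
      have 2: "amap (L1 (lsrc t)) m \<in> Arr (L0 D)" "L.w m \<in> Arr (L0 D)"
        "Dom (L0 D) (amap (L1 (lsrc t)) m) = Dom (L0 D) (L.w m)"
        using m(2) L.S.amap_simps[of m] by simp_all
      show ?thesis
        unfolding lcomp_lhcomp[OF L.lambda_trans_G2 eD X] 1 using 2 by simp
    qed
    moreover have "hor (amap (L1 (lsrc t)) m) = amap (lsrc t) h"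
      using h m by (simp add: hor_amap_L1[OF lambda_transD(1)[OF t]])
    ultimately show "lcomp (lhcomp t (lid (eps C))) X = lcomp (lhcomp (lid (eps D)) (G2 (L2 t))) X"
      using h(2) w by simp
  qed (simp_all add: eps_natural1[OF lambda_transD(1)[OF t]] eps_natural1[OF lambda_transD(2)[OF t]])
qed

lemma eta_natural1:
  assumes F: "lc_functor C D F"
  shows "comp_func (L1 (G1 F)) (eta C) = comp_func (eta D) F"
proof -
  interpret F: lc_functor C D F by fact
  note GF = F.ordered_functor_G1
  have [simp]: "fdom (G1 F) = G0 C" using ordered_functorD(2)[OF GF] .
  show ?thesis
  proof (rule func_eqI)
    show "functor_between C (L0 (G0 D)) (comp_func (L1 (G1 F)) (eta C))"
      "functor_between C (L0 (G0 D)) (comp_func (eta D) F)"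
      using F.C.lc_functor_eta F.D.lc_functor_eta functor_between_L1[OF GF] F.functor_between_axioms
      by (auto simp: lc_functor_def intro: functor_between_comp)
  qed simp
qed

lemma eta_natural2:
  assumes t: "lc_nat_trans C D t"
  shows "nhcomp (L2 (G2 t)) (nid (eta C)) = nhcomp (nid (eta D)) t"
proof -
  interpret t: lc_nat_trans C D t by fact
  have [simp]: "fdom (G1 (nsrc t)) = G0 C" "fcod (G1 (nsrc t)) = G0 D"
    using ordered_functorD(2,3)[OF t.S.ordered_functor_G1] by simp_all
  note e = nat_trans_nid[OF lc_functor.axioms(1)[OF t.C.lc_functor_eta]]
    nat_trans_nid[OF lc_functor.axioms(1)[OF t.D.lc_functor_eta]]
  show ?thesis
  proof (rule ntrans_eqI[OF nat_trans_nhcomp[OF e(1) nat_trans_L2[OF t.lambda_trans_G2]]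
        nat_trans_nhcomp[OF t.nat_trans_axioms e(2)]])
    fix A assume A: "A \<in> Obj C"
    have "t.w (Ident C A) = ncomp t A" using A by (simp add: t.w_def)
    moreover have "obj_le (G0 D) (sub D (ncomp t A)) (sub D (Ident D (omap (ntrg t) A)))"
      using A by simp
    ultimately show "ncomp (nhcomp (L2 (G2 t)) (nid (eta C))) A = ncomp (nhcomp (nid (eta D)) t) A"
      using A by simp
  qed (simp_all add: eta_natural1[OF t.S.lc_functor_axioms] eta_natural1[OF t.T.lc_functor_axioms])
qed

text \<open>The unit sends the legs to \<open>[1, m]\<close> and \<open>[1, n]\<close>, and
  \<open>[1, n]\<close> after \<open>[m, 1]\<close>, the inverse of \<open>[1, m]\<close>, is
  \<open>[m, n]\<close>.\<close>

lemma triangle_G: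
  assumes "lc_category C" shows "comp_func (eps (G0 C)) (G1 (eta C)) = id_func (G0 C)"
proof -
  interpret lc_category C by fact
  interpret G: infinite_ordered_groupoid "G0 C" by (intro infinite_ordered_groupoid.intro ordered_groupoid_G0)
  interpret e: lc_functor C "L0 (G0 C)" "eta C" by (rule lc_functor_eta)
  note Ge = e.ordered_functor_G1
  have [simp]: "fdom (G1 (eta C)) = G0 C" using ordered_functorD(2)[OF Ge] .
  show ?thesis
  proof (rule func_eqI)
    show "functor_between (G0 C) (G0 C) (comp_func (eps (G0 C)) (G1 (eta C)))"
      by (blast intro: ordered_functorD(1) ordered_functor_comp Ge G.ordered_functor_eps)
    show "functor_between (G0 C) (G0 C) (id_func (G0 C))" by (rule functor_between_id[OF category_G0])
    fix x assume "x \<in> Arr (G0 C)"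
    then obtain m n where x: "x = span C m n" "m \<in> Arr C" "n \<in> Arr C" "Dom C m = Dom C n" by (rule G0_arrE)
    have "amap (eps (G0 C)) (span (L0 (G0 C)) (amap (eta C) m) (amap (eta C) n)) =
        hor (amap (eta C) n) \<cdot>\<^bsub>G0 C\<^esub> inv_arrow (G0 C) (hor (amap (eta C) m))"
      using x(2-4) e.amap_simps[of m] e.amap_simps[of n] by (intro G.amap_eps) simp_all
    also have "\<dots> = span C m n" using x(2-4) by simp
    finally show "amap (comp_func (eps (G0 C)) (G1 (eta C))) x = amap (id_func (G0 C)) x"
      using x e.amap_G1[of m n] by simp
  qed
qed

lemma triangle_L:
  assumes "ordered_groupoid G" shows "comp_func (L1 (eps G)) (eta (L0 G)) = id_func (L0 G)"
proof -
  interpret G: infinite_ordered_groupoid G by (intro infinite_ordered_groupoid.intro assms)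
  show ?thesis
  proof (rule func_eqI)
    show "functor_between (L0 G) (L0 G) (comp_func (L1 (eps G)) (eta (L0 G)))"
      using G.L.lc_functor_eta functor_between_L1[OF G.ordered_functor_eps]
      by (auto simp: lc_functor_def intro: functor_between_comp)
    show "functor_between (L0 G) (L0 G) (id_func (L0 G))" by (rule functor_between_id[OF G.L.category_axioms])
    fix x assume x: "x \<in> Arr (L0 G)"
    have d: "Dom (L0 G) x \<in> Obj G" "Cod (L0 G) x \<in> Obj G" using G.L.Dom_in[OF x] G.L.Cod_in[OF x] by simp_all
    \<comment> \<open>Identities of \<open>L0 G\<close> are kept folded, so that the rules for
      \<open>Ident (L0 G)\<close> still match. The left leg is an identity, so the counit returns
      \<open>hor x\<close>, and the second component restores the vertical part.\<close>
    have "amap (L1 (eps G)) (amap (eta (L0 G)) x) =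
        pair (amap (eps G) (span (L0 G) (Ident (L0 G) (Dom (L0 G) x)) x), omap (eps G) (sub (L0 G) (Ident (L0 G) (Cod (L0 G) x))))"
      using x d by (simp del: L0_simps(5))
    also have "\<dots> = x" using x d by (simp del: L0_simps(5) add: G.hor_Ident)
    finally show "amap (comp_func (L1 (eps G)) (eta (L0 G))) x = amap (id_func (L0 G)) x"
      using x by simp
  qed
qed

lemma two_adjunction_G_L: "two_adjunction lcCat oGpd_max Gfun Lfun eta eps"
proof -
  note two = two_functor_G two_functor_L_max
  have A: "two_category (lcCat :: 'a Cat2)" and B: "two_category (oGpd_max :: 'a oGpd2)"
    using two_functor_L_max[where 'a = 'a] by (simp_all add: two_functor_def)
  note [simp] = id_two_fun_def comp_two_fun_def Gfun_def Lfun_def hom1_def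
  show ?thesis
  proof (intro two_adjunction.intro two_natural.intro two_natural_axioms.intro two_adjunction_axioms.intro
      two two_functor_id[OF A] two_functor_id[OF B] two_functor_comp[OF two(1,2)] two_functor_comp[OF two(2,1)])
    fix C :: "'a cat" assume "C \<in> Obj0 lcCat"
    then interpret C: lc_category C by (simp add: lc_categoryI)
    show "eta C \<in> hom1 lcCat (map0 id_two_fun C) (map0 (comp_two_fun Lfun Gfun) C)"
      using functor_between.is_functor[OF lc_functor.axioms(1)[OF C.lc_functor_eta]] C.lc
        left_cancellative_L0[OF C.ordered_groupoid_G0] by simp
    show "comp1 oGpd_max (eps (map0 Gfun C)) (map1 Gfun (eta C)) = id1 oGpd_max (map0 Gfun C)"
      by (simp add: triangle_G C.lc_category_axioms)
  next
    fix F :: "('a, 'a cat) func" assume "F \<in> Mor1 lcCat"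
    then obtain C D where F: "lc_functor C D F" by (rule lcCat_Mor1E)
    then show "comp1 lcCat (map1 (comp_two_fun Lfun Gfun) F) (eta (src1 lcCat F)) =
        comp1 lcCat (eta (trg1 lcCat F)) (map1 id_two_fun F)"
      by (simp add: eta_natural1[OF F] lc_functorD[OF F])
  next
    fix t :: "'a ntrans" assume "t \<in> Cell2 lcCat"
    then obtain C D where t: "lc_nat_trans C D t" by (rule lcCat_Cell2E)
    then show "hcomp lcCat (map2 (comp_two_fun Lfun Gfun) t) (id2 lcCat (eta (src0 lcCat t))) =
        hcomp lcCat (id2 lcCat (eta (trg0 lcCat t))) (map2 id_two_fun t)"
      by (simp add: eta_natural2[OF t] lc_nat_transD[OF t])
  next
    fix G :: "'a ogpd" assume G: "G \<in> Obj0 oGpd_max"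
    then interpret G: infinite_ordered_groupoid G by (simp add: infinite_ordered_groupoid.intro)
    show "eps G \<in> hom1 oGpd_max (map0 (comp_two_fun Gfun Lfun) G) (map0 id_two_fun G)"
      using G ordered_functor_double[OF G.ordered_functor_eps] G.L.has_unique_maximal_G0 by simp
    show "comp1 lcCat (map1 Lfun (eps G)) (eta (map0 Lfun G)) = id1 lcCat (map0 Lfun G)"
      by (simp add: triangle_L G.ordered_groupoid_axioms)
  next
    fix F :: "'a ofunc" assume "F \<in> Mor1 oGpd_max"
    then obtain C D where F: "ordered_functor C D F" by (auto simp: double_functor_iff)
    then show "comp1 oGpd_max (map1 id_two_fun F) (eps (src1 oGpd_max F)) =
        comp1 oGpd_max (eps (trg1 oGpd_max F)) (map1 (comp_two_fun Gfun Lfun) F)"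
      by (simp add: eps_natural1[OF F] ordered_functorD[OF F])
  next
    fix t :: "'a ltrans" assume "t \<in> Cell2 oGpd_max"
    then obtain C D where t: "lambda_trans C D t" by (auto simp: lambda_transformation_iff)
    then show "hcomp oGpd_max (map2 id_two_fun t) (id2 oGpd_max (eps (src0 oGpd_max t))) =
        hcomp oGpd_max (id2 oGpd_max (eps (trg0 oGpd_max t))) (map2 (comp_two_fun Gfun Lfun) t)"
      by (simp add: eps_natural2[OF t] lambda_transD[OF t])
  qed
qed

section \<open>Unit and counit are equivalences\<close>

lemma isomorphic1I:
  assumes "a \<in> hom2 K f g" "b \<in> hom2 K g f" "vcomp K b a = id2 K f" "vcomp K a b = id2 K g"
  shows "isomorphic1 K f g"
  unfolding isomorphic1_def invertible2_def
  by (intro bexI[of _ a] conjI bexI[of _ b]) (use assms in \<open>auto simp: hom2_def\<close>)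

text \<open>Conjugating the naturality squares of \<open>t\<close> by the pointwise inverses shows
  that these inverses are natural too, so they form an inverse 2-cell.\<close>

lemma isomorphic1_lcCatI:
  assumes t: "lc_nat_trans C D t" and iso: "\<And>X. X \<in> Obj C \<Longrightarrow> iso D (ncomp t X)"
  shows "isomorphic1 lcCat (nsrc t) (ntrg t)"
proof -
  interpret t: lc_nat_trans C D t by fact
  have "\<forall>X \<in> Obj C. \<exists>g. inverse_arrows D (ncomp t X) g" using iso by (simp add: iso_def)
  from bchoice[OF this] obtain s where s: "\<And>X. X \<in> Obj C \<Longrightarrow> inverse_arrows D (ncomp t X) (s X)"
    by blast
  have s' [simp]: "s X \<in> Arr D" "Dom D (s X) = omap (ntrg t) X" "Cod D (s X) = omap (nsrc t) X"
    "s X \<cdot>\<^bsub>D\<^esub> ncomp t X = Ident D (omap (nsrc t) X)" "ncomp t X \<cdot>\<^bsub>D\<^esub> s X = Ident D (omap (ntrg t) X)"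
    if "X \<in> Obj C" for X
    using s[OF that] that by (simp_all add: inverse_arrows_def hom_def)
  define u where "u = \<lparr>nsrc = ntrg t, ntrg = nsrc t, ncomp = (\<lambda>X \<in> Obj C. s X)\<rparr>"
  have [simp]: "nsrc u = ntrg t" "ntrg u = nsrc t" "\<And>X. X \<in> Obj C \<Longrightarrow> ncomp u X = s X"
    by (simp_all add: u_def)
  have u: "nat_trans C D u"
  proof (rule nat_transI)
    fix f assume f: "f \<in> Arr C"
    have "amap (nsrc t) f \<cdot>\<^bsub>D\<^esub> s (Dom C f) =
      (s (Cod C f) \<cdot>\<^bsub>D\<^esub> ncomp t (Cod C f)) \<cdot>\<^bsub>D\<^esub> (amap (nsrc t) f \<cdot>\<^bsub>D\<^esub> s (Dom C f))"
      using f by (simp del: t.S.D.assoc)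
    also have "\<dots> = s (Cod C f) \<cdot>\<^bsub>D\<^esub> ((ncomp t (Cod C f) \<cdot>\<^bsub>D\<^esub> amap (nsrc t) f) \<cdot>\<^bsub>D\<^esub> s (Dom C f))"
      using f by (simp del: s'(4))
    also have "\<dots> = s (Cod C f) \<cdot>\<^bsub>D\<^esub> ((amap (ntrg t) f \<cdot>\<^bsub>D\<^esub> ncomp t (Dom C f)) \<cdot>\<^bsub>D\<^esub> s (Dom C f))"
      using t.naturality[OF f] by simp
    also have "\<dots> = s (Cod C f) \<cdot>\<^bsub>D\<^esub> amap (ntrg t) f" using f by simp
    finally show "amap (ntrg u) f \<cdot>\<^bsub>D\<^esub> ncomp u (Dom C f) = ncomp u (Cod C f) \<cdot>\<^bsub>D\<^esub> amap (nsrc u) f"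
      using f by simp
  qed (simp_all add: t.S.functor_between_axioms t.T.functor_between_axioms, simp add: u_def)
  have "nvcomp u t = nid (nsrc t)"
    by (rule ntrans_eqI[OF nat_trans_nvcomp[OF t.nat_trans_axioms u] nat_trans_nid[OF t.S.functor_between_axioms]]) simp_all
  moreover have "nvcomp t u = nid (ntrg t)"
    by (rule ntrans_eqI[OF nat_trans_nvcomp[OF u t.nat_trans_axioms] nat_trans_nid[OF t.T.functor_between_axioms]]) simp_all
  moreover have "natural_transformation t" "natural_transformation u"
    using u t.nat_trans_axioms by (auto simp: natural_transformation_iff)
  ultimately show ?thesis
    using t.C.lc t.D.lc by (intro isomorphic1I[of t _ _ _ u]) (simp_all add: hom2_def)
qed

text \<open>The classical criterion: fully faithful and essentially surjective. Objects
  \<open>r Y\<close> with isomorphisms \<open>e Y\<close> from their images to \<open>Y\<close> are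
  chosen, arrows are lifted by fullness, and every equation in \<open>C\<close> is checked after
  applying \<open>F\<close>.\<close>

lemma equivalence1_lcCatI:
  assumes F: "lc_functor C D F"
    and full: "\<And>A B g. \<lbrakk>A \<in> Obj C; B \<in> Obj C; g \<in> Arr D; Dom D g = omap F A; Cod D g = omap F B\<rbrakk>
      \<Longrightarrow> \<exists>f \<in> Arr C. Dom C f = A \<and> Cod C f = B \<and> amap F f = g"
    and faithful: "\<And>f f'. \<lbrakk>f \<in> Arr C; f' \<in> Arr C; Dom C f = Dom C f'; Cod C f = Cod C f';
      amap F f = amap F f'\<rbrakk> \<Longrightarrow> f = f'"
    and surj: "\<And>Y. Y \<in> Obj D \<Longrightarrow> \<exists>X \<in> Obj C. \<exists>e. iso D e \<and> Dom D e = omap F X \<and> Cod D e = Y"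
  shows "equivalence1 lcCat F"
proof -
  interpret F: lc_functor C D F by fact
  have "\<forall>Y \<in> Obj D. \<exists>X. X \<in> Obj C \<and> (\<exists>e. iso D e \<and> Dom D e = omap F X \<and> Cod D e = Y)"
    using surj by blast
  from bchoice[OF this] obtain r where r: "\<And>Y. Y \<in> Obj D \<Longrightarrow> r Y \<in> Obj C"
    and "\<forall>Y \<in> Obj D. \<exists>e. iso D e \<and> Dom D e = omap F (r Y) \<and> Cod D e = Y"
    by blast
  from bchoice[OF this(2)] obtain e where e: "\<And>Y. Y \<in> Obj D \<Longrightarrow> iso D (e Y)"
    "\<And>Y. Y \<in> Obj D \<Longrightarrow> Dom D (e Y) = omap F (r Y)" "\<And>Y. Y \<in> Obj D \<Longrightarrow> Cod D (e Y) = Y"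
    by blast
  have "\<forall>Y \<in> Obj D. \<exists>g. inverse_arrows D (e Y) g" using e(1) by (simp add: iso_def)
  from bchoice[OF this] obtain e' where e': "\<And>Y. Y \<in> Obj D \<Longrightarrow> inverse_arrows D (e Y) (e' Y)"
    by blast
  have r [simp]: "r Y \<in> Obj C" "iso D (e Y)" "e Y \<in> Arr D" "Dom D (e Y) = omap F (r Y)" "Cod D (e Y) = Y"
    "e' Y \<in> Arr D" "Dom D (e' Y) = Y" "Cod D (e' Y) = omap F (r Y)"
    "e' Y \<cdot>\<^bsub>D\<^esub> e Y = Ident D (omap F (r Y))" "e Y \<cdot>\<^bsub>D\<^esub> e' Y = Ident D Y" if "Y \<in> Obj D" for Y
    using r[OF that] e[OF that] e'[OF that] by (simp_all add: inverse_arrows_def hom_def)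
  have ee' [simp]: "e Y \<cdot>\<^bsub>D\<^esub> (e' Y \<cdot>\<^bsub>D\<^esub> g) = g" if "Y \<in> Obj D" "g \<in> Arr D" "Cod D g = Y" for Y g
    using that by (simp flip: F.D.assoc)
  define lift where "lift A B g = (SOME f. f \<in> Arr C \<and> Dom C f = A \<and> Cod C f = B \<and> amap F f = g)" for A B g
  have lift [simp]: "lift A B g \<in> Arr C" "Dom C (lift A B g) = A" "Cod C (lift A B g) = B" "amap F (lift A B g) = g"
    if "A \<in> Obj C" "B \<in> Obj C" "g \<in> Arr D" "Dom D g = omap F A" "Cod D g = omap F B" for A B g
    using someI_ex[of "\<lambda>f. f \<in> Arr C \<and> Dom C f = A \<and> Cod C f = B \<and> amap F f = g"] full[OF that]
    unfolding lift_def by blast+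
  \<comment> \<open>An arrow \<open>g\<close> is conjugated by the chosen isomorphisms so that it
    runs between images of \<open>F\<close>, and then lifted. With this choice \<open>e\<close> is
    natural from \<open>F\<close> after \<open>R\<close> to the identity.\<close>
  define R where "R = \<lparr>fdom = D, fcod = C, omap = (\<lambda>Y \<in> Obj D. r Y),
    amap = (\<lambda>g \<in> Arr D. lift (r (Dom D g)) (r (Cod D g)) (e' (Cod D g) \<cdot>\<^bsub>D\<^esub> (g \<cdot>\<^bsub>D\<^esub> e (Dom D g))))\<rparr>"
  have R_simps [simp]: "fdom R = D" "fcod R = C" "\<And>Y. Y \<in> Obj D \<Longrightarrow> omap R Y = r Y"
    "\<And>g. g \<in> Arr D \<Longrightarrow> amap R g =
       lift (r (Dom D g)) (r (Cod D g)) (e' (Cod D g) \<cdot>\<^bsub>D\<^esub> (g \<cdot>\<^bsub>D\<^esub> e (Dom D g)))"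
    by (simp_all add: R_def)
  have R: "functor_between D C R"
  proof (rule functor_betweenI)
    fix A assume A: "A \<in> Obj D"
    show "amap R (Ident D A) = Ident C (omap R A)" by (rule faithful) (use A in simp_all)
  next
    fix g f assume gf: "g \<in> Arr D" "f \<in> Arr D" "Dom D g = Cod D f"
    show "amap R (g \<cdot>\<^bsub>D\<^esub> f) = amap R g \<cdot>\<^bsub>C\<^esub> amap R f" by (rule faithful) (use gf in simp_all)
  qed (simp_all add: F.C.category_axioms F.D.category_axioms, simp_all add: R_def)
  note FR = functor_between_comp[OF R F.functor_between_axioms] and RF = functor_between_comp[OF F.functor_between_axioms R]
  note iC = functor_between_id[OF F.C.category_axioms] and iD = functor_between_id[OF F.D.category_axioms]
  define a where "a = \<lparr>nsrc = comp_func F R, ntrg = id_func D, ncomp = (\<lambda>Y \<in> Obj D. e Y)\<rparr>"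
  \<comment> \<open>The isomorphism \<open>e (omap F X)\<close> runs between images of objects of
    \<open>C\<close>, so it lifts to a component at \<open>X\<close>; the lift of its inverse is the
    inverse component.\<close>
  define b where "b = \<lparr>nsrc = comp_func R F, ntrg = id_func C,
    ncomp = (\<lambda>X \<in> Obj C. lift (r (omap F X)) X (e (omap F X)))\<rparr>"
  have a: "nat_trans D D a"
    by (rule nat_transI) (simp_all add: a_def FR iD)
  have b: "nat_trans C C b"
  proof (rule nat_transI)
    fix f assume f: "f \<in> Arr C"
    have "f \<cdot>\<^bsub>C\<^esub> lift (r (omap F (Dom C f))) (Dom C f) (e (omap F (Dom C f))) =
      lift (r (omap F (Cod C f))) (Cod C f) (e (omap F (Cod C f))) \<cdot>\<^bsub>C\<^esub> amap R (amap F f)"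
      by (rule faithful) (use f in simp_all)
    then show "amap (ntrg b) f \<cdot>\<^bsub>C\<^esub> ncomp b (Dom C f) = ncomp b (Cod C f) \<cdot>\<^bsub>C\<^esub> amap (nsrc b) f"
      using f by (simp add: b_def del: R_simps(4))
  qed (simp_all add: b_def RF iC)
  have "iso C (ncomp b X)" if X: "X \<in> Obj C" for X
  proof (rule F.C.isoI[of _ "lift X (r (omap F X)) (e' (omap F X))"])
    show "lift X (r (omap F X)) (e' (omap F X)) \<cdot>\<^bsub>C\<^esub> ncomp b X = Ident C (Dom C (ncomp b X))"
      "ncomp b X \<cdot>\<^bsub>C\<^esub> lift X (r (omap F X)) (e' (omap F X)) = Ident C (Cod C (ncomp b X))"
      by (rule faithful; use X in \<open>simp add: b_def\<close>)+
  qed (use X in \<open>simp_all add: b_def\<close>)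
  then have "isomorphic1 lcCat (nsrc b) (ntrg b)"
    using isomorphic1_lcCatI[OF lc_nat_transI[OF b F.C.lc F.C.lc]] by blast
  moreover have "isomorphic1 lcCat (nsrc a) (ntrg a)"
    by (rule isomorphic1_lcCatI[OF lc_nat_transI[OF a F.D.lc F.D.lc]]) (simp add: a_def)
  ultimately show ?thesis
    using functor_between.is_functor[OF R] F.is_functor F.C.lc F.D.lc
    by (auto simp: equivalence1_def hom1_def a_def b_def intro!: bexI[of _ R])
qed

lemma equivalence1_eta:
  assumes "lc_category C" shows "equivalence1 lcCat (eta C)"
proof -
  interpret lc_category C by fact
  interpret G: ordered_groupoid "G0 C" by (rule ordered_groupoid_G0)
  interpret L: lc_category "L0 (G0 C)" by (rule lc_category_L0) (rule ordered_groupoid_G0)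
  show ?thesis
  proof (rule equivalence1_lcCatI[OF lc_functor_eta])
    fix A B g assume AB: "A \<in> Obj C" "B \<in> Obj C" and "g \<in> Arr (L0 (G0 C))"
      and d: "Dom (L0 (G0 C)) g = omap (eta C) A" "Cod (L0 (G0 C)) g = omap (eta C) B"
    then obtain x Y where g: "g = pair (x, Y)" "x \<in> Arr (G0 C)" "obj_le (G0 C) (Cod (G0 C) x) Y" by (elim L_arrE)
    have Y: "Y = sub C (Ident C B)" and "Dom (G0 C) x = sub C (Ident C A)" using g d AB by simp_all
    then obtain n where n: "x = span C (Ident C A) n" "n \<in> Arr C" "Dom C n = A"
      using g(2) AB G0_arr_DomE[of x "Ident C A"] by auto
    \<comment> \<open>So far \<open>n\<close> starts at \<open>A\<close> but may end anywhere. Being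
      below the class of the identity on \<open>B\<close> forces its codomain to be
      \<open>B\<close>, and then \<open>n\<close> is the required preimage.\<close>
    then have "obj_le (G0 C) (sub C n) (sub C (Ident C B))" using g(3) Y AB by simp
    then obtain h where h: "h \<in> Arr C" "Cod C h = B" "sub C n = sub C (Ident C B \<cdot>\<^bsub>C\<^esub> h)"
      using AB obj_le_G0_iff[of "Ident C B"] by auto
    then have "sub C n = sub C h" using AB by simp
    then obtain j where j: "j \<in> Arr C" "Cod C j = Dom C h" "n = h \<cdot>\<^bsub>C\<^esub> j" using n(2) h(1) by (elim sub_eqE)
    then have "Cod C n = B" using h by simp
    then show "\<exists>f\<in>Arr C. Dom C f = A \<and> Cod C f = B \<and> amap (eta C) f = g"
      using n g Y by (intro bexI[of _ n]) simp_all
  next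
    fix f f' assume *: "f \<in> Arr C" "f' \<in> Arr C" "Dom C f = Dom C f'" "amap (eta C) f = amap (eta C) f'"
    then have "span C (Ident C (Dom C f)) f = span C (Ident C (Dom C f)) f'" by simp
    then show "f = f'" using * span_eq_right_iff[of "Ident C (Dom C f)" f f'] by auto
  next
    fix Y assume "Y \<in> Obj (L0 (G0 C))"
    then have "Y \<in> Obj (G0 C)" by simp
    then obtain m where m: "Y = sub C m" "m \<in> Arr C" by (rule G0_objE)
    define A where "A = Dom C m"
    have A: "A \<in> Obj C" "Dom C m = A" using m by (simp_all add: A_def)
    have "iso (L0 (G0 C)) (pair (span C (Ident C A) m, sub C m))"
      by (rule L.isoI[of _ "pair (span C m (Ident C A), sub C (Ident C A))"]) (use m(2) A in simp_all)
    then show "\<exists>X\<in>Obj C. \<exists>e. iso (L0 (G0 C)) e \<and> Dom (L0 (G0 C)) e = omap (eta C) X \<and> Cod (L0 (G0 C)) e = Y"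
      using m A by (intro bexI[of _ A] exI[of _ "pair (span C (Ident C A) m, sub C m)"]) simp_all
  qed
qed

section \<open>The pseudo-inverse of the counit\<close>

locale max_ordered_groupoid = infinite_ordered_groupoid +
  assumes has_max: "has_unique_maximal G"
begin

definition max_above :: "'a \<Rightarrow> 'a" where "max_above A = (THE M. maximal_obj G M \<and> obj_le G A M)"

lemma max_above_simps:
  assumes "A \<in> Obj G" shows "maximal_obj G (max_above A)" "obj_le G A (max_above A)" "max_above A \<in> Obj G"
  using theI'[of "\<lambda>M. maximal_obj G M \<and> obj_le G A M"] has_max assms
  unfolding max_above_def has_unique_maximal_def maximal_obj_def by blast+

text \<open>The maximal object above \<open>B\<close> is also above \<open>A\<close>, and there is
  only one such object.\<close>

lemma max_above_eq:
  assumes "obj_le G A B" shows "max_above A = max_above B"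
proof -
  have A: "A \<in> Obj G" and B: "B \<in> Obj G" using obj_leD[OF assms] by auto
  have "\<exists>!M. maximal_obj G M \<and> obj_le G A M" using has_max A by (simp add: has_unique_maximal_def)
  then show ?thesis using max_above_simps(1,2)[OF A] max_above_simps(1,2)[OF B] obj_le_trans[OF assms] by blast
qed

text \<open>On subobjects this is the round trip through the counit: \<open>eps_inv\<close> after
  \<open>eps\<close> sends \<open>[m]\<close> to \<open>[to_max m]\<close>, so the comparison with
  the identity is made of spans with legs \<open>to_max m\<close> and \<open>m\<close>.\<close>

definition to_max :: "'a \<Rightarrow> 'a" where "to_max m = pair (hor m, max_above (Cod G (hor m)))"

lemma to_max_simps [simp]:
  assumes "m \<in> Arr (L0 G)"
  shows "to_max m \<in> Arr (L0 G)" "Dom (L0 G) (to_max m) = Dom (L0 G) m" "hor (to_max m) = hor m"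
  using assms by (simp_all add: to_max_def max_above_simps)

text \<open>The horizontal part of the composite ends below the codomain of \<open>hor m\<close>,
  hence under the same maximal object. Compatibility with isomorphisms and with the order of
  subobjects follows from this one rule.\<close>

lemma to_max_Comp [simp]:
  assumes "m \<in> Arr (L0 G)" "k \<in> Arr (L0 G)" "Dom (L0 G) m = Cod (L0 G) k"
  shows "to_max (m \<cdot>\<^bsub>L0 G\<^esub> k) = to_max m \<cdot>\<^bsub>L0 G\<^esub> k"
proof -
  obtain h B where k: "k = pair (h, B)" "h \<in> Arr G" "obj_le G (Cod G h) B" using assms(2) by (rule L_arrE)
  obtain l E where m: "m = pair (l, E)" "l \<in> Arr G" "obj_le G (Cod G l) E" using assms(1) by (rule L_arrE)
  have B: "Dom G l = B" using assms(3) k m by simp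
  have "max_above (Cod G (restr G l (Cod G h))) = max_above (Cod G l)"
    by (rule max_above_eq[OF Cod_restr]) (use k m B in simp_all)
  then show ?thesis using k m B max_above_simps(2)[of "Cod G l"] by (simp add: to_max_def)
qed

text \<open>
  The pseudo-inverse of the counit sends \<open>A\<close> to the class of the inclusion of \<open>A\<close> into the maximal
  object above it.
\<close>

definition eps_inv :: "'a ofunc" where
  "eps_inv = \<lparr>fdom = G, fcod = G0 (L0 G),
     omap = (\<lambda>A \<in> Obj G. sub (L0 G) (to_max (pair (Ident G A, A)))),
     amap = (\<lambda>h \<in> Arr G. span (L0 G) (to_max (pair (Ident G (Dom G h), Dom G h))) (to_max (pair (h, Cod G h))))\<rparr>"

lemma eps_inv_simps [simp]:
  "fdom eps_inv = G" "fcod eps_inv = G0 (L0 G)"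
  "A \<in> Obj G \<Longrightarrow> omap eps_inv A = sub (L0 G) (to_max (pair (Ident G A, A)))"
  "h \<in> Arr G \<Longrightarrow> amap eps_inv h =
     span (L0 G) (to_max (pair (Ident G (Dom G h), Dom G h))) (to_max (pair (h, Cod G h)))"
  by (simp_all add: eps_inv_def)

lemma iso_pair: "h \<in> Arr G \<Longrightarrow> iso (L0 G) (pair (h, Cod G h))"
  by (rule L.isoI[of _ "pair (inv_arrow G h, Dom G h)"]) simp_all

text \<open>The legs of the value of \<open>eps_inv\<close> are precomposed with the isomorphism
  \<open>pair (h, Cod G h)\<close>, where \<open>h\<close> is \<open>hor m\<close>. It turns the
  identity leg into \<open>to_max m\<close> and, cancelling the inverse of \<open>h\<close>, the
  other leg into \<open>to_max n\<close>.\<close>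

lemma eps_inv_span:
  assumes "m \<in> Arr (L0 G)" "n \<in> Arr (L0 G)" "Dom (L0 G) m = Dom (L0 G) n"
  shows "amap eps_inv (hor n \<cdot> inv_arrow G (hor m)) = span (L0 G) (to_max m) (to_max n)"
proof -
  obtain h B where m: "m = pair (h, B)" "h \<in> Arr G" "obj_le G (Cod G h) B" using assms(1) by (rule L_arrE)
  obtain k E where n: "n = pair (k, E)" "k \<in> Arr G" "obj_le G (Cod G k) E" using assms(2) by (rule L_arrE)
  have D: "Dom G k = Dom G h" using assms(3) m n by simp
  have e: "to_max (pair (Ident G (Cod G h), Cod G h)) \<cdot>\<^bsub>L0 G\<^esub> pair (h, Cod G h) = to_max m"
    "to_max (pair (k \<cdot> inv_arrow G h, Cod G k)) \<cdot>\<^bsub>L0 G\<^esub> pair (h, Cod G h) = to_max n"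
    using m n D by (simp_all add: to_max_def max_above_simps)
  have "amap eps_inv (hor n \<cdot> inv_arrow G (hor m)) =
      span (L0 G) (to_max (pair (Ident G (Cod G h), Cod G h))) (to_max (pair (k \<cdot> inv_arrow G h, Cod G k)))"
    using m n D by simp
  also have "\<dots> = span (L0 G) (to_max m) (to_max n)"
    unfolding e[symmetric]
    by (rule L.span_Comp_iso[OF iso_pair, symmetric]) (use m n D in simp_all)
  finally show ?thesis .
qed

lemma omap_eps_inv:
  assumes "m \<in> Arr (L0 G)" shows "omap eps_inv (Cod G (hor m)) = sub (L0 G) (to_max m)"
proof -
  have "Dom (G0 (L0 G)) (amap eps_inv (hor m \<cdot> inv_arrow G (hor m))) = sub (L0 G) (to_max m)"
    unfolding eps_inv_span[OF assms assms refl] using assms by simp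
  then show ?thesis using assms by simp
qed

lemma ordered_functor_eps_inv: "ordered_functor G (G0 (L0 G)) eps_inv"
proof (rule ordered_functorI)
  show "functor_between G (G0 (L0 G)) eps_inv"
  proof (rule functor_betweenI)
    fix h assume h: "h \<in> Arr G"
    then show "amap eps_inv h \<in> Arr (G0 (L0 G)) \<and> Dom (G0 (L0 G)) (amap eps_inv h) = omap eps_inv (Dom G h) \<and>
        Cod (G0 (L0 G)) (amap eps_inv h) = omap eps_inv (Cod G h)"
      using omap_eps_inv[of "pair (h, Cod G h)"] by simp
    fix g assume g: "g \<in> Arr G" "Dom G g = Cod G h"
    \<comment> \<open>Writing \<open>g\<close> as \<open>g \<cdot> h\<close> after the inverse of
      \<open>h\<close> gives its value a left leg equal to the right leg of the value at
      \<open>h\<close>, so the two spans compose directly.\<close>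
    have "amap eps_inv g = span (L0 G) (to_max (pair (h, Cod G h))) (to_max (pair (g \<cdot> h, Cod G g)))"
      using g h eps_inv_span[of "pair (h, Cod G h)" "pair (g \<cdot> h, Cod G g)"] by simp
    then show "amap eps_inv (g \<cdot> h) = amap eps_inv g \<cdot>\<^bsub>G0 (L0 G)\<^esub> amap eps_inv h"
      using g h by simp
  qed (simp_all add: L.category_G0 category_axioms, simp_all add: eps_inv_def)
  fix a b assume ab: "(a, b) \<in> Le G"
  have A: "a \<in> Arr G" "b \<in> Arr G" using Le_Arr ab by auto
  \<comment> \<open>\<open>j\<close> is the inequality between the domains, seen as an arrow of
    \<open>L0 G\<close>. Precomposition with it restricts the legs at \<open>b\<close> to those at
    \<open>a\<close>; the maximal targets agree by \<open>max_above_eq\<close>.\<close>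
  define j where "j = pair (Ident G (Dom G a), Dom G b)"
  have j: "j \<in> Arr (L0 G)" "Cod (L0 G) j = Dom G b" using A Le_Dom[OF ab] by (simp_all add: j_def)
  have e: "to_max (pair (Ident G (Dom G b), Dom G b)) \<cdot>\<^bsub>L0 G\<^esub> j = to_max (pair (Ident G (Dom G a), Dom G a))"
    "to_max (pair (b, Cod G b)) \<cdot>\<^bsub>L0 G\<^esub> j = to_max (pair (a, Cod G a))"
    using A Le_Dom[OF ab] max_above_eq[OF Le_Dom[OF ab]] max_above_eq[OF Le_Cod[OF ab]] restr_eqI[OF ab]
    by (simp_all add: to_max_def j_def max_above_simps)
  have "(span (L0 G) (to_max (pair (Ident G (Dom G b), Dom G b)) \<cdot>\<^bsub>L0 G\<^esub> j) (to_max (pair (b, Cod G b)) \<cdot>\<^bsub>L0 G\<^esub> j),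
      amap eps_inv b) \<in> Le (G0 (L0 G))"
    using A j by (simp add: L.Le_G0I)
  then show "(amap eps_inv a, amap eps_inv b) \<in> Le (G0 (L0 G))" using A(1) by (simp add: e)
qed (simp_all add: ordered_groupoid_axioms L.ordered_groupoid_G0)

lemma eps_eps_inv: "comp_func (eps G) eps_inv = id_func G"
  by (rule func_eqI[OF ordered_functorD(1)[OF ordered_functor_comp[OF ordered_functor_eps_inv ordered_functor_eps]]
        functor_between_id[OF category_axioms]])
    simp

text \<open>Here \<open>lmid\<close> equals \<open>ltrg\<close>: the transformation is purely
  horizontal, so reversing its spans, as in \<open>sigma'\<close>, gives the inverse. The stored
  representative \<open>X\<close> serves as an arrow and directly supplies one leg.\<close>

definition sigma :: "'a ltrans" where
  "sigma = \<lparr>lsrc = comp_func eps_inv (eps G), ltrg = id_func (G0 (L0 G)), lmid = id_func (G0 (L0 G)),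
     lcomp = (\<lambda>X \<in> Obj (G0 (L0 G)). span (L0 G) (to_max X) X)\<rparr>"

definition sigma' :: "'a ltrans" where
  "sigma' = \<lparr>lsrc = id_func (G0 (L0 G)), ltrg = comp_func eps_inv (eps G), lmid = comp_func eps_inv (eps G),
     lcomp = (\<lambda>X \<in> Obj (G0 (L0 G)). span (L0 G) X (to_max X))\<rparr>"

lemma sigma_simps [simp]:
  "lsrc sigma = comp_func eps_inv (eps G)" "ltrg sigma = id_func (G0 (L0 G))"
  "lsrc sigma' = id_func (G0 (L0 G))" "ltrg sigma' = comp_func eps_inv (eps G)"
  by (simp_all add: sigma_def sigma'_def)

lemma lcomp_sigma [simp]:
  assumes "m \<in> Arr (L0 G)"
  shows "lcomp sigma (sub (L0 G) m) = span (L0 G) (to_max m) m"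
    "lcomp sigma' (sub (L0 G) m) = span (L0 G) m (to_max m)"
proof -
  obtain k where k: "iso (L0 G) k" "k \<in> Arr (L0 G)" "Cod (L0 G) k = Dom (L0 G) m" "sub (L0 G) m = m \<cdot>\<^bsub>L0 G\<^esub> k"
    using L.sub_rep[OF assms] .
  show "lcomp sigma (sub (L0 G) m) = span (L0 G) (to_max m) m"
    "lcomp sigma' (sub (L0 G) m) = span (L0 G) m (to_max m)"
    using L.sub_in[OF assms] assms k by (simp_all add: sigma_def sigma'_def L.span_Comp_iso)
qed

lemma eps_inv_eps_simps [simp]:
  "m \<in> Arr (L0 G) \<Longrightarrow> omap (comp_func eps_inv (eps G)) (sub (L0 G) m) = sub (L0 G) (to_max m)"
  "\<lbrakk>m \<in> Arr (L0 G); n \<in> Arr (L0 G); Dom (L0 G) m = Dom (L0 G) n\<rbrakk>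
    \<Longrightarrow> amap (comp_func eps_inv (eps G)) (span (L0 G) m n) = span (L0 G) (to_max m) (to_max n)"
  by (simp_all add: omap_eps_inv eps_inv_span del: eps_inv_simps(3,4))

lemma lambda_trans_sigma: "lambda_trans (G0 (L0 G)) (G0 (L0 G)) sigma" "lambda_trans (G0 (L0 G)) (G0 (L0 G)) sigma'"
proof -
  note qe = ordered_functor_comp[OF ordered_functor_eps ordered_functor_eps_inv]
  interpret GL: ordered_groupoid "G0 (L0 G)" by (rule L.ordered_groupoid_G0)
  interpret QE: ordered_functor "G0 (L0 G)" "G0 (L0 G)" "comp_func eps_inv (eps G)" by (rule qe)
  note id = ordered_functor_id[OF L.ordered_groupoid_G0]
  interpret ID: ordered_functor "G0 (L0 G)" "G0 (L0 G)" "id_func (G0 (L0 G))" by (rule id)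
  have mono: "(lcomp sigma X, lcomp sigma Y) \<in> Le (G0 (L0 G)) \<and> (lcomp sigma' X, lcomp sigma' Y) \<in> Le (G0 (L0 G))"
    if XY: "obj_le (G0 (L0 G)) X Y" for X Y
  proof -
    obtain m where m: "Y = sub (L0 G) m" "m \<in> Arr (L0 G)" using GL.obj_leD(2)[OF XY] by (rule L.G0_objE)
    obtain h where h: "h \<in> Arr (L0 G)" "Cod (L0 G) h = Dom (L0 G) m" "X = sub (L0 G) (m \<cdot>\<^bsub>L0 G\<^esub> h)"
      using XY m L.obj_le_G0_iff by blast
    show ?thesis using m h by (simp add: L.Le_G0I)
  qed
  have obj: "lcomp sigma X \<in> Arr (G0 (L0 G)) \<and> Dom (G0 (L0 G)) (lcomp sigma X) = omap (comp_func eps_inv (eps G)) X \<and>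
      Cod (G0 (L0 G)) (lcomp sigma X) = X \<and>
      lcomp sigma' X \<in> Arr (G0 (L0 G)) \<and> Dom (G0 (L0 G)) (lcomp sigma' X) = X \<and>
      Cod (G0 (L0 G)) (lcomp sigma' X) = omap (comp_func eps_inv (eps G)) X" if X: "X \<in> Obj (G0 (L0 G))" for X
  proof -
    obtain m where m: "X = sub (L0 G) m" "m \<in> Arr (L0 G)" using X by (rule L.G0_objE)
    then show ?thesis by (simp del: comp_func_simps)
  qed
  have nat: "x \<cdot>\<^bsub>G0 (L0 G)\<^esub> lcomp sigma (Dom (G0 (L0 G)) x) =
      lcomp sigma (Cod (G0 (L0 G)) x) \<cdot>\<^bsub>G0 (L0 G)\<^esub> amap (comp_func eps_inv (eps G)) x \<and>
    amap (comp_func eps_inv (eps G)) x \<cdot>\<^bsub>G0 (L0 G)\<^esub> lcomp sigma' (Dom (G0 (L0 G)) x) =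
      lcomp sigma' (Cod (G0 (L0 G)) x) \<cdot>\<^bsub>G0 (L0 G)\<^esub> x" if x: "x \<in> Arr (G0 (L0 G))" for x
  proof -
    obtain m n where "x = span (L0 G) m n" "m \<in> Arr (L0 G)" "n \<in> Arr (L0 G)" "Dom (L0 G) m = Dom (L0 G) n"
      using x by (rule L.G0_arrE)
    then show ?thesis by (simp del: comp_func_simps)
  qed
  \<comment> \<open>The composite \<open>eps_inv\<close> after \<open>eps\<close> stays folded, so
    that \<open>obj\<close> and \<open>nat\<close> match it.\<close>
  note [simp del] = comp_func_simps
  show "lambda_trans (G0 (L0 G)) (G0 (L0 G)) sigma"
  proof (rule lambda_transI)
    have "omap (id_func (G0 (L0 G))) = (\<lambda>X\<in>Obj (G0 (L0 G)). Cod (G0 (L0 G)) (lcomp sigma X))"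
      by (rule extensionalityI[OF ID.extensional(1)]) (simp_all add: obj)
    moreover have "amap (id_func (G0 (L0 G))) = (\<lambda>f\<in>Arr (G0 (L0 G)). restr (G0 (L0 G)) (amap (ltrg sigma) f)
        (Cod (G0 (L0 G)) (lcomp sigma (Dom (G0 (L0 G)) f))))"
      by (rule extensionalityI[OF ID.extensional(2)]) (simp_all add: obj)
    ultimately show "lmid sigma = \<lparr>fdom = G0 (L0 G), fcod = G0 (L0 G), omap = \<lambda>X\<in>Obj (G0 (L0 G)). Cod (G0 (L0 G)) (lcomp sigma X),
        amap = \<lambda>f\<in>Arr (G0 (L0 G)). restr (G0 (L0 G)) (amap (ltrg sigma) f) (Cod (G0 (L0 G)) (lcomp sigma (Dom (G0 (L0 G)) f)))\<rparr>"
      by (intro func.equality) (simp_all add: sigma_def)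
  qed (use nat obj mono qe id in \<open>simp_all\<close>, simp add: sigma_def)
  show "lambda_trans (G0 (L0 G)) (G0 (L0 G)) sigma'"
  proof (rule lambda_transI)
    have "omap (comp_func eps_inv (eps G)) = (\<lambda>X\<in>Obj (G0 (L0 G)). Cod (G0 (L0 G)) (lcomp sigma' X))"
      by (rule extensionalityI[OF QE.extensional(1)]) (simp_all add: obj)
    moreover have "amap (comp_func eps_inv (eps G)) = (\<lambda>f\<in>Arr (G0 (L0 G)). restr (G0 (L0 G)) (amap (ltrg sigma') f)
        (Cod (G0 (L0 G)) (lcomp sigma' (Dom (G0 (L0 G)) f))))"
      by (rule extensionalityI[OF QE.extensional(2)]) (simp_all add: obj)
    ultimately show "lmid sigma' = \<lparr>fdom = G0 (L0 G), fcod = G0 (L0 G), omap = \<lambda>X\<in>Obj (G0 (L0 G)). Cod (G0 (L0 G)) (lcomp sigma' X),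
        amap = \<lambda>f\<in>Arr (G0 (L0 G)). restr (G0 (L0 G)) (amap (ltrg sigma') f) (Cod (G0 (L0 G)) (lcomp sigma' (Dom (G0 (L0 G)) f)))\<rparr>"
      by (intro func.equality) (simp_all add: sigma'_def)
  qed (use nat obj mono qe id in \<open>simp_all\<close>, simp add: sigma'_def)
qed

lemma equivalence1_eps: "equivalence1 oGpd_max (eps G)"
proof -
  note qe = ordered_functor_comp[OF ordered_functor_eps ordered_functor_eps_inv]
  note id = ordered_functor_id[OF L.ordered_groupoid_G0]
  note s = lambda_trans_sigma(1) and s' = lambda_trans_sigma(2)
  have 1: "lvcomp sigma' sigma = lid (comp_func eps_inv (eps G))"
  proof (rule ltrans_eqI[OF lambda_trans_lvcomp[OF s s'] lambda_trans_lid[OF qe]])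
    fix X assume X: "X \<in> Obj (G0 (L0 G))"
    then obtain m where m: "X = sub (L0 G) m" "m \<in> Arr (L0 G)" by (rule L.G0_objE)
    \<comment> \<open>The component of \<open>sigma\<close> ends exactly at \<open>X\<close>, so the
      restriction in the vertical composite is trivial and the two opposite spans compose to an
      identity.\<close>
    then show "lcomp (lvcomp sigma' sigma) X = lcomp (lid (comp_func eps_inv (eps G))) X"
      unfolding lcomp_lvcomp[OF s X] using X
      by (simp add: eps_inv_eps_simps(1)[simplified comp_func_simps(3)] ordered_groupoid.restr_Dom[OF L.ordered_groupoid_G0] omap_eps_inv del: eps_inv_simps(3))
  qed simp_all
  have 2: "lvcomp sigma sigma' = lid (id_func (G0 (L0 G)))"
  proof (rule ltrans_eqI[OF lambda_trans_lvcomp[OF s' s] lambda_trans_lid[OF id]])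
    fix X assume X: "X \<in> Obj (G0 (L0 G))"
    then obtain m where m: "X = sub (L0 G) m" "m \<in> Arr (L0 G)" by (rule L.G0_objE)
    then show "lcomp (lvcomp sigma sigma') X = lcomp (lid (id_func (G0 (L0 G)))) X"
      unfolding lcomp_lvcomp[OF s' X] using X
      by (simp add: ordered_groupoid.restr_Dom[OF L.ordered_groupoid_G0])
  qed simp_all
  have "isomorphic1 oGpd_max (comp_func eps_inv (eps G)) (id_func (G0 (L0 G)))"
    using 1 2 lambda_trans.lambda_transformation[OF s] lambda_trans.lambda_transformation[OF s'] L.has_unique_maximal_G0
    by (intro isomorphic1I[of sigma _ _ _ sigma']) (simp_all add: hom2_def)
  \<comment> \<open>By \<open>eps_eps_inv\<close> this composite equals the identity strictly, so
    the identity 2-cell serves as the isomorphism.\<close>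
  moreover have "isomorphic1 oGpd_max (id_func G) (id_func G)"
  proof -
    note i = lambda_trans_lid[OF ordered_functor_id[OF ordered_groupoid_axioms]]
    have "lvcomp (lid (id_func G)) (lid (id_func G)) = lid (id_func G)"
    proof (rule ltrans_eqI[OF lambda_trans_lvcomp[OF i i] i])
      fix X assume "X \<in> Obj G"
      then show "lcomp (lvcomp (lid (id_func G)) (lid (id_func G))) X = lcomp (lid (id_func G)) X"
        by (simp add: lcomp_lvcomp[OF i])
    qed simp_all
    then show ?thesis using lambda_trans.lambda_transformation[OF i] has_max
      by (intro isomorphic1I[of "lid (id_func G)" _ _ _ "lid (id_func G)"]) (simp_all add: hom2_def)
  qed
  ultimately show ?thesis
    using eps_eps_inv ordered_functor_double[OF ordered_functor_eps] ordered_functor_double[OF ordered_functor_eps_inv]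
      has_max L.has_unique_maximal_G0
    by (auto simp: equivalence1_def hom1_def intro!: bexI[of _ eps_inv])
qed

end

theorem corollary5p2:
  shows "two_functor (oGpd_max :: 'u::infinite oGpd2) (lcCat :: 'u Cat2) Lfun \<and>
         two_functor (lcCat :: 'u Cat2) (oGpd_max :: 'u oGpd2) Gfun \<and>
         two_adjoint_biequivalence (lcCat :: 'u Cat2) (oGpd_max :: 'u oGpd2) Gfun Lfun"
proof (intro conjI two_functor_L_max two_functor_G)
  have "equivalence1 lcCat (eta C)" if "C \<in> Obj0 lcCat" for C :: "'u cat"
    using that by (simp add: equivalence1_eta lc_categoryI)
  moreover have "equivalence1 oGpd_max (eps G)" if "G \<in> Obj0 oGpd_max" for G :: "'u ogpd"
    using that by (intro max_ordered_groupoid.equivalence1_eps)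
      (simp add: max_ordered_groupoid_def max_ordered_groupoid_axioms_def infinite_ordered_groupoid_def)
  ultimately show "two_adjoint_biequivalence (lcCat :: 'u Cat2) (oGpd_max :: 'u oGpd2) Gfun Lfun"
    using two_adjunction_G_L unfolding two_adjoint_biequivalence_def by blast
qed

end
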